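(* Let $\overline{M}^{m+n}$ be a Riemannian manifold of dimension $m+n$, let $\Sigma$ be an $m$-dimensional submanifold isometrically immersed in $\overline{M}$ with $m\geq 2$, and let $q\in\Sigma$. Fix an integer $s$ with $0<s\leq m-1$. Assume that, as $M$ ranges over all $(s+n)$-dimensional submanifolds of $\overline{M}$ through $q$ which are totally geodesic at $q$ and satisfy $T_q^{\bot}\Sigma\subset T_qM$, the mean curvature vector at $q$ of the $s$-dimensional submanifold $S_M:=M\cap\Sigma$ is always the same (that is, it does not depend on $M$). Then the point $q\in\Sigma$ is umbilic.
   Context: $T_q^{\bot}\Sigma$ denotes the normal space of $\Sigma$ at $q$ in $T_q\overline{M}$. For a $k$-dimensional isometrically immersed submanifold $S$ of $\overline{M}$, the second fundamental form ${\rm II}_S$ is defined by the Gauss formula $\overline{\nabla}_XY=\nabla^S_XY+{\rm II}_S(X,Y)$, where $\overline{\nabla}$ is the Levi-Civita connection of $\overline{M}$ and $\nabla^S$ the induced connection, and the mean curvature vector of $S$ at $p$ is ${\rm H}(p)=\frac1k\,{\rm trace}\,{\rm II}_S(p)$. A point $p\in S$ is umbilic if ${\rm II}_S(u,v)=\overline{g}(u,v)\,{\rm H}(p)$ for all $u,v\in T_pS$. A submanifold $M$ is totally geodesic at $q\in M$ if every geodesic of $M$ with initial vector in $T_qM$ is a geodesic of $\overline{M}$ for all parameters in some neighborhood of $0$. Near $q$, the intersection $S_M=M\cap\Sigma$ is an $s$-dimensional submanifold (since $T_qM+T_q\Sigma=T_q\overline{M}$), regarded as a submanifold of $\overline{M}$;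 for $s=1$ it is a curve regarded as a $1$-dimensional submanifold. *)

theory Defs
  imports "HOL-Analysis.Analysis"
begin

section \<open>Smooth functions between normed spaces\<close>

text \<open>Meant for open \<open>S\<close>: the derivative is the one in the ambient vector space.\<close>

primrec times_diff_on ::
  "nat \<Rightarrow> 'a::real_normed_vector set \<Rightarrow> ('a \<Rightarrow> 'b::real_normed_vector) \<Rightarrow> bool" where
  "times_diff_on 0 S F \<longleftrightarrow> continuous_on S F"
| "times_diff_on (Suc k) S F \<longleftrightarrow>
     (\<forall>x\<in>S. F differentiable (at x)) \<and>
     (\<forall>v. times_diff_on k S (\<lambda>x. frechet_derivative F (at x) v))"

definition smooth_on ::
  "'a::real_normed_vector set \<Rightarrow> ('a \<Rightarrow> 'b::real_normed_vector) \<Rightarrow> bool" where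
  "smooth_on S F \<longleftrightarrow> (\<forall>k. times_diff_on k S F)"

section \<open>Smooth and Riemannian manifolds\<close>

text \<open>
  A chart is a domain together with a coordinate map. A manifold is a subset \<open>points\<close> of a
  Hausdorff second countable space, with the subspace topology and a (not necessarily maximal)
  smooth atlas. The point set need not be open in the surrounding type, so the same notion
  serves for ambient manifolds, embedded submanifolds and abstract immersed manifolds. The
  dimension is that of the Euclidean space \<open>'e\<close> in which the charts take their values.

  Tensors are given by their components: a tangent vector at \<open>p\<close> is, in a chart around \<open>p\<close>, a
  vector of \<open>'e\<close>, and \<open>metric R c x u v\<close> is the inner product of the vectors with components
  \<open>u\<close> and \<open>v\<close> in the chart \<open>c\<close>, at the point with coordinates \<open>x\<close> in \<open>c\<close>.
\<close>

type_synonym ('p, 'e) chart = "'p set \<times> ('p \<Rightarrow> 'e)"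

type_synonym 'e metric_field = "'e \<Rightarrow> 'e \<Rightarrow> 'e \<Rightarrow> real"

record ('p, 'e) riem =
  points :: "'p set"
  charts :: "('p, 'e) chart set"
  metric :: "('p, 'e) chart \<Rightarrow> 'e metric_field"

abbreviation cdom :: "('p, 'e) chart \<Rightarrow> 'p set" where "cdom c \<equiv> fst c"

abbreviation cmap :: "('p, 'e) chart \<Rightarrow> 'p \<Rightarrow> 'e" where "cmap c \<equiv> snd c"

definition cinv :: "('p, 'e) chart \<Rightarrow> 'e \<Rightarrow> 'p" where
  "cinv c = inv_into (cdom c) (cmap c)"

definition charts_at :: "('p, 'e) riem \<Rightarrow> 'p \<Rightarrow> ('p, 'e) chart set" where
  "charts_at R p = {c \<in> charts R. p \<in> cdom c}"

text \<open>Coordinate expression of \<open>f\<close>, and the set of coordinates on which it is meaningful.\<close>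

definition rep :: "('b, 'k) chart \<Rightarrow> ('p, 'e) chart \<Rightarrow> ('b \<Rightarrow> 'p) \<Rightarrow> 'k \<Rightarrow> 'e" where
  "rep b c f = cmap c \<circ> f \<circ> cinv b"

definition rep_dom :: "('b, 'k) chart \<Rightarrow> ('p, 'e) chart \<Rightarrow> ('b \<Rightarrow> 'p) \<Rightarrow> 'k set" where
  "rep_dom b c f = cmap b ` {z \<in> cdom b. f z \<in> cdom c}"

definition smooth_manifold ::
  "('p::{t2_space,second_countable_topology}, 'e::euclidean_space) riem \<Rightarrow> bool" where
  "smooth_manifold R \<longleftrightarrow>
     (\<Union>c\<in>charts R. cdom c) = points R \<and>
     (\<forall>c\<in>charts R. openin (top_of_set (points R)) (cdom c) \<and>
        open (cmap c ` cdom c) \<and>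
        homeomorphism (cdom c) (cmap c ` cdom c) (cmap c) (cinv c)) \<and>
     (\<forall>c\<in>charts R. \<forall>d\<in>charts R. smooth_on (rep_dom c d (\<lambda>z. z)) (rep c d (\<lambda>z. z)))"

definition riemannian_manifold ::
  "('p::{t2_space,second_countable_topology}, 'e::euclidean_space) riem \<Rightarrow> bool" where
  "riemannian_manifold R \<longleftrightarrow>
     smooth_manifold R \<and>
     (\<forall>c\<in>charts R. \<forall>x\<in>cmap c ` cdom c.
        bilinear (metric R c x) \<and>
        (\<forall>u v. metric R c x u v = metric R c x v u) \<and>
        (\<forall>u. u \<noteq> 0 \<longrightarrow> metric R c x u u > 0)) \<and>
     (\<forall>c\<in>charts R. \<forall>u v. smooth_on (cmap c ` cdom c) (\<lambda>x. metric R c x u v)) \<and>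
     (\<forall>c\<in>charts R. \<forall>d\<in>charts R. \<forall>x\<in>rep_dom c d (\<lambda>z. z).
        let T = rep c d (\<lambda>z. z); DT = frechet_derivative T (at x)
        in \<forall>u v. metric R c x u v = metric R d (T x) (DT u) (DT v))"

section \<open>Isometric immersions\<close>

definition smooth_immersion ::
  "('b::{t2_space,second_countable_topology}, 'k::euclidean_space) riem \<Rightarrow>
   ('p::{t2_space,second_countable_topology}, 'e::euclidean_space) riem \<Rightarrow>
   ('b \<Rightarrow> 'p) \<Rightarrow> bool" where
  "smooth_immersion N R f \<longleftrightarrow>
     f ` points N \<subseteq> points R \<and> continuous_on (points N) f \<and>
     (\<forall>b\<in>charts N. \<forall>c\<in>charts R.
        smooth_on (rep_dom b c f) (rep b c f) \<and>
        (\<forall>x\<in>rep_dom b c f. inj (frechet_derivative (rep b c f) (at x))))"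

definition isometric_immersion ::
  "('b::{t2_space,second_countable_topology}, 'k::euclidean_space) riem \<Rightarrow>
   ('p::{t2_space,second_countable_topology}, 'e::euclidean_space) riem \<Rightarrow>
   ('b \<Rightarrow> 'p) \<Rightarrow> bool" where
  "isometric_immersion N R f \<longleftrightarrow>
     smooth_immersion N R f \<and>
     (\<forall>b\<in>charts N. \<forall>c\<in>charts R. \<forall>x\<in>rep_dom b c f.
        let Df = frechet_derivative (rep b c f) (at x)
        in \<forall>u v. metric N b x u v = metric R c (rep b c f x) (Df u) (Df v))"

text \<open>Embeddedness holds because \<open>points M\<close> carries the subspace topology.\<close>

definition submanifold ::
  "('p::{t2_space,second_countable_topology}, 'k::euclidean_space) riem \<Rightarrow>
   ('p, 'e::euclidean_space) riem \<Rightarrow> bool" where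
  "submanifold M R \<longleftrightarrow> riemannian_manifold M \<and> isometric_immersion M R (\<lambda>z. z)"

text \<open>Tangent and normal spaces of an immersion at \<open>p\<close>, in components with respect to the chart
  \<open>c\<close> of the ambient manifold around \<open>f p\<close>.\<close>

definition tangent_subspace ::
  "('b, 'k::real_normed_vector) riem \<Rightarrow> ('b \<Rightarrow> 'p) \<Rightarrow> ('p, 'e::real_normed_vector) chart \<Rightarrow> 'b \<Rightarrow> 'e set"
  where
  "tangent_subspace N f c p =
     (\<Union>b\<in>charts_at N p. range (frechet_derivative (rep b c f) (at (cmap b p))))"

definition normal_subspace ::
  "('b, 'k::real_normed_vector) riem \<Rightarrow> ('p, 'e::real_normed_vector) riem \<Rightarrow> ('b \<Rightarrow> 'p) \<Rightarrow>
   ('p, 'e) chart \<Rightarrow> 'b \<Rightarrow> 'e set" where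
  "normal_subspace N R f c p =
     {w. \<forall>u\<in>tangent_subspace N f c p. metric R c (cmap c (f p)) u w = 0}"

section \<open>Levi-Civita connection and geodesics\<close>

text \<open>The Levi-Civita connection of the metric field \<open>h\<close> is \<open>\<nabla>\<^sub>u Y = D Y u + \<Gamma> u Y\<close>, where the
  Christoffel map \<open>\<Gamma>\<close> at \<open>x\<close> is symmetric (no torsion) and compatible with \<open>h\<close>.\<close>

definition christoffel :: "'e::euclidean_space metric_field \<Rightarrow> 'e \<Rightarrow> 'e \<Rightarrow> 'e \<Rightarrow> 'e" where
  "christoffel h x = (THE \<Gamma>. bilinear \<Gamma> \<and> (\<forall>u v. \<Gamma> u v = \<Gamma> v u) \<and>
     (\<forall>u v z. frechet_derivative (\<lambda>y. h y u v) (at x) z = h x (\<Gamma> z u) v + h x u (\<Gamma> z v)))"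

text \<open>Covariant derivative in direction \<open>u\<close> at \<open>x\<close> of a vector field \<open>Z\<close> along the map \<open>y\<close>.\<close>

definition cov_deriv ::
  "'e::euclidean_space metric_field \<Rightarrow> ('k::real_normed_vector \<Rightarrow> 'e) \<Rightarrow> ('k \<Rightarrow> 'e) \<Rightarrow> 'k \<Rightarrow> 'k \<Rightarrow> 'e"
  where
  "cov_deriv h y Z x u =
     frechet_derivative Z (at x) u + christoffel h (y x) (frechet_derivative y (at x) u) (Z x)"

definition geodesic ::
  "('p::{t2_space,second_countable_topology}, 'e::euclidean_space) riem \<Rightarrow>
   real set \<Rightarrow> (real \<Rightarrow> 'p) \<Rightarrow> bool" where
  "geodesic R J \<gamma> \<longleftrightarrow>
     open J \<and> is_interval J \<and> continuous_on J \<gamma> \<and> \<gamma> ` J \<subseteq> points R \<and>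
     (\<forall>c\<in>charts R. let y = cmap c \<circ> \<gamma> in
        smooth_on {t \<in> J. \<gamma> t \<in> cdom c} y \<and>
        (\<forall>t\<in>J. \<gamma> t \<in> cdom c \<longrightarrow>
           cov_deriv (metric R c) y (\<lambda>r. frechet_derivative y (at r) 1) t 1 = 0))"

definition totally_geodesic_at ::
  "('p::{t2_space,second_countable_topology}, 'k::euclidean_space) riem \<Rightarrow>
   ('p, 'e::euclidean_space) riem \<Rightarrow> 'p \<Rightarrow> bool" where
  "totally_geodesic_at M R q \<longleftrightarrow>
     (\<forall>J \<gamma>. geodesic M J \<gamma> \<and> 0 \<in> J \<and> \<gamma> 0 = q \<longrightarrow>
        (\<exists>\<epsilon>>0. {-\<epsilon><..<\<epsilon>} \<subseteq> J \<and> geodesic R {-\<epsilon><..<\<epsilon>} \<gamma>))"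

section \<open>Second fundamental form, mean curvature, umbilic points\<close>

text \<open>
  Gauss formula for an isometric immersion \<open>f\<close> of \<open>N\<close> into \<open>R\<close>. The arguments \<open>u\<close>, \<open>v\<close> are the
  components of tangent vectors of \<open>N\<close> at \<open>p\<close> in the chart \<open>b\<close>, the result has components in the
  chart \<open>c\<close>. As the second fundamental form is tensorial, \<open>v\<close> may be extended to the field whose
  components in \<open>b\<close> are constant.
\<close>

definition second_fundamental_form ::
  "('b, 'k::euclidean_space) riem \<Rightarrow> ('p, 'e::euclidean_space) riem \<Rightarrow> ('b \<Rightarrow> 'p) \<Rightarrow>
   ('b, 'k) chart \<Rightarrow> ('p, 'e) chart \<Rightarrow> 'b \<Rightarrow> 'k \<Rightarrow> 'k \<Rightarrow> 'e" where
  "second_fundamental_form N R f b c p u v =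
     (let y = rep b c f; x = cmap b p in
        cov_deriv (metric R c) y (\<lambda>a. frechet_derivative y (at a) v) x u -
        frechet_derivative y (at x) (cov_deriv (metric N b) (\<lambda>a. a) (\<lambda>a. v) x u))"

definition orthonormal_frame :: "('k::euclidean_space \<Rightarrow> 'k \<Rightarrow> real) \<Rightarrow> 'k set \<Rightarrow> bool" where
  "orthonormal_frame h E \<longleftrightarrow>
     card E = DIM('k) \<and> (\<forall>u\<in>E. \<forall>v\<in>E. h u v = (if u = v then 1 else 0))"

text \<open>The trace does not depend on the chosen frame.\<close>

definition mean_curvature ::
  "('b, 'k::euclidean_space) riem \<Rightarrow> ('p, 'e::euclidean_space) riem \<Rightarrow> ('b \<Rightarrow> 'p) \<Rightarrow>
   ('b, 'k) chart \<Rightarrow> ('p, 'e) chart \<Rightarrow> 'b \<Rightarrow> 'e" where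
  "mean_curvature N R f b c p =
     (1 / real DIM('k)) *\<^sub>R
     (\<Sum>e\<in>(SOME E. orthonormal_frame (metric N b (cmap b p)) E).
        second_fundamental_form N R f b c p e e)"

definition umbilic_at ::
  "('b, 'k::euclidean_space) riem \<Rightarrow> ('p, 'e::euclidean_space) riem \<Rightarrow> ('b \<Rightarrow> 'p) \<Rightarrow> 'b \<Rightarrow> bool"
  where
  "umbilic_at N R f p \<longleftrightarrow>
     (\<forall>b\<in>charts_at N p. \<forall>c\<in>charts_at R (f p). \<forall>u v.
        let Df = frechet_derivative (rep b c f) (at (cmap b p)) in
        second_fundamental_form N R f b c p u v =
        metric R c (cmap c (f p)) (Df u) (Df v) *\<^sub>R mean_curvature N R f b c p)"

section \<open>Intersection with an immersed submanifold\<close>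

text \<open>
  \<open>S\<close> is the intersection of \<open>M\<close> with the submanifold immersed by \<open>f\<close>, near \<open>q\<close>: as a point set
  it is the part of the preimage of \<open>M\<close> in a neighborhood \<open>V\<close> of \<open>q\<close>, and it is an embedded
  Riemannian submanifold of the immersed manifold. It is a submanifold of the ambient
  manifold through the restriction of \<open>f\<close>.
\<close>

definition local_intersection ::
  "('b::{t2_space,second_countable_topology}, 'l::euclidean_space) riem \<Rightarrow>
   ('p::{t2_space,second_countable_topology}, 'k::euclidean_space) riem \<Rightarrow>
   ('b, 'm::euclidean_space) riem \<Rightarrow> ('b \<Rightarrow> 'p) \<Rightarrow> 'b \<Rightarrow> bool" where
  "local_intersection S M N f q \<longleftrightarrow>
     (\<exists>V. openin (top_of_set (points N)) V \<and> q \<in> V \<and> points S = {z \<in> V. f z \<in> points M}) \<and>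
     submanifold S N"

end

theory Submission
  imports Defs
begin

text \<open>Let \<open>W\<close> be an \<open>s\<close>-dimensional subspace of the tangent space of \<open>\<Sigma>\<close> at \<open>q\<close>. The image \<open>M\<close> under the
  exponential map at \<open>q\<close> of the sum of \<open>W\<close> and the normal space is totally geodesic at \<open>q\<close>, so the second
  fundamental form of \<open>S = M \<inter> \<Sigma>\<close> at \<open>q\<close> is tangent to \<open>M\<close> and normal to \<open>W\<close>. Hence it is normal to \<open>\<Sigma>\<close> and
  coincides on \<open>W\<close> with the second fundamental form \<open>II\<close> of \<open>\<Sigma>\<close>, and the mean curvature vector of \<open>S\<close> is the
  normalized trace of \<open>II\<close> over \<open>W\<close>. If these traces agree for all \<open>W\<close>, then \<open>II\<close> is a multiple of the metric.

  The smooth exponential map is obtained by solving the geodesic equation for the acceleration, as a fixed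
  point in a space of bounded continuous functions. Smooth dependence on the initial velocity is an induction
  on the order of differentiability: the derivative of the fixed point solves a linear equation whose
  coefficients are as smooth as the fixed point is already known to be. The same lemma on linear equations
  gives smoothness of Christoffel symbols and of inverse functions.\<close>

section \<open>Higher-order calculus on open subsets of normed spaces\<close>

section \<open>Calculus of smooth functions\<close>

text \<open>Total geodesy of \<open>M\<close> concerns all geodesics of \<open>M\<close> through the
  point, whereas the exponential map exhibits only the radial ones; hence a local uniqueness
  statement for the geodesic equation is needed besides existence. Both are linked by the radial
  identity, which says that the curve \<open>F (t *\<^sub>R v)\<close> has no covariant
  acceleration. Split into parts tangent and normal to \<open>M\<close>, it shows that rays are
  geodesics in the chart of \<open>M\<close> and that the second fundamental form of
  \<open>M\<close> vanishes at the centre.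

  Taking the acceleration as unknown leaves no derivative in the fixed point equation, so the sup
  norm suffices. The time interval stays [-1, 1] and the initial velocity is made small instead: the
  right side is quadratic in the velocity, so its derivative vanishes at velocity zero, which yields
  the contraction constant. Homogeneity then turns the time-one map on a ray into a trajectory.

  Smoothness is given by iterated directional derivatives in fixed directions. Where a derivative
  meets a moving direction, it is expanded in a basis, which is why the source spaces are
  Euclidean.\<close>

abbreviation fderiv :: "('a::real_normed_vector \<Rightarrow> 'b::real_normed_vector) \<Rightarrow> 'a \<Rightarrow> 'a \<Rightarrow> 'b" where
  "fderiv F x \<equiv> frechet_derivative F (at x)"

lemma fderiv_eq: "(F has_derivative F') (at x) \<Longrightarrow> fderiv F x = F'"
  by (metis frechet_derivative_at)

lemma fderiv_cong:
  assumes "open S" "x \<in> S" "\<And>y. y \<in> S \<Longrightarrow> F y = G y"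
  shows "fderiv F x = fderiv G x"
proof -
  have "(F has_derivative F') (at x) \<longleftrightarrow> (G has_derivative F') (at x)" for F'
    using has_derivative_transform_within_open[of F F' x UNIV S G]
      has_derivative_transform_within_open[of G F' x UNIV S F] assms by auto
  then show ?thesis
    by (simp add: frechet_derivative_def)
qed

text \<open>On an open set the ambient derivative at a point only sees nearby points of the set, so
  agreement passes to every iterated derivative.\<close>

lemma times_diff_on_cong:
  assumes "open S" "\<And>x. x \<in> S \<Longrightarrow> F x = G x"
  shows "times_diff_on k S F \<longleftrightarrow> times_diff_on k S G"
  using assms(2)
proof (induction k arbitrary: F G)
  case 0
  then show ?case by (simp cong: continuous_on_cong)
next
  case (Suc k)
  have "F differentiable (at x) \<longleftrightarrow> G differentiable (at x)" if "x \<in> S" for x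
    using differentiable_transform_within[of F x UNIV _ G] assms(1) that Suc.prems
    by (metis differentiable_def has_derivative_transform_within_open)
  moreover have "times_diff_on k S (\<lambda>x. fderiv F x v) \<longleftrightarrow> times_diff_on k S (\<lambda>x. fderiv G x v)" for v
    by (rule Suc.IH) (metis fderiv_cong[OF assms(1)] Suc.prems)
  ultimately show ?case by auto
qed

text \<open>Allows any formula for the derivative in place of \<open>frechet_derivative\<close>;
  most closure properties below are inductions through this rule.\<close>

lemma times_diff_on_SucI:
  assumes "open S" "\<And>x. x \<in> S \<Longrightarrow> (F has_derivative F' x) (at x)"
    and "\<And>v. times_diff_on k S (\<lambda>x. F' x v)"
  shows "times_diff_on (Suc k) S F"
proof -
  have "times_diff_on k S (\<lambda>x. fderiv F x v) = times_diff_on k S (\<lambda>x. F' x v)" for v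
    by (rule times_diff_on_cong[OF assms(1)]) (metis assms(2) fderiv_eq)
  then show ?thesis using assms by (auto simp: differentiable_def)
qed

lemma times_diff_on_derivative:
  "times_diff_on (Suc k) S F \<Longrightarrow> x \<in> S \<Longrightarrow> (F has_derivative fderiv F x) (at x)"
  using frechet_derivative_works by auto

lemma times_diff_on_SucD: "times_diff_on (Suc k) S F \<Longrightarrow> times_diff_on k S F"
proof (induction k arbitrary: F)
  case 0
  then show ?case
    by (auto intro!: continuous_at_imp_continuous_on differentiable_imp_continuous_within)
qed simp

lemma times_diff_on_mono: "times_diff_on k S F \<Longrightarrow> l \<le> k \<Longrightarrow> times_diff_on l S F"
  by (induction k) (auto simp: le_Suc_eq dest: times_diff_on_SucD simp del: times_diff_on.simps(2))

lemma times_diff_on_subset: "times_diff_on k S F \<Longrightarrow> T \<subseteq> S \<Longrightarrow> times_diff_on k T F"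
  by (induction k arbitrary: F) (auto intro: continuous_on_subset)

lemma times_diff_on_const [simp]: "times_diff_on k S (\<lambda>x. c)"
  by (induction k arbitrary: c) auto

lemma times_diff_on_linear_comp:
  assumes L: "bounded_linear L" and S: "open S" and "times_diff_on k S F"
  shows "times_diff_on k S (\<lambda>x. L (F x))"
  using assms(3)
proof (induction k arbitrary: F)
  case 0
  then show ?case
    using L by (auto intro: linear_continuous_on_compose bounded_linear.continuous_on)
next
  case (Suc k)
  show ?case
    by (rule times_diff_on_SucI[OF S bounded_linear.has_derivative[OF L
          times_diff_on_derivative[OF Suc.prems]]]) (use Suc in auto)
qed

lemma times_diff_on_linear:
  assumes "bounded_linear L" "open S" shows "times_diff_on k S L"
proof (cases k)
  case 0
  then show ?thesis using assms by (simp add: linear_continuous_on)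
next
  case (Suc l)
  show ?thesis unfolding Suc
    by (rule times_diff_on_SucI[of _ _ "\<lambda>_. L"])
      (use assms in \<open>auto intro: bounded_linear_imp_has_derivative\<close>)
qed

lemma times_diff_on_id: "open S \<Longrightarrow> times_diff_on k S (\<lambda>x. x)"
  using times_diff_on_linear[OF bounded_linear_ident] .

lemma times_diff_on_add:
  assumes S: "open S" and "times_diff_on k S F" "times_diff_on k S G"
  shows "times_diff_on k S (\<lambda>x. F x + G x)"
  using assms(2,3)
proof (induction k arbitrary: F G)
  case 0
  then show ?case by (auto intro: continuous_intros)
next
  case (Suc k)
  show ?case
    by (rule times_diff_on_SucI[OF S has_derivative_add[OF
          times_diff_on_derivative[OF Suc.prems(1)] times_diff_on_derivative[OF Suc.prems(2)]]])
      (use Suc in auto)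
qed

lemma times_diff_on_sum:
  assumes S: "open S" and "\<And>i. i \<in> I \<Longrightarrow> times_diff_on k S (F i)"
  shows "times_diff_on k S (\<lambda>x. \<Sum>i\<in>I. F i x)"
  using assms(2)
  by (induction I rule: infinite_finite_induct) (auto intro!: times_diff_on_add[OF S])

text \<open>The product rule gives two terms of the same bilinear shape, so the induction closes. An
  arbitrary bounded \<open>B\<close> covers scalar multiples, composition of operators and the
  pointwise products of bounded functions used for the geodesic equation.\<close>

lemma times_diff_on_bilinear:
  assumes B: "bounded_bilinear B" and S: "open S"
    and "times_diff_on k S F" "times_diff_on k S G"
  shows "times_diff_on k S (\<lambda>x. B (F x) (G x))"
  using assms(3,4)
proof (induction k arbitrary: F G)
  case 0
  then show ?case using bounded_bilinear.continuous_on[OF B] by auto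
next
  case (Suc k)
  note * = Suc.prems[THEN times_diff_on_SucD]
  show ?case
    by (rule times_diff_on_SucI[OF S bounded_bilinear.FDERIV[OF B
          times_diff_on_derivative[OF Suc.prems(1)] times_diff_on_derivative[OF Suc.prems(2)]]])
      (use Suc * in \<open>auto intro!: times_diff_on_add[OF S] simp del: times_diff_on.simps(1)\<close>)
qed

lemma linear_eq_sum_Basis:
  fixes x :: "'a::euclidean_space"
  assumes "linear L"
  shows "L x = (\<Sum>i\<in>Basis. (x \<bullet> i) *\<^sub>R L i)"
proof -
  have "L x = L (\<Sum>i\<in>Basis. (x \<bullet> i) *\<^sub>R i)" by (simp add: euclidean_representation)
  also have "\<dots> = (\<Sum>i\<in>Basis. (x \<bullet> i) *\<^sub>R L i)"
    by (simp add: linear_sum[OF assms] linear_cmul[OF assms])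
  finally show ?thesis .
qed

text \<open>The chain rule applies the derivative of \<open>G\<close> in the direction
  \<open>fderiv F x v\<close>, which moves with \<open>x\<close>, while \<open>times_diff_on\<close>
  only controls fixed directions. Expanding it in a basis of the Euclidean middle space leaves the
  maps \<open>fderiv G (F x) i\<close>, to which the induction hypothesis applies.\<close>

lemma times_diff_on_compose:
  fixes F :: "'a::real_normed_vector \<Rightarrow> 'b::euclidean_space"
  assumes S: "open S" and U: "open U" and FU: "F ` S \<subseteq> U"
    and "times_diff_on k S F" "times_diff_on k U G"
  shows "times_diff_on k S (\<lambda>x. G (F x))"
  using assms(4,5)
proof (induction k arbitrary: G)
  case 0
  then show ?case using FU by (auto intro: continuous_on_compose2)
next
  case (Suc k)
  have FU': "F x \<in> U" if "x \<in> S" for x using FU that by blast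
  have F: "times_diff_on k S F" by (rule times_diff_on_SucD[OF Suc.prems(1)])
  show ?case
  proof (rule times_diff_on_SucI[OF S])
    fix x assume x: "x \<in> S"
    note d = times_diff_on_derivative[OF Suc.prems(2) FU'[OF x]]
    have "((\<lambda>x. G (F x)) has_derivative (\<lambda>v. fderiv G (F x) (fderiv F x v))) (at x)"
      using diff_chain_at[OF times_diff_on_derivative[OF Suc.prems(1) x] d] by (simp add: o_def)
    then show "((\<lambda>x. G (F x)) has_derivative
        (\<lambda>v. \<Sum>i\<in>Basis. (fderiv F x v \<bullet> i) *\<^sub>R fderiv G (F x) i)) (at x)"
      by (subst (asm) linear_eq_sum_Basis[OF has_derivative_linear[OF d]])
  next
    fix v
    show "times_diff_on k S (\<lambda>x. \<Sum>i\<in>Basis. (fderiv F x v \<bullet> i) *\<^sub>R fderiv G (F x) i)"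
      by (intro times_diff_on_sum[OF S] times_diff_on_bilinear[OF bounded_bilinear_scaleR S]
          times_diff_on_linear_comp[OF bounded_linear_inner_left S] Suc.IH F)
        (use Suc.prems in auto)
  qed
qed

lemma smooth_on_derivative: "smooth_on S F \<Longrightarrow> x \<in> S \<Longrightarrow> (F has_derivative fderiv F x) (at x)"
  using times_diff_on_derivative unfolding smooth_on_def by blast

lemma smooth_on_linear_fderiv: "smooth_on S F \<Longrightarrow> x \<in> S \<Longrightarrow> linear (fderiv F x)"
  using smooth_on_derivative has_derivative_linear by blast

lemma smooth_on_fderiv: "smooth_on S F \<Longrightarrow> smooth_on S (\<lambda>x. fderiv F x v)"
  unfolding smooth_on_def using times_diff_on.simps(2) by blast

lemma smooth_on_continuous: "smooth_on S F \<Longrightarrow> continuous_on S F"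
  unfolding smooth_on_def using times_diff_on.simps(1) by blast

lemma smooth_on_cong:
  "open S \<Longrightarrow> (\<And>x. x \<in> S \<Longrightarrow> F x = G x) \<Longrightarrow> smooth_on S F \<longleftrightarrow> smooth_on S G"
  unfolding smooth_on_def using times_diff_on_cong by metis

lemma smooth_on_subset: "smooth_on S F \<Longrightarrow> T \<subseteq> S \<Longrightarrow> smooth_on T F"
  unfolding smooth_on_def using times_diff_on_subset by blast

lemma smooth_on_const [simp]: "smooth_on S (\<lambda>x. c)"
  unfolding smooth_on_def by simp

lemma smooth_on_linear: "bounded_linear L \<Longrightarrow> open S \<Longrightarrow> smooth_on S L"
  unfolding smooth_on_def using times_diff_on_linear by blast

lemma smooth_on_id: "open S \<Longrightarrow> smooth_on S (\<lambda>x. x)"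
  unfolding smooth_on_def using times_diff_on_id by blast

lemma smooth_on_linear_comp:
  "bounded_linear L \<Longrightarrow> open S \<Longrightarrow> smooth_on S F \<Longrightarrow> smooth_on S (\<lambda>x. L (F x))"
  unfolding smooth_on_def using times_diff_on_linear_comp by blast

lemma smooth_on_add:
  "open S \<Longrightarrow> smooth_on S F \<Longrightarrow> smooth_on S G \<Longrightarrow> smooth_on S (\<lambda>x. F x + G x)"
  unfolding smooth_on_def using times_diff_on_add by blast

lemma smooth_on_sum:
  "open S \<Longrightarrow> (\<And>i. i \<in> I \<Longrightarrow> smooth_on S (F i)) \<Longrightarrow> smooth_on S (\<lambda>x. \<Sum>i\<in>I. F i x)"
  by (simp add: smooth_on_def times_diff_on_sum)

lemma smooth_on_bilinear:
  "bounded_bilinear B \<Longrightarrow> open S \<Longrightarrow> smooth_on S F \<Longrightarrow> smooth_on S G \<Longrightarrow>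
    smooth_on S (\<lambda>x. B (F x) (G x))"
  unfolding smooth_on_def using times_diff_on_bilinear by blast

lemma smooth_on_compose:
  fixes F :: "'a::real_normed_vector \<Rightarrow> 'b::euclidean_space"
  shows "open S \<Longrightarrow> open U \<Longrightarrow> F ` S \<subseteq> U \<Longrightarrow> smooth_on S F \<Longrightarrow> smooth_on U G \<Longrightarrow>
    smooth_on S (\<lambda>x. G (F x))"
  unfolding smooth_on_def using times_diff_on_compose by blast

lemma fderiv_compose:
  assumes "smooth_on S F" "smooth_on U G" "x \<in> S" "F x \<in> U"
  shows "fderiv (\<lambda>x. G (F x)) x v = fderiv G (F x) (fderiv F x v)"
proof -
  have "((\<lambda>x. G (F x)) has_derivative (\<lambda>v. fderiv G (F x) (fderiv F x v))) (at x)"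
    using diff_chain_at[OF smooth_on_derivative[OF assms(1,3)] smooth_on_derivative[OF assms(2,4)]]
    by (simp add: o_def)
  then show ?thesis by (simp add: fderiv_eq)
qed

lemma Blinfun_fderiv_apply:
  "smooth_on S F \<Longrightarrow> x \<in> S \<Longrightarrow> blinfun_apply (Blinfun (fderiv F x)) = fderiv F x"
  by (rule bounded_linear_Blinfun_apply[OF has_derivative_bounded_linear[OF smooth_on_derivative]])

text \<open>Upgrades fixed directions to the operator norm: in finite dimension the derivative is a
  finite sum of partial derivatives times coordinate functionals. This gives uniform estimates for
  the derivative on compact sets.\<close>

lemma smooth_on_Blinfun_fderiv:
  fixes F :: "'a::euclidean_space \<Rightarrow> 'b::real_normed_vector"
  assumes S: "open S" and F: "smooth_on S F"
  shows "smooth_on S (\<lambda>x. Blinfun (fderiv F x))"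
proof -
  have "Blinfun (fderiv F x) =
      (\<Sum>i\<in>Basis. blinfun_scaleR_left (fderiv F x i) o\<^sub>L blinfun_inner_left i)" if "x \<in> S" for x
  proof (rule blinfun_eqI)
    fix v
    have "blinfun_apply (Blinfun (fderiv F x)) v = fderiv F x v"
      by (simp only: Blinfun_fderiv_apply[OF F that])
    also have "\<dots> = (\<Sum>i\<in>Basis. (v \<bullet> i) *\<^sub>R fderiv F x i)"
      by (rule linear_eq_sum_Basis[OF smooth_on_linear_fderiv[OF F that]])
    finally show "blinfun_apply (Blinfun (fderiv F x)) v =
      blinfun_apply (\<Sum>i\<in>Basis. blinfun_scaleR_left (fderiv F x i) o\<^sub>L blinfun_inner_left i) v"
      by (simp add: blinfun.sum_left blinfun.bilinear_simps)
  qed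
  moreover have "smooth_on S (\<lambda>x. \<Sum>i\<in>Basis. blinfun_scaleR_left (fderiv F x i) o\<^sub>L
      (blinfun_inner_left i :: 'a \<Rightarrow>\<^sub>L real))"
    by (intro smooth_on_sum[OF S] smooth_on_bilinear[OF bounded_bilinear_blinfun_compose S]
        smooth_on_linear_comp[OF bounded_linear_blinfun_scaleR_left S] smooth_on_fderiv F smooth_on_const)
  ultimately show ?thesis using smooth_on_cong[OF S] by (metis (no_types, lifting))
qed

section \<open>Symmetry of second derivatives\<close>

text \<open>Mean value inequality for \<open>h\<close>, whose increment over [0, s] is the vector to
  be estimated. Its derivative compares \<open>F' _ u\<close> at two points that differ by
  \<open>s *\<^sub>R v\<close>; differentiability of \<open>F' _ u\<close> at \<open>x\<close>
  evaluates this to \<open>s *\<^sub>R B v\<close> up to \<open>e * s\<close>.\<close>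

lemma second_difference_bound:
  assumes F: "\<And>y. y \<in> ball x r \<Longrightarrow> (F has_derivative F' y) (at y)" and r: "r > 0"
    and B: "((\<lambda>y. F' y u) has_derivative B) (at x)" and e: "e > 0"
  shows "\<exists>d>0. \<forall>s. 0 < s \<and> s < d \<longrightarrow>
    norm (F (x + s *\<^sub>R u + s *\<^sub>R v) - F (x + s *\<^sub>R u) - F (x + s *\<^sub>R v) + F x - (s * s) *\<^sub>R B v)
      \<le> e * (s * s)"
proof -
  \<comment> \<open>All points involved lie within \<open>s * m\<close> of \<open>x\<close>. The
    tolerance \<open>e / (2 * m)\<close> is halved because two expansions around \<open>x\<close>
    are subtracted.\<close>
  define m where "m = norm u + norm v + 1"
  have m: "m > 0" by (simp add: m_def add_nonneg_pos)
  have "e / (2 * m) > 0" using e m by simp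
  then obtain d where d: "d > 0"
    and dB: "\<And>y. norm (y - x) < d \<Longrightarrow> norm (F' y u - F' x u - B (y - x)) \<le> e / (2 * m) * norm (y - x)"
    using B unfolding has_derivative_at_alt by blast
  interpret B: bounded_linear B using B by (rule has_derivative_bounded_linear)
  have "norm (F (x + s *\<^sub>R u + s *\<^sub>R v) - F (x + s *\<^sub>R u) - F (x + s *\<^sub>R v) + F x - (s * s) *\<^sub>R B v)
      \<le> e * (s * s)" if s: "0 < s" "s < min d r / m" for s
  proof -
    have sm: "s * m < d" "s * m < r" using s m by (auto simp: field_simps)
    define h where "h t = F (x + t *\<^sub>R u + s *\<^sub>R v) - F (x + t *\<^sub>R u) - (t * s) *\<^sub>R B v" for t
    define h' where "h' t a = a *\<^sub>R (F' (x + t *\<^sub>R u + s *\<^sub>R v) u - F' (x + t *\<^sub>R u) u - s *\<^sub>R B v)" for t and a :: real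
    have near: "norm (t *\<^sub>R u + s *\<^sub>R v) \<le> s * m" "norm (t *\<^sub>R u) \<le> s * m" if "t \<in> {0..s}" for t
    proof -
      have "norm (t *\<^sub>R u) \<le> s * norm u" using that by (simp add: mult_right_mono)
      moreover have "norm (s *\<^sub>R v) = s * norm v" using s by simp
      moreover have "s * norm u + s * norm v \<le> s * m" "s * norm u \<le> s * m"
        unfolding m_def using s by (auto simp: algebra_simps)
      ultimately show "norm (t *\<^sub>R u + s *\<^sub>R v) \<le> s * m" "norm (t *\<^sub>R u) \<le> s * m"
        using norm_triangle_ineq[of "t *\<^sub>R u" "s *\<^sub>R v"] by linarith+
    qed
    have "norm (h s - h 0) \<le> (e * s) * norm (s - 0)"
    proof (rule differentiable_bound[of "{0..s}" h h'])
      show "convex {0..s}" by simp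
      fix t assume t: "t \<in> {0..s}"
      have in_ball: "x + t *\<^sub>R u + s *\<^sub>R v \<in> ball x r" "x + t *\<^sub>R u \<in> ball x r"
        using near[OF t] sm by (auto simp: dist_norm algebra_simps intro: le_less_trans)
           (metis add_uminus_conv_diff minus_add_distrib norm_minus_cancel le_less_trans)
      have 1: "((\<lambda>t. F (x + t *\<^sub>R u + s *\<^sub>R v)) has_derivative (\<lambda>a. F' (x + t *\<^sub>R u + s *\<^sub>R v) (a *\<^sub>R u))) (at t)"
        by (rule has_derivative_compose[where g = F and f = "\<lambda>t. x + t *\<^sub>R u + s *\<^sub>R v", OF _ F[OF in_ball(1)]])
          (auto intro!: derivative_eq_intros)
      have 2: "((\<lambda>t. F (x + t *\<^sub>R u)) has_derivative (\<lambda>a. F' (x + t *\<^sub>R u) (a *\<^sub>R u))) (at t)"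
        by (rule has_derivative_compose[where g = F and f = "\<lambda>t. x + t *\<^sub>R u", OF _ F[OF in_ball(2)]])
          (auto intro!: derivative_eq_intros)
      have "(h has_derivative (\<lambda>a. F' (x + t *\<^sub>R u + s *\<^sub>R v) (a *\<^sub>R u) - F' (x + t *\<^sub>R u) (a *\<^sub>R u)
          - (a * s) *\<^sub>R B v)) (at t)"
        unfolding h_def
        by (intro has_derivative_diff 1 2) (auto intro!: derivative_eq_intros)
      then have "(h has_derivative h' t) (at t)"
        unfolding h'_def
        by (simp only: linear_cmul[OF has_derivative_linear[OF F[OF in_ball(1)]]]
            linear_cmul[OF has_derivative_linear[OF F[OF in_ball(2)]]] scaleR_diff_right scaleR_scaleR)
      then show "(h has_derivative h' t) (at t within {0..s})"
        by (rule has_derivative_at_withinI)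
      have dB': "norm (F' y u - F' x u - B (y - x)) \<le> e / (2 * m) * (s * m)"
        if "norm (y - x) \<le> s * m" for y
      proof -
        have "norm (F' y u - F' x u - B (y - x)) \<le> e / (2 * m) * norm (y - x)"
          using dB[of y] that sm by linarith
        also have "\<dots> \<le> e / (2 * m) * (s * m)" using that e m by (intro mult_left_mono) auto
        finally show ?thesis .
      qed
      have "norm (F' (x + t *\<^sub>R u + s *\<^sub>R v) u - F' x u - B (t *\<^sub>R u + s *\<^sub>R v)) \<le> e / (2 * m) * (s * m)"
        using dB'[of "x + t *\<^sub>R u + s *\<^sub>R v"] near(1)[OF t] by (simp add: add.assoc)
      moreover have "norm (F' (x + t *\<^sub>R u) u - F' x u - B (t *\<^sub>R u)) \<le> e / (2 * m) * (s * m)"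
        using dB'[of "x + t *\<^sub>R u"] near(2)[OF t] by simp
      moreover have "e / (2 * m) * (s * m) = e * s / 2" using m by simp
      moreover have eq: "F' (x + t *\<^sub>R u + s *\<^sub>R v) u - F' (x + t *\<^sub>R u) u - s *\<^sub>R B v =
          (F' (x + t *\<^sub>R u + s *\<^sub>R v) u - F' x u - B (t *\<^sub>R u + s *\<^sub>R v)) -
          (F' (x + t *\<^sub>R u) u - F' x u - B (t *\<^sub>R u))"
        by (simp add: B.add B.scaleR)
      ultimately have "norm (F' (x + t *\<^sub>R u + s *\<^sub>R v) u - F' (x + t *\<^sub>R u) u - s *\<^sub>R B v) \<le> e * s"
        using norm_triangle_ineq4[of "F' (x + t *\<^sub>R u + s *\<^sub>R v) u - F' x u - B (t *\<^sub>R u + s *\<^sub>R v)"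
          "F' (x + t *\<^sub>R u) u - F' x u - B (t *\<^sub>R u)"] unfolding eq by linarith
      then show "onorm (h' t) \<le> e * s"
        unfolding h'_def using e s
        by (intro onorm_bound) (auto simp: mult.commute[of "e * s"] intro: mult_left_mono)
    qed (use s in auto)
    then show ?thesis using s by (simp add: h_def algebra_simps)
  qed
  moreover have "min d r / m > 0" using d r m by simp
  ultimately show ?thesis by blast
qed

text \<open>Exchanging \<open>u\<close> and \<open>v\<close> does not change the second difference,
  so both mixed derivatives approximate it; with \<open>e\<close> a quarter of their distance the
  two errors add up to only half of that distance.\<close>

lemma second_fderiv_symmetric:
  assumes S: "open S" and F: "smooth_on S F" and x: "x \<in> S"
  shows "fderiv (\<lambda>y. fderiv F y v) x u = fderiv (\<lambda>y. fderiv F y u) x v" (is "?A = ?B")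
proof (rule ccontr)
  assume ne: "?A \<noteq> ?B"
  define e where "e = norm (?A - ?B) / 4"
  have e: "e > 0" using ne by (simp add: e_def)
  obtain r where r: "r > 0" "ball x r \<subseteq> S" using S x open_contains_ball by blast
  have F': "(F has_derivative fderiv F y) (at y)" if "y \<in> ball x r" for y
    using smooth_on_derivative[OF F] that r by auto
  have D: "((\<lambda>y. fderiv F y w) has_derivative fderiv (\<lambda>y. fderiv F y w) x) (at x)" for w
    by (rule smooth_on_derivative[OF smooth_on_fderiv[OF F] x])
  obtain d1 where d1: "d1 > 0" "\<And>s. 0 < s \<and> s < d1 \<Longrightarrow>
     norm (F (x + s *\<^sub>R u + s *\<^sub>R v) - F (x + s *\<^sub>R u) - F (x + s *\<^sub>R v) + F x - (s * s) *\<^sub>R ?B) \<le> e * (s * s)"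
    using second_difference_bound[OF F' r(1) D e, of u v] by blast
  obtain d2 where d2: "d2 > 0" "\<And>s. 0 < s \<and> s < d2 \<Longrightarrow>
     norm (F (x + s *\<^sub>R v + s *\<^sub>R u) - F (x + s *\<^sub>R v) - F (x + s *\<^sub>R u) + F x - (s * s) *\<^sub>R ?A) \<le> e * (s * s)"
    using second_difference_bound[OF F' r(1) D e, of v u] by blast
  define s where "s = min d1 d2 / 2"
  have s: "0 < s" "s < d1" "s < d2" using d1 d2 by (auto simp: s_def)
  define X where "X = F (x + s *\<^sub>R u + s *\<^sub>R v) - F (x + s *\<^sub>R u) - F (x + s *\<^sub>R v) + F x"
  have "norm (X - (s * s) *\<^sub>R ?B) \<le> e * (s * s)" using d1(2)[of s] s by (simp add: X_def)
  moreover have "norm (X - (s * s) *\<^sub>R ?A) \<le> e * (s * s)"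
    using d2(2)[of s] s by (simp add: X_def algebra_simps)
  ultimately have "norm ((X - (s * s) *\<^sub>R ?B) - (X - (s * s) *\<^sub>R ?A)) \<le> 2 * e * (s * s)"
    using norm_triangle_ineq4[of "X - (s * s) *\<^sub>R ?B" "X - (s * s) *\<^sub>R ?A"] by linarith
  then have "norm ((s * s) *\<^sub>R (?A - ?B)) \<le> 2 * e * (s * s)" by (simp add: algebra_simps)
  then have "norm (?A - ?B) * (s * s) \<le> 2 * e * (s * s)" by (simp add: mult.commute)
  then have "norm (?A - ?B) \<le> 2 * e" using s by (simp add: mult_le_cancel_right)
  then show False using e by (simp add: e_def)
qed

section \<open>Regularity by bootstrapping: solutions of linear equations and local inverses\<close>

section \<open>Linear equations with smooth coefficients\<close>

text \<open>\<open>L\<close> is the constant part of the operator and \<open>T (a y)\<close> the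
  varying one; in the applications \<open>L\<close> is the identity or zero. After subtracting the
  equations at \<open>y\<close> and \<open>x\<close> and using the lower bound at \<open>x\<close>,
  the one term that still contains \<open>w y - w x\<close> carries the small factor
  \<open>a y - a x\<close> and is absorbed.\<close>

lemma continuous_solution_linear_equation:
  fixes L :: "'w::real_normed_vector \<Rightarrow> 'x::real_normed_vector"
    and a :: "'s::real_normed_vector \<Rightarrow> 'z::real_normed_vector"
  assumes T: "bounded_bilinear T" and L: "bounded_linear L"
    and eq: "\<And>y. y \<in> S \<Longrightarrow> L (w y) + T (a y) (w y) = b y"
    and x: "x \<in> S" and bd: "\<And>v. norm v \<le> C * norm (L v + T (a x) v)"
    and a: "continuous_on S a" and b: "continuous_on S b"
  shows "continuous (at x within S) w"
proof -
  interpret T: bounded_bilinear T by fact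
  interpret L: bounded_linear L by fact
  obtain K where K: "K > 0" "\<And>p v. norm (T p v) \<le> norm p * norm v * K" using T.pos_bounded by blast
  define C' where "C' = max C 1"
  have bd': "norm v \<le> C' * norm (L v + T (a x) v)" for v
    using bd[of v] mult_right_mono[of C C' "norm (L v + T (a x) v)"] by (simp add: C'_def)
  have C': "C' > 0" by (simp add: C'_def)
  have at: "(a \<longlongrightarrow> a x) (at x within S)" and bt: "(b \<longlongrightarrow> b x) (at x within S)"
    using a b x by (auto simp: continuous_on_def)
  have "((\<lambda>y. norm (a y - a x)) \<longlongrightarrow> 0) (at x within S)"
    using at by (simp add: LIM_zero_iff tendsto_norm_zero_iff)
  \<comment> \<open>Below this threshold the term to be absorbed is at most half of
    \<open>norm (w y - w x)\<close>.\<close>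
  then have ev: "\<forall>\<^sub>F y in at x within S. norm (a y - a x) < 1 / (2 * C' * K)"
    by (rule order_tendstoD) (use C' K in simp)
  have evS: "\<forall>\<^sub>F y in at x within S. y \<in> S" by (simp add: eventually_at_filter)
  have "\<forall>\<^sub>F y in at x within S.
    norm (w y - w x) \<le> 2 * C' * (norm (b y - b x) + norm (a y - a x) * norm (w x) * K)"
    using ev evS
  proof (eventually_elim)
    case (elim y)
    then have y: "y \<in> S" by simp
    let ?d = "w y - w x"
    have eqd: "L ?d + T (a x) ?d = b y - b x - T (a y - a x) (w x) - T (a y - a x) ?d"
      using eq[OF y] eq[OF x]
      by (simp add: L.diff T.diff_left T.diff_right algebra_simps)
    have "norm (L ?d + T (a x) ?d) \<le> norm (b y - b x) + norm (a y - a x) * norm (w x) * K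
       + norm (a y - a x) * norm ?d * K"
      unfolding eqd using K(2)[of "a y - a x" "w x"] K(2)[of "a y - a x" ?d]
        norm_triangle_ineq4[of "b y - b x - T (a y - a x) (w x)" "T (a y - a x) ?d"]
        norm_triangle_ineq4[of "b y - b x" "T (a y - a x) (w x)"] by linarith
    then have "norm ?d \<le> C' * (norm (b y - b x) + norm (a y - a x) * norm (w x) * K
       + norm (a y - a x) * norm ?d * K)"
      using bd'[of ?d] C' by (meson less_imp_le mult_left_mono order_trans)
    moreover have "C' * (norm (a y - a x) * norm ?d * K) \<le> norm ?d / 2"
    proof -
      have "norm (a y - a x) * (C' * K) \<le> 1 / 2"
        using elim(1) C' K by (simp add: field_simps)
      then have "norm (a y - a x) * (C' * K) * norm ?d \<le> 1 / 2 * norm ?d"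
        by (rule mult_right_mono) simp
      then show ?thesis by (simp add: algebra_simps)
    qed
    ultimately show ?case by (simp add: algebra_simps)
  qed
  moreover have "((\<lambda>y. 2 * C' * (norm (b y - b x) + norm (a y - a x) * norm (w x) * K)) \<longlongrightarrow>
      2 * C' * (norm (b x - b x) + norm (a x - a x) * norm (w x) * K)) (at x within S)"
    by (intro tendsto_intros at bt)
  then have "((\<lambda>y. 2 * C' * (norm (b y - b x) + norm (a y - a x) * norm (w x) * K)) \<longlongrightarrow> 0)
      (at x within S)" by simp
  ultimately have "((\<lambda>y. w y - w x) \<longlongrightarrow> 0) (at x within S)"
    by (rule Lim_null_comparison)
  then show ?thesis by (simp add: continuous_within LIM_zero_iff)
qed

text \<open>Formal differentiation shows what the derivative must be: the solution, for the same
  operator at \<open>x\<close>, with right side \<open>b' h - T (a' h) (w x)\<close>. Surjectivity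
  provides it; the lower bound makes it bounded and turns smallness of the image of the remainder
  into smallness of the remainder.\<close>

lemma derivative_solution_linear_equation:
  fixes L :: "'w::real_normed_vector \<Rightarrow> 'x::real_normed_vector"
    and a :: "'s::real_normed_vector \<Rightarrow> 'z::real_normed_vector"
  assumes T: "bounded_bilinear T" and L: "bounded_linear L" and S: "open S"
    and eq: "\<And>y. y \<in> S \<Longrightarrow> L (w y) + T (a y) (w y) = b y"
    and x: "x \<in> S" and bd: "\<And>v. norm v \<le> C * norm (L v + T (a x) v)"
    and surj: "surj (\<lambda>v. L v + T (a x) v)"
    and w: "isCont w x"
    and a: "(a has_derivative a') (at x)" and b: "(b has_derivative b') (at x)"
  shows "\<exists>w'. (w has_derivative w') (at x) \<and>
    (\<forall>h. L (w' h) + T (a x) (w' h) = b' h - T (a' h) (w x))"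
proof -
  interpret T: bounded_bilinear T by fact
  interpret L: bounded_linear L by fact
  interpret a': bounded_linear a' using a by (rule has_derivative_bounded_linear)
  interpret b': bounded_linear b' using b by (rule has_derivative_bounded_linear)
  obtain K where K: "K > 0" "\<And>p v. norm (T p v) \<le> norm p * norm v * K" using T.pos_bounded by blast
  obtain Ka where Ka: "Ka > 0" "\<And>h. norm (a' h) \<le> norm h * Ka" using a'.pos_bounded by blast
  obtain Kb where Kb: "Kb > 0" "\<And>h. norm (b' h) \<le> norm h * Kb" using b'.pos_bounded by blast
  define C' where "C' = max C 1"
  define \<Lambda> where "\<Lambda> v = L v + T (a x) v" for v
  have bd': "norm v \<le> C' * norm (\<Lambda> v)" for v
    using bd[of v] mult_right_mono[of C C' "norm (L v + T (a x) v)"] unfolding \<Lambda>_def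
    by (simp add: C'_def)
  have C': "C' > 0" by (simp add: C'_def)
  have \<Lambda>_diff: "\<Lambda> (u - v) = \<Lambda> u - \<Lambda> v" for u v
    by (simp add: \<Lambda>_def L.diff T.diff_right)
  have \<Lambda>_inj: "u = v" if "\<Lambda> u = \<Lambda> v" for u v
    using bd'[of "u - v"] that by (simp add: \<Lambda>_diff)
  define \<Lambda>i where "\<Lambda>i = inv \<Lambda>"
  have "surj \<Lambda>" using surj unfolding \<Lambda>_def[abs_def] .
  then have \<Lambda>i: "\<Lambda> (\<Lambda>i z) = z" for z unfolding \<Lambda>i_def by (rule surj_f_inv_f)
  define w' where "w' h = \<Lambda>i (b' h - T (a' h) (w x))" for h
  have \<Lambda>w': "\<Lambda> (w' h) = b' h - T (a' h) (w x)" for h by (simp add: w'_def \<Lambda>i)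
  have blw: "bounded_linear w'"
  proof (rule bounded_linear_intro)
    show "w' (h + k) = w' h + w' k" for h k
    proof (rule \<Lambda>_inj)
      have "\<Lambda> (w' h + w' k) = \<Lambda> (w' h) + \<Lambda> (w' k)"
        by (simp add: \<Lambda>_def L.add T.add_right)
      then show "\<Lambda> (w' (h + k)) = \<Lambda> (w' h + w' k)"
        by (simp add: \<Lambda>w' a'.add b'.add T.add_left)
    qed
    show "w' (r *\<^sub>R h) = r *\<^sub>R w' h" for r h
    proof (rule \<Lambda>_inj)
      have "\<Lambda> (r *\<^sub>R w' h) = r *\<^sub>R \<Lambda> (w' h)"
        by (simp add: \<Lambda>_def L.scaleR T.scaleR_right algebra_simps)
      then show "\<Lambda> (w' (r *\<^sub>R h)) = \<Lambda> (r *\<^sub>R w' h)"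
        by (simp add: \<Lambda>w' a'.scaleR b'.scaleR T.scaleR_left algebra_simps)
    qed
    show "norm (w' h) \<le> norm h * (C' * (Kb + Ka * norm (w x) * K))" for h
    proof -
      have "norm (T (a' h) (w x)) \<le> norm h * Ka * norm (w x) * K"
        using K(2)[of "a' h" "w x"] mult_right_mono[OF Ka(2)[of h], of "norm (w x) * K"] K(1)
        by (simp add: mult.assoc)
      then have "norm (\<Lambda> (w' h)) \<le> norm h * Kb + norm h * Ka * norm (w x) * K"
        unfolding \<Lambda>w' using Kb(2)[of h] norm_triangle_ineq4[of "b' h" "T (a' h) (w x)"] by linarith
      then have "norm (w' h) \<le> C' * (norm h * Kb + norm h * Ka * norm (w x) * K)"
        by (rule order_trans[OF bd' mult_left_mono]) (use C' in simp)
      then show ?thesis by (simp add: algebra_simps)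
    qed
  qed
  define \<alpha> where "\<alpha> h = norm (a (x + h) - a x - a' h) / norm h" for h
  define \<beta> where "\<beta> h = norm (b (x + h) - b x - b' h) / norm h" for h
  have \<alpha>: "(\<alpha> \<longlongrightarrow> 0) (at 0)" and \<beta>: "(\<beta> \<longlongrightarrow> 0) (at 0)"
    using a b unfolding has_derivative_at \<alpha>_def \<beta>_def by auto
  have wt: "((\<lambda>h. w (x + h)) \<longlongrightarrow> w x) (at 0)"
    using w by (simp add: isCont_def LIM_offset_zero_iff)
  have "((\<lambda>h. x + h) \<longlongrightarrow> x + 0) (at 0)" by (intro tendsto_intros)
  then have evS: "\<forall>\<^sub>F h in at 0. x + h \<in> S"
    using S x by (auto simp: tendsto_def)
  have "\<forall>\<^sub>F h in at 0. norm (norm (w (x + h) - w x - w' h) / norm h) \<le>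
     C' * (\<beta> h + \<alpha> h * norm (w (x + h)) * K + Ka * norm (w (x + h) - w x) * K)"
    using evS
  proof eventually_elim
    case (elim h)
    show ?case
    proof (cases "h = 0")
      case True
      then show ?thesis using C' K Ka by (simp add: \<alpha>_def \<beta>_def)
    next
      case False
      let ?d = "w (x + h) - w x - w' h"
      \<comment> \<open>Two Taylor remainders, of \<open>b\<close> and of \<open>a\<close>, and the
        product of \<open>a' h\<close> with an increment of \<open>w\<close>, which is o(h) because
        \<open>w\<close> is continuous.\<close>
      have eqd: "\<Lambda> ?d = (b (x + h) - b x - b' h) - T (a (x + h) - a x - a' h) (w (x + h))
          - T (a' h) (w (x + h) - w x)"
        unfolding \<Lambda>_diff \<Lambda>w'
        by (simp add: \<Lambda>_def T.diff_left T.diff_right T.add_left eq[OF elim, symmetric]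
            eq[OF x, symmetric])
      have T1: "norm (T (a' h) (w (x + h) - w x)) \<le> norm h * Ka * norm (w (x + h) - w x) * K"
        using K(2)[of "a' h" "w (x + h) - w x"] K(1)
          mult_right_mono[OF Ka(2)[of h], of "norm (w (x + h) - w x) * K"]
        by (simp add: mult.assoc)
      have \<alpha>h: "norm (a (x + h) - a x - a' h) = \<alpha> h * norm h"
        and \<beta>h: "norm (b (x + h) - b x - b' h) = \<beta> h * norm h"
        using False by (auto simp: \<alpha>_def \<beta>_def)
      have "norm (\<Lambda> ?d) \<le> \<beta> h * norm h + \<alpha> h * norm h * norm (w (x + h)) * K
          + norm h * Ka * norm (w (x + h) - w x) * K"
        unfolding eqd
        using K(2)[of "a (x + h) - a x - a' h" "w (x + h)"] T1
          norm_triangle_ineq4[of "b (x + h) - b x - b' h - T (a (x + h) - a x - a' h) (w (x + h))"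
            "T (a' h) (w (x + h) - w x)"]
          norm_triangle_ineq4[of "b (x + h) - b x - b' h" "T (a (x + h) - a x - a' h) (w (x + h))"]
        unfolding \<alpha>h \<beta>h by linarith
      then have "norm ?d \<le> C' * (\<beta> h * norm h + \<alpha> h * norm h * norm (w (x + h)) * K
          + norm h * Ka * norm (w (x + h) - w x) * K)"
        by (rule order_trans[OF bd' mult_left_mono]) (use C' in simp)
      also have "\<dots> = C' * (\<beta> h + \<alpha> h * norm (w (x + h)) * K
          + Ka * norm (w (x + h) - w x) * K) * norm h"
        by (simp add: algebra_simps)
      finally have "norm ?d / norm h \<le> C' * (\<beta> h + \<alpha> h * norm (w (x + h)) * K
          + Ka * norm (w (x + h) - w x) * K)"
        using False by (simp only: pos_divide_le_eq zero_less_norm_iff not_False_eq_True)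
      then show ?thesis by simp
    qed
  qed
  moreover have "((\<lambda>h. C' * (\<beta> h + \<alpha> h * norm (w (x + h)) * K + Ka * norm (w (x + h) - w x) * K))
     \<longlongrightarrow> C' * (0 + 0 * norm (w x) * K + Ka * norm (w x - w x) * K)) (at 0)"
    by (intro tendsto_intros \<alpha> \<beta> wt)
  then have "((\<lambda>h. C' * (\<beta> h + \<alpha> h * norm (w (x + h)) * K + Ka * norm (w (x + h) - w x) * K))
     \<longlongrightarrow> 0) (at 0)" by simp
  ultimately have "((\<lambda>h. norm (w (x + h) - w x - w' h) / norm h) \<longlongrightarrow> 0) (at 0)"
    by (rule Lim_null_comparison)
  then have "(w has_derivative w') (at x)" using blw by (simp add: has_derivative_at)
  then show ?thesis using \<Lambda>w' unfolding \<Lambda>_def by blast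
qed

text \<open>The derivative of \<open>w\<close> in a fixed direction solves an equation with the same
  operator, whose right side contains \<open>w\<close> undifferentiated. A solution of class k thus
  has directional derivatives of class k, which is why \<open>b\<close> and \<open>w\<close> are
  generalized in the induction.\<close>

lemma times_diff_on_linear_equation:
  fixes L :: "'w::real_normed_vector \<Rightarrow> 'x::real_normed_vector"
    and a :: "'s::real_normed_vector \<Rightarrow> 'z::real_normed_vector"
  assumes T: "bounded_bilinear T" and L: "bounded_linear L" and S: "open S"
    and eq: "\<And>y. y \<in> S \<Longrightarrow> L (w y) + T (a y) (w y) = b y"
    and bd: "\<And>x. x \<in> S \<Longrightarrow> \<exists>C. \<forall>v. norm v \<le> C * norm (L v + T (a x) v)"
    and surj: "\<And>x. x \<in> S \<Longrightarrow> surj (\<lambda>v. L v + T (a x) v)"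
    and "times_diff_on k S a" "times_diff_on k S b"
  shows "times_diff_on k S w"
  using eq assms(7,8)
proof (induction k arbitrary: b w)
  case 0
  then have ab: "continuous_on S a" "continuous_on S b" by auto
  have "continuous (at x within S) w" if x: "x \<in> S" for x
  proof -
    obtain C where C: "\<And>v. norm v \<le> C * norm (L v + T (a x) v)" using bd[OF x] by metis
    show ?thesis
      by (rule continuous_solution_linear_equation[OF T L _ x C ab]) (rule 0(1))
  qed
  then show ?case by (simp add: continuous_on_eq_continuous_within)
next
  case (Suc k)
  have a: "times_diff_on k S a" and b: "times_diff_on k S b"
    using Suc.prems(2,3)[THEN times_diff_on_SucD] by auto
  have w: "times_diff_on k S w" by (rule Suc.IH[OF Suc.prems(1) a b])
  then have "continuous_on S w" using times_diff_on_mono[of k S w 0] by simp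
  then have cont: "isCont w x" if "x \<in> S" for x
    using S that continuous_on_eq_continuous_at by blast
  have "\<exists>w'. (w has_derivative w') (at x) \<and>
    (\<forall>h. L (w' h) + T (a x) (w' h) = fderiv b x h - T (fderiv a x h) (w x))" if x: "x \<in> S" for x
  proof -
    obtain C where C: "\<And>v. norm v \<le> C * norm (L v + T (a x) v)" using bd[OF x] by metis
    show ?thesis
      by (rule derivative_solution_linear_equation[OF T L S _ x C surj[OF x] cont[OF x]
        times_diff_on_derivative[OF Suc.prems(2) x] times_diff_on_derivative[OF Suc.prems(3) x]])
        (rule Suc.prems(1))
  qed
  then obtain w' where w': "\<And>x. x \<in> S \<Longrightarrow> (w has_derivative w' x) (at x)"
    and eq': "\<And>x h. x \<in> S \<Longrightarrow> L (w' x h) + T (a x) (w' x h) = fderiv b x h - T (fderiv a x h) (w x)"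
    by metis
  show ?case
  proof (rule times_diff_on_SucI[OF S w'])
    fix v
    have "times_diff_on k S (\<lambda>x. fderiv b x v + (- 1) *\<^sub>R T (fderiv a x v) (w x))"
      by (intro times_diff_on_add[OF S] times_diff_on_linear_comp[OF bounded_linear_scaleR_right S]
          times_diff_on_bilinear[OF T S] w Suc.prems(2,3)[unfolded times_diff_on.simps, THEN conjunct2, THEN spec])
    then have b': "times_diff_on k S (\<lambda>x. fderiv b x v - T (fderiv a x v) (w x))" by simp
    show "times_diff_on k S (\<lambda>x. w' x v)"
      by (rule Suc.IH[OF eq' a b'])
  qed
qed

section \<open>The smooth inverse function theorem\<close>

text \<open>Higher regularity of the inverse comes from the identity
  \<open>F' (G y) (G' y v) = v\<close>, a linear equation for \<open>G' y v\<close> whose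
  coefficient is as regular as \<open>G\<close> is already known to be.\<close>

lemma smooth_inverse_function:
  fixes F :: "'a::euclidean_space \<Rightarrow> 'a"
  assumes S: "open S" and F: "smooth_on S F" and x0: "x0 \<in> S" and inj: "inj (fderiv F x0)"
  obtains U V G where "open U" "U \<subseteq> S" "x0 \<in> U" "open V" "F x0 \<in> V" "homeomorphism U V F G"
    "smooth_on V G" "\<And>x. x \<in> U \<Longrightarrow> bij (fderiv F x)"
proof -
  define F' where "F' x = Blinfun (fderiv F x)" for x
  have F'_apply: "blinfun_apply (F' x) = fderiv F x" if "x \<in> S" for x
    unfolding F'_def by (rule Blinfun_fderiv_apply[OF F that])
  have F'_smooth: "smooth_on S F'"
    unfolding F'_def by (rule smooth_on_Blinfun_fderiv[OF S F])
  have lin: "linear (fderiv F x0)" by (rule smooth_on_linear_fderiv[OF F x0])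
  obtain g where g: "linear g" "g \<circ> fderiv F x0 = id"
    using linear_injective_left_inverse[OF lin inj] by blast
  have "Blinfun g o\<^sub>L F' x0 = id_blinfun"
    using g by (intro blinfun_eqI)
      (simp add: F'_apply x0 bounded_linear_Blinfun_apply linear_conv_bounded_linear pointfree_idE)
  with S F'_apply obtain U V G G' where U: "open U" "U \<subseteq> S" "x0 \<in> U" "open V" "F x0 \<in> V"
    and hom: "homeomorphism U V F G"
    and G: "\<And>y. y \<in> V \<Longrightarrow> (G has_derivative G' y) (at y)"
      "\<And>y. y \<in> V \<Longrightarrow> G' y = inv (blinfun_apply (F' (G y)))"
      "\<And>y. y \<in> V \<Longrightarrow> bij (blinfun_apply (F' (G y)))"
    using inverse_function_theorem[OF S _ smooth_on_continuous[OF F'_smooth] x0, of F "Blinfun g"]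
      smooth_on_derivative[OF F] by metis
  have GU: "G y \<in> U" if "y \<in> V" for y using hom that by (auto simp: homeomorphism_def)
  have bij: "bij (fderiv F x)" if "x \<in> U" for x
  proof -
    have "F x \<in> V" "G (F x) = x" using hom that by (auto simp: homeomorphism_def)
    then show ?thesis using G(3)[of "F x"] F'_apply U that by auto
  qed
  have "times_diff_on k V G" for k
  proof (induction k)
    case 0
    then show ?case using hom by (simp add: homeomorphism_def)
  next
    case (Suc k)
    show ?case
    proof (rule times_diff_on_SucI[OF \<open>open V\<close> G(1)])
      fix v
      show "times_diff_on k V (\<lambda>y. G' y v)"
      proof (rule times_diff_on_linear_equation[OF bounded_bilinear_blinfun_apply bounded_linear_zero \<open>open V\<close>,
            where a = "\<lambda>y. F' (G y)" and b = "\<lambda>_. v"])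
        fix y assume y: "y \<in> V"
        show "0 + blinfun_apply (F' (G y)) (G' y v) = v"
          using G(2,3)[OF y] by (simp add: bij_is_surj surj_f_inv_f)
        have l: "linear (blinfun_apply (F' (G y)))"
          by (simp add: blinfun.bounded_linear_right bounded_linear.linear)
        obtain B where "B > 0" "\<And>v. B * norm v \<le> norm (blinfun_apply (F' (G y)) v)"
          using linear_inj_bounded_below_pos[OF l bij_is_inj[OF G(3)[OF y]]] by metis
        then have "norm v \<le> (1 / B) * norm (0 + blinfun_apply (F' (G y)) v)" for v
          by (simp add: field_simps)
        then show "\<exists>C. \<forall>v. norm v \<le> C * norm (0 + blinfun_apply (F' (G y)) v)" by blast
        show "surj (\<lambda>v. 0 + blinfun_apply (F' (G y)) v)"
          using bij_is_surj[OF G(3)[OF y]] by simp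
      next
        show "times_diff_on k V (\<lambda>y. F' (G y))"
          by (rule times_diff_on_compose[OF \<open>open V\<close> S _ Suc.IH])
            (use GU U F'_smooth in \<open>auto simp: smooth_on_def\<close>)
      qed auto
    qed
  qed
  then have "smooth_on V G" by (simp add: smooth_on_def)
  then show thesis using that U hom bij by blast
qed

section \<open>Local Riemannian geometry: metric, Levi-Civita connection and Gauss formula in
  coordinates\<close>

section \<open>Riemannian metrics on open sets of a Euclidean space\<close>

text \<open>A metric on the image of a single chart. Connection, Gauss formula and exponential map
  are developed for such fields, and manifolds enter only afterwards.\<close>

definition riemannian_field :: "'e::euclidean_space set \<Rightarrow> 'e metric_field \<Rightarrow> bool" where
  "riemannian_field U h \<longleftrightarrow> open U \<and>
     (\<forall>x\<in>U. bilinear (h x) \<and> (\<forall>u v. h x u v = h x v u) \<and> (\<forall>u. u \<noteq> 0 \<longrightarrow> h x u u > 0)) \<and>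
     (\<forall>u v. smooth_on U (\<lambda>x. h x u v))"

lemma riemannian_fieldD:
  assumes "riemannian_field U h"
  shows "open U" "x \<in> U \<Longrightarrow> bilinear (h x)" "x \<in> U \<Longrightarrow> h x u v = h x v u"
    "x \<in> U \<Longrightarrow> u \<noteq> 0 \<Longrightarrow> h x u u > 0" "smooth_on U (\<lambda>x. h x u v)"
  using assms unfolding riemannian_field_def by auto

lemma riemannian_field_subset:
  "riemannian_field U h \<Longrightarrow> open V \<Longrightarrow> V \<subseteq> U \<Longrightarrow> riemannian_field V h"
  unfolding riemannian_field_def using smooth_on_subset by blast

lemma riemannian_field_nondegenerate:
  assumes "riemannian_field U h" "x \<in> U" "\<And>z. h x a z = h x b z"
  shows "a = b"
proof (rule ccontr)
  assume "a \<noteq> b"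
  then have "h x (a - b) (a - b) > 0" using riemannian_fieldD(4)[OF assms(1,2)] by simp
  moreover have "h x (a - b) (a - b) = 0"
    using bilinear_lsub[OF riemannian_fieldD(2)[OF assms(1,2)], of a b "a - b"] assms(3) by simp
  ultimately show False by simp
qed

lemma smooth_on_transform:
  "smooth_on S G \<Longrightarrow> open S \<Longrightarrow> (\<And>x. x \<in> S \<Longrightarrow> F x = G x) \<Longrightarrow> smooth_on S F"
  using smooth_on_cong[of S F G] by blast

lemma bilinear_eq_sum_Basis:
  fixes B :: "'a::euclidean_space \<Rightarrow> 'b::euclidean_space \<Rightarrow> 'c::real_vector"
  assumes "bilinear B"
  shows "B a b = (\<Sum>i\<in>Basis. \<Sum>j\<in>Basis. ((a \<bullet> i) * (b \<bullet> j)) *\<^sub>R B i j)"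
proof -
  have l: "linear (\<lambda>a. B a b)" for b using assms by (simp add: bilinear_def)
  have r: "linear (B a)" for a using assms by (simp add: bilinear_def)
  have "B a b = B (\<Sum>i\<in>Basis. (a \<bullet> i) *\<^sub>R i) (\<Sum>j\<in>Basis. (b \<bullet> j) *\<^sub>R j)"
    by (simp add: euclidean_representation)
  also have "\<dots> = (\<Sum>(i, j)\<in>Basis \<times> Basis. B ((a \<bullet> i) *\<^sub>R i) ((b \<bullet> j) *\<^sub>R j))"
    by (rule bilinear_sum[OF assms])
  also have "\<dots> = (\<Sum>(i, j)\<in>Basis \<times> Basis. ((a \<bullet> i) * (b \<bullet> j)) *\<^sub>R B i j)"
    by (simp add: bilinear_lmul[OF assms] bilinear_rmul[OF assms] mult.commute)
  finally show ?thesis by (simp add: sum.cartesian_product)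
qed

lemma smooth_on_bilinear_field:
  fixes B :: "'e::euclidean_space \<Rightarrow> 'a::euclidean_space \<Rightarrow> 'b::euclidean_space \<Rightarrow> 'c::real_normed_vector"
  assumes S: "open S" and U: "open U" and y: "y ` S \<subseteq> U" "smooth_on S y"
    and B: "\<And>x. x \<in> U \<Longrightarrow> bilinear (B x)" "\<And>u v. smooth_on U (\<lambda>x. B x u v)"
    and a: "smooth_on S a" and b: "smooth_on S b"
  shows "smooth_on S (\<lambda>x. B (y x) (a x) (b x))"
proof -
  have "smooth_on S (\<lambda>x. \<Sum>i\<in>Basis. \<Sum>j\<in>Basis. ((a x \<bullet> i) * (b x \<bullet> j)) *\<^sub>R B (y x) i j)"
    by (intro smooth_on_sum[OF S] smooth_on_bilinear[OF bounded_bilinear_scaleR S]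
        smooth_on_bilinear[OF bounded_bilinear_mult S]
        smooth_on_linear_comp[OF bounded_linear_inner_left S] a b smooth_on_compose[OF S U y] B(2))
  then show ?thesis
    by (rule smooth_on_transform[OF _ S]) (rule bilinear_eq_sum_Basis[OF B(1)], use y in auto)
qed

text \<open>Base point and both arguments vary at once. Written through its values on basis vectors,
  the form becomes a sum of products of scalar functions, to which the ordinary product rule
  applies; the three groups of terms are then collected again.\<close>

lemma has_derivative_bilinear_field:
  fixes B :: "'e::euclidean_space \<Rightarrow> 'a::euclidean_space \<Rightarrow> 'b::euclidean_space \<Rightarrow> real"
  assumes U: "open U" and y: "(y has_derivative y') (at x)" "y x \<in> U"
    and B: "\<And>x. x \<in> U \<Longrightarrow> bilinear (B x)" "\<And>u v. smooth_on U (\<lambda>x. B x u v)"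
    and a: "(a has_derivative a') (at x)" and b: "(b has_derivative b') (at x)"
  shows "((\<lambda>x. B (y x) (a x) (b x)) has_derivative
     (\<lambda>z. fderiv (\<lambda>p. B p (a x) (b x)) (y x) (y' z) + B (y x) (a' z) (b x) + B (y x) (a x) (b' z))) (at x)"
proof -
  have By: "((\<lambda>x. B (y x) i j) has_derivative (\<lambda>z. fderiv (\<lambda>p. B p i j) (y x) (y' z))) (at x)" for i j
    using diff_chain_at[OF y(1) smooth_on_derivative[OF B(2) y(2)]] by (simp add: o_def)
  have fd: "fderiv (\<lambda>p. B p (a x) (b x)) (y x) =
     (\<lambda>z. \<Sum>i\<in>Basis. \<Sum>j\<in>Basis. ((a x \<bullet> i) * (b x \<bullet> j)) *\<^sub>R fderiv (\<lambda>p. B p i j) (y x) z)"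
  proof (rule fderiv_eq)
    have "((\<lambda>p. \<Sum>i\<in>Basis. \<Sum>j\<in>Basis. ((a x \<bullet> i) * (b x \<bullet> j)) *\<^sub>R B p i j) has_derivative
      (\<lambda>z. \<Sum>i\<in>Basis. \<Sum>j\<in>Basis. ((a x \<bullet> i) * (b x \<bullet> j)) *\<^sub>R fderiv (\<lambda>p. B p i j) (y x) z)) (at (y x))"
      by (intro has_derivative_sum has_derivative_scaleR_right smooth_on_derivative[OF B(2) y(2)])
    then show "((\<lambda>p. B p (a x) (b x)) has_derivative
      (\<lambda>z. \<Sum>i\<in>Basis. \<Sum>j\<in>Basis. ((a x \<bullet> i) * (b x \<bullet> j)) *\<^sub>R fderiv (\<lambda>p. B p i j) (y x) z)) (at (y x))"
      by (rule has_derivative_transform_within_open[OF _ U y(2)])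
        (rule bilinear_eq_sum_Basis[OF B(1), symmetric])
  qed
  have "((\<lambda>x. \<Sum>i\<in>Basis. \<Sum>j\<in>Basis. ((a x \<bullet> i) * (b x \<bullet> j)) *\<^sub>R B (y x) i j) has_derivative
     (\<lambda>z. \<Sum>i\<in>Basis. \<Sum>j\<in>Basis. ((a x \<bullet> i) * (b x \<bullet> j)) *\<^sub>R fderiv (\<lambda>p. B p i j) (y x) (y' z) +
       ((a x \<bullet> i) * (b' z \<bullet> j) + (a' z \<bullet> i) * (b x \<bullet> j)) *\<^sub>R B (y x) i j)) (at x)"
    by (intro has_derivative_sum has_derivative_scaleR has_derivative_mult By
        bounded_linear.has_derivative[OF bounded_linear_inner_left] a b)
  moreover have "(\<Sum>i\<in>Basis. \<Sum>j\<in>Basis. ((a x \<bullet> i) * (b x \<bullet> j)) *\<^sub>R fderiv (\<lambda>p. B p i j) (y x) (y' z) +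
       ((a x \<bullet> i) * (b' z \<bullet> j) + (a' z \<bullet> i) * (b x \<bullet> j)) *\<^sub>R B (y x) i j) =
     fderiv (\<lambda>p. B p (a x) (b x)) (y x) (y' z) + B (y x) (a' z) (b x) + B (y x) (a x) (b' z)" for z
    unfolding fd bilinear_eq_sum_Basis[OF B(1)[OF y(2)], of "a' z" "b x"]
      bilinear_eq_sum_Basis[OF B(1)[OF y(2)], of "a x" "b' z"]
    by (simp add: sum.distrib algebra_simps)
  ultimately have d: "((\<lambda>x. \<Sum>i\<in>Basis. \<Sum>j\<in>Basis. ((a x \<bullet> i) * (b x \<bullet> j)) *\<^sub>R B (y x) i j) has_derivative
     (\<lambda>z. fderiv (\<lambda>p. B p (a x) (b x)) (y x) (y' z) + B (y x) (a' z) (b x) + B (y x) (a x) (b' z))) (at x)"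
    by simp
  have "isCont y x" using y(1) by (rule has_derivative_continuous)
  then have "\<forall>\<^sub>F p in nhds x. y p \<in> U"
    using U y(2) by (simp add: isCont_def tendsto_def eventually_nhds_conv_at)
  then obtain V where V: "open V" "x \<in> V" "\<And>p. p \<in> V \<Longrightarrow> y p \<in> U"
    unfolding eventually_nhds by blast
  show ?thesis
    by (rule has_derivative_transform_within_open[OF d V(1,2)])
      (rule bilinear_eq_sum_Basis[OF B(1), symmetric], rule V(3))
qed

section \<open>The Christoffel map\<close>

definition metric_deriv :: "'e::euclidean_space metric_field \<Rightarrow> 'e \<Rightarrow> 'e \<Rightarrow> 'e \<Rightarrow> 'e \<Rightarrow> real" where
  "metric_deriv h x z u v = fderiv (\<lambda>y. h y u v) x z"

lemma metric_deriv_linear: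
  assumes h: "riemannian_field U h" and x: "x \<in> U"
  shows "linear (\<lambda>z. metric_deriv h x z u v)" "bilinear (metric_deriv h x z)"
    "metric_deriv h x z u v = metric_deriv h x z v u"
proof -
  note U = riemannian_fieldD(1)[OF h] and b = riemannian_fieldD(2)[OF h]
    and d = smooth_on_derivative[OF riemannian_fieldD(5)[OF h] x]
  show "linear (\<lambda>z. metric_deriv h x z u v)"
    unfolding metric_deriv_def by (rule has_derivative_linear[OF d])
  show sym: "metric_deriv h x z u v = metric_deriv h x z v u" for u v
    unfolding metric_deriv_def
    by (rule fun_cong[OF fderiv_cong[OF U x]]) (rule riemannian_fieldD(3)[OF h])
  have add: "metric_deriv h x z (u + u') v = metric_deriv h x z u v + metric_deriv h x z u' v" for u u' v
  proof -
    have "fderiv (\<lambda>y. h y (u + u') v) x = fderiv (\<lambda>y. h y u v + h y u' v) x"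
      by (rule fderiv_cong[OF U x]) (rule bilinear_ladd[OF b])
    also have "\<dots> = (\<lambda>z. fderiv (\<lambda>y. h y u v) x z + fderiv (\<lambda>y. h y u' v) x z)"
      by (rule fderiv_eq[OF has_derivative_add[OF d d]])
    finally show ?thesis by (simp add: metric_deriv_def)
  qed
  have scale: "metric_deriv h x z (r *\<^sub>R u) v = r *\<^sub>R metric_deriv h x z u v" for r u v
  proof -
    have "fderiv (\<lambda>y. h y (r *\<^sub>R u) v) x = fderiv (\<lambda>y. r *\<^sub>R h y u v) x"
      by (rule fderiv_cong[OF U x]) (rule bilinear_lmul[OF b])
    also have "\<dots> = (\<lambda>z. r *\<^sub>R fderiv (\<lambda>y. h y u v) x z)"
      by (rule fderiv_eq[OF has_derivative_scaleR_right[OF d]])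
    finally show ?thesis by (simp add: metric_deriv_def)
  qed
  show "bilinear (metric_deriv h x z)"
    unfolding bilinear_def by (intro conjI allI linearI add scale) (metis add sym, metis scale sym)
qed

definition is_christoffel :: "'e::euclidean_space metric_field \<Rightarrow> 'e \<Rightarrow> ('e \<Rightarrow> 'e \<Rightarrow> 'e) \<Rightarrow> bool" where
  "is_christoffel h x \<Gamma> \<longleftrightarrow> bilinear \<Gamma> \<and> (\<forall>u v. \<Gamma> u v = \<Gamma> v u) \<and>
     (\<forall>u v z. metric_deriv h x z u v = h x (\<Gamma> z u) v + h x u (\<Gamma> z v))"

text \<open>In the alternating sum of the three compatibility identities, symmetry of
  \<open>\<Gamma>\<close> cancels everything except two copies of the left side. Thus the first
  derivatives of \<open>h\<close> determine \<open>\<Gamma>\<close>.\<close>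

lemma koszul:
  assumes "riemannian_field U h" "x \<in> U" and \<Gamma>: "is_christoffel h x \<Gamma>"
  shows "h x (\<Gamma> u v) z = (metric_deriv h x u v z + metric_deriv h x v u z - metric_deriv h x z u v) / 2"
proof -
  note sym = riemannian_fieldD(3)[OF assms(1,2)]
  have s: "\<Gamma> u v = \<Gamma> v u" for u v using \<Gamma> by (simp add: is_christoffel_def)
  have c: "metric_deriv h x z u v = h x (\<Gamma> z u) v + h x u (\<Gamma> z v)" for z u v
    using \<Gamma> by (simp add: is_christoffel_def)
  show ?thesis
    unfolding c using s[of u v] s[of z u] s[of z v] sym[of v "\<Gamma> u z"] sym[of u "\<Gamma> v z"]
      sym[of "\<Gamma> z u" v] by simp
qed

text \<open>\<open>A\<close> is the Gram operator, representing \<open>h x\<close> by the Euclidean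
  inner product. Positive definiteness makes it invertible, so \<open>\<Gamma> u v\<close> can be
  defined as the vector that represents the Koszul functional \<open>k u v\<close>.\<close>

lemma christoffel_exists:
  assumes h: "riemannian_field U h" and x: "x \<in> U"
  shows "\<exists>\<Gamma>. is_christoffel h x \<Gamma>"
proof -
  note bil = riemannian_fieldD(2)[OF h x]
  define A where "A w = (\<Sum>i\<in>Basis. h x w i *\<^sub>R i)" for w
  have hA: "h x w z = A w \<bullet> z" for w z
  proof -
    have "linear (h x w)" using bil by (simp add: bilinear_def)
    then have "h x w z = (\<Sum>i\<in>Basis. (z \<bullet> i) *\<^sub>R h x w i)" by (rule linear_eq_sum_Basis)
    also have "\<dots> = A w \<bullet> z"
      unfolding A_def inner_sum_left inner_scaleR_left
      by (rule sum.cong) (simp_all add: inner_commute mult.commute)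
    finally show ?thesis .
  qed
  have linA: "linear A"
    by (rule linearI) (simp_all add: A_def bilinear_ladd[OF bil] bilinear_lmul[OF bil]
        sum.distrib scaleR_add_left scaleR_sum_right)
  have "inj A"
    by (rule injI) (metis hA riemannian_field_nondegenerate[OF h x])
  then have surjA: "surj A" using linA linear_injective_imp_surjective by blast
  define k where "k u v z = (metric_deriv h x u v z + metric_deriv h x v u z - metric_deriv h x z u v) / 2"
    for u v z
  note ml = metric_deriv_linear[OF h x]
  note lin = linear_add[OF ml(1)] linear_cmul[OF ml(1)] bilinear_ladd[OF ml(2)] bilinear_lmul[OF ml(2)]
      bilinear_radd[OF ml(2)] bilinear_rmul[OF ml(2)]
  have k3: "linear (k u v)" for u v
    by (rule linearI) (simp_all add: k_def lin algebra_simps add_divide_distrib diff_divide_distrib)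
  define \<Gamma> where "\<Gamma> u v = inv A (\<Sum>i\<in>Basis. k u v i *\<^sub>R i)" for u v
  have h\<Gamma>: "h x (\<Gamma> u v) z = k u v z" for u v z
  proof -
    have "h x (\<Gamma> u v) z = (\<Sum>i\<in>Basis. k u v i *\<^sub>R i) \<bullet> z"
      by (simp add: hA \<Gamma>_def surj_f_inv_f[OF surjA])
    also have "\<dots> = (\<Sum>i\<in>Basis. (z \<bullet> i) *\<^sub>R k u v i)"
      unfolding inner_sum_left inner_scaleR_left
      by (rule sum.cong) (simp_all add: inner_commute mult.commute)
    also have "\<dots> = k u v z" by (rule linear_eq_sum_Basis[OF k3, symmetric])
    finally show ?thesis .
  qed
  note nd = riemannian_field_nondegenerate[OF h x]
  have sym\<Gamma>: "\<Gamma> u v = \<Gamma> v u" for u v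
    by (rule nd) (simp add: h\<Gamma> k_def ml(3)[of _ u v])
  have add: "\<Gamma> (u + u') v = \<Gamma> u v + \<Gamma> u' v" for u u' v
    by (rule nd) (simp add: h\<Gamma> k_def bilinear_ladd[OF bil] lin field_simps)
  have scale: "\<Gamma> (r *\<^sub>R u) v = r *\<^sub>R \<Gamma> u v" for r u v
    by (rule nd) (simp add: h\<Gamma> k_def bilinear_lmul[OF bil] lin algebra_simps)
  have "bilinear \<Gamma>"
    unfolding bilinear_def by (intro conjI allI linearI add scale) (metis add sym\<Gamma>, metis scale sym\<Gamma>)
  moreover have "metric_deriv h x z u v = h x (\<Gamma> z u) v + h x u (\<Gamma> z v)" for u v z
    unfolding riemannian_fieldD(3)[OF h x, of u "\<Gamma> z v"] h\<Gamma> k_def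
    using ml(3)[of z u v] by (simp add: field_simps)
  ultimately show ?thesis using sym\<Gamma> unfolding is_christoffel_def by blast
qed

lemma christoffel_is_christoffel:
  assumes h: "riemannian_field U h" and x: "x \<in> U"
  shows "is_christoffel h x (christoffel h x)"
proof -
  have eq: "christoffel h x = (THE \<Gamma>. is_christoffel h x \<Gamma>)"
    unfolding christoffel_def is_christoffel_def metric_deriv_def ..
  obtain \<Gamma> where \<Gamma>: "is_christoffel h x \<Gamma>" using christoffel_exists[OF h x] by blast
  have "\<Gamma>' = \<Gamma>" if "is_christoffel h x \<Gamma>'" for \<Gamma>'
    by (intro ext riemannian_field_nondegenerate[OF h x]) (simp add: koszul[OF h x \<Gamma>] koszul[OF h x that])
  with \<Gamma> show ?thesis unfolding eq by (rule theI)
qed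

lemma christoffelD:
  assumes h: "riemannian_field U h" and x: "x \<in> U"
  shows "bilinear (christoffel h x)" "christoffel h x u v = christoffel h x v u"
    "metric_deriv h x z u v = h x (christoffel h x z u) v + h x u (christoffel h x z v)"
  using christoffel_is_christoffel[OF assms] unfolding is_christoffel_def by auto

text \<open>For fixed \<open>u\<close> and \<open>v\<close> the Christoffel vector solves a linear
  equation whose operator is the Gram operator \<open>A\<close> and whose right side is the Koszul
  functional \<open>b\<close>; both have smooth entries, so no explicit matrix inverse is
  required.\<close>

lemma smooth_on_christoffel:
  assumes h: "riemannian_field U h"
  shows "smooth_on U (\<lambda>x. christoffel h x u v)"
proof -
  note U = riemannian_fieldD(1)[OF h] and sm = riemannian_fieldD(5)[OF h]
  define A where "A x = (\<Sum>i\<in>Basis. \<Sum>j\<in>Basis. h x j i *\<^sub>R (blinfun_scaleR_left i o\<^sub>L blinfun_inner_left j))"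
    for x
  define b where "b x = (\<Sum>i\<in>Basis. ((metric_deriv h x u v i + metric_deriv h x v u i +
      (- 1) *\<^sub>R metric_deriv h x i u v) / 2) *\<^sub>R i)" for x
  have A_apply: "blinfun_apply (A x) w = (\<Sum>i\<in>Basis. h x w i *\<^sub>R i)" if x: "x \<in> U" for x w
  proof -
    have l: "linear (\<lambda>w. h x w i)" for i using riemannian_fieldD(2)[OF h x] by (simp add: bilinear_def)
    have eq: "h x w i = (\<Sum>j\<in>Basis. (w \<bullet> j) * h x j i)" for i
      by (rule trans[OF linear_eq_sum_Basis[OF l]]) simp
    have "(\<Sum>i\<in>Basis. h x w i *\<^sub>R i) = (\<Sum>i\<in>Basis. (\<Sum>j\<in>Basis. (w \<bullet> j) * h x j i) *\<^sub>R i)"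
      by (subst eq) (rule refl)
    then show ?thesis
      by (simp add: A_def blinfun.sum_left blinfun.scaleR_left scaleR_sum_left mult.commute)
  qed
  have A_inner: "blinfun_apply (A x) w \<bullet> z = h x w z" if x: "x \<in> U" for x w z
  proof -
    have "linear (h x w)" using riemannian_fieldD(2)[OF h x] by (simp add: bilinear_def)
    from linear_eq_sum_Basis[OF this, of z] have "h x w z = (\<Sum>i\<in>Basis. (z \<bullet> i) *\<^sub>R h x w i)" .
    also have "\<dots> = blinfun_apply (A x) w \<bullet> z"
      unfolding A_apply[OF x] inner_sum_left inner_scaleR_left
      by (rule sum.cong) (simp_all add: inner_commute mult.commute)
    finally show ?thesis by (rule sym)
  qed
  have sA: "smooth_on U A"
    unfolding A_def
    by (intro smooth_on_sum[OF U] smooth_on_bilinear[OF bounded_bilinear_scaleR U] sm smooth_on_const)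
  have smd: "smooth_on U (\<lambda>x. metric_deriv h x z u v)" for z u v
    unfolding metric_deriv_def by (intro smooth_on_fderiv sm)
  have sb: "smooth_on U b"
    unfolding b_def
    by (intro smooth_on_sum[OF U] smooth_on_bilinear[OF bounded_bilinear_scaleR U] smooth_on_const
        smooth_on_linear_comp[OF bounded_linear_divide U] smooth_on_add[OF U]
        smooth_on_linear_comp[OF bounded_linear_scaleR_right U] smd)
  have "times_diff_on k U (\<lambda>x. christoffel h x u v)" for k
  proof (rule times_diff_on_linear_equation[OF bounded_bilinear_blinfun_apply bounded_linear_zero U,
        where a = A and b = b])
    fix x assume x: "x \<in> U"
    show "0 + blinfun_apply (A x) (christoffel h x u v) = b x"
      by (simp add: A_apply[OF x] b_def koszul[OF h x christoffel_is_christoffel[OF h x]])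
    have l: "linear (blinfun_apply (A x))"
      by (simp add: blinfun.bounded_linear_right bounded_linear.linear)
    have inj: "inj (blinfun_apply (A x))"
      by (rule injI) (metis A_inner[OF x] riemannian_field_nondegenerate[OF h x])
    obtain B where "B > 0" "\<And>v. B * norm v \<le> norm (blinfun_apply (A x) v)"
      using linear_inj_bounded_below_pos[OF l inj] by metis
    then have "norm v \<le> (1 / B) * norm (0 + blinfun_apply (A x) v)" for v
      by (simp add: field_simps)
    then show "\<exists>C. \<forall>v. norm v \<le> C * norm (0 + blinfun_apply (A x) v)" by blast
    show "surj (\<lambda>v. 0 + blinfun_apply (A x) v)"
      using linear_injective_imp_surjective[OF l inj] by simp
  qed (use sA sb in \<open>auto simp: smooth_on_def\<close>)
  then show ?thesis by (simp add: smooth_on_def)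
qed

section \<open>The Gauss formula\<close>

text \<open>Covers immersions in charts, parametrizations of submanifolds and coordinate changes
  alike, so that one Gauss formula serves all three.\<close>

definition isometric_map ::
  "'k::euclidean_space set \<Rightarrow> 'k metric_field \<Rightarrow> 'e::euclidean_space set \<Rightarrow> 'e metric_field \<Rightarrow> ('k \<Rightarrow> 'e) \<Rightarrow> bool"
  where
  "isometric_map D g U h \<theta> \<longleftrightarrow> riemannian_field D g \<and> riemannian_field U h \<and> smooth_on D \<theta> \<and>
     \<theta> ` D \<subseteq> U \<and> (\<forall>x\<in>D. \<forall>u v. g x u v = h (\<theta> x) (fderiv \<theta> x u) (fderiv \<theta> x v))"

lemma isometric_mapD:
  assumes "isometric_map D g U h \<theta>"
  shows "riemannian_field D g" "riemannian_field U h" "smooth_on D \<theta>" "x \<in> D \<Longrightarrow> \<theta> x \<in> U"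
    "x \<in> D \<Longrightarrow> g x u v = h (\<theta> x) (fderiv \<theta> x u) (fderiv \<theta> x v)" "open D"
  using assms riemannian_fieldD(1) unfolding isometric_map_def by auto

definition second_form ::
  "'k::euclidean_space metric_field \<Rightarrow> 'e::euclidean_space metric_field \<Rightarrow> ('k \<Rightarrow> 'e) \<Rightarrow> 'k \<Rightarrow> 'k \<Rightarrow> 'k \<Rightarrow> 'e"
  where
  "second_form g h \<theta> x u v = fderiv (\<lambda>a. fderiv \<theta> a v) x u +
     christoffel h (\<theta> x) (fderiv \<theta> x u) (fderiv \<theta> x v) - fderiv \<theta> x (christoffel g x u v)"

lemma isometric_map_inj:
  assumes "isometric_map D g U h \<theta>" "x \<in> D"
  shows "inj (fderiv \<theta> x)"
proof -
  note I = isometric_mapD[OF assms(1)]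
  have lin: "linear (fderiv \<theta> x)" by (rule smooth_on_linear_fderiv[OF I(3) assms(2)])
  show ?thesis
    unfolding linear_injective_0[OF lin]
  proof (intro allI impI, rule ccontr)
    fix u assume u: "fderiv \<theta> x u = 0" "u \<noteq> 0"
    then have "g x u u > 0" using riemannian_fieldD(4)[OF I(1) assms(2)] by blast
    moreover have "g x u u = 0"
      unfolding I(5)[OF assms(2)] u(1)
      using bilinear_lzero[OF riemannian_fieldD(2)[OF I(2) I(4)[OF assms(2)]]] by blast
    ultimately show False by simp
  qed
qed

lemma metric_compatible:
  assumes h: "riemannian_field U h" and y: "(y has_derivative y') (at x)" "y x \<in> U"
    and a: "(a has_derivative a') (at x)" and b: "(b has_derivative b') (at x)"
  shows "((\<lambda>x. h (y x) (a x) (b x)) has_derivative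
     (\<lambda>z. h (y x) (a' z + christoffel h (y x) (y' z) (a x)) (b x) +
          h (y x) (a x) (b' z + christoffel h (y x) (y' z) (b x)))) (at x)"
proof -
  note bil = riemannian_fieldD(2)[OF h]
  have "fderiv (\<lambda>p. h p (a x) (b x)) (y x) (y' z) + h (y x) (a' z) (b x) + h (y x) (a x) (b' z) =
     h (y x) (a' z + christoffel h (y x) (y' z) (a x)) (b x) +
     h (y x) (a x) (b' z + christoffel h (y x) (y' z) (b x))" for z
    using christoffelD(3)[OF h y(2), of "y' z" "a x" "b x"]
    by (simp add: metric_deriv_def bilinear_ladd[OF bil[OF y(2)]] bilinear_radd[OF bil[OF y(2)]])
  with has_derivative_bilinear_field[OF riemannian_fieldD(1)[OF h] y bil riemannian_fieldD(5)[OF h] a b]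
  show ?thesis by simp
qed

lemma second_form_symmetric:
  assumes I: "isometric_map D g U h \<theta>" and x: "x \<in> D"
  shows "second_form g h \<theta> x u v = second_form g h \<theta> x v u"
  unfolding second_form_def
  using second_fderiv_symmetric[OF isometric_mapD(6)[OF I] isometric_mapD(3)[OF I] x, of v u]
    christoffelD(2)[OF isometric_mapD(1)[OF I] x, of u v]
    christoffelD(2)[OF isometric_mapD(2)[OF I] isometric_mapD(4)[OF I x], of "fderiv \<theta> x u"]
  by simp

text \<open>The derivative of \<open>g\<close> is computed twice, with the connection of
  \<open>g\<close> and, through \<open>\<theta>\<close>, with that of \<open>h\<close>. The
  comparison makes the tangential part \<open>B\<close> skew in its last two arguments, whereas
  symmetry of second derivatives and of Christoffel maps makes it symmetric in the first
  two.\<close>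

theorem second_form_normal:
  assumes I: "isometric_map D g U h \<theta>" and x: "x \<in> D"
  shows "h (\<theta> x) (second_form g h \<theta> x u v) (fderiv \<theta> x w) = 0"
proof -
  note D = isometric_mapD[OF I] and D4 = isometric_mapD(4)[OF I x]
  note bil = riemannian_fieldD(2)[OF D(2) D4] and sym = riemannian_fieldD(3)[OF D(2) D4]
  have lin: "linear (fderiv \<theta> x)" by (rule smooth_on_linear_fderiv[OF D(3) x])
  define B where "B z u v = h (\<theta> x) (second_form g h \<theta> x z u) (fderiv \<theta> x v)" for z u v
  have "B z u v + B z v u = 0" for z u v
  proof -
    have d\<theta>: "((\<lambda>y. fderiv \<theta> y u) has_derivative fderiv (\<lambda>y. fderiv \<theta> y u) x) (at x)" for u
      by (rule smooth_on_derivative[OF smooth_on_fderiv[OF D(3)] x])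
    have "fderiv (\<lambda>y. g y u v) x = fderiv (\<lambda>y. h (\<theta> y) (fderiv \<theta> y u) (fderiv \<theta> y v)) x"
      by (rule fderiv_cong[OF D(6) x]) (rule D(5))
    also have "\<dots> = (\<lambda>z. h (\<theta> x) (fderiv (\<lambda>y. fderiv \<theta> y u) x z +
          christoffel h (\<theta> x) (fderiv \<theta> x z) (fderiv \<theta> x u)) (fderiv \<theta> x v) +
        h (\<theta> x) (fderiv \<theta> x u) (fderiv (\<lambda>y. fderiv \<theta> y v) x z +
          christoffel h (\<theta> x) (fderiv \<theta> x z) (fderiv \<theta> x v)))"
      by (rule fderiv_eq[OF metric_compatible[OF D(2) smooth_on_derivative[OF D(3) x] D4 d\<theta> d\<theta>]])
    finally have "metric_deriv g x z u v = h (\<theta> x) (second_form g h \<theta> x z u + fderiv \<theta> x (christoffel g x z u))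
        (fderiv \<theta> x v) + h (\<theta> x) (fderiv \<theta> x u)
        (second_form g h \<theta> x z v + fderiv \<theta> x (christoffel g x z v))"
      by (simp add: metric_deriv_def second_form_def)
    moreover have "metric_deriv g x z u v = h (\<theta> x) (fderiv \<theta> x (christoffel g x z u)) (fderiv \<theta> x v) +
        h (\<theta> x) (fderiv \<theta> x u) (fderiv \<theta> x (christoffel g x z v))"
      by (simp add: christoffelD(3)[OF D(1) x] D(5)[OF x])
    ultimately show ?thesis
      using sym[of "second_form g h \<theta> x z v"] by (simp add: B_def bilinear_ladd[OF bil] bilinear_radd[OF bil])
  qed
  moreover have "B z u v = B u z v" for z u v
    unfolding B_def by (subst second_form_symmetric[OF I x]) (rule refl)
  \<comment> \<open>a trilinear form symmetric in the first and skew in the last two arguments vanishes\<close>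
  ultimately have "B u v w = 0"
    by (smt (verit))
  then show ?thesis by (simp add: B_def)
qed

lemma fderiv_fderiv_Blinfun:
  fixes \<theta> :: "'k::euclidean_space \<Rightarrow> 'e::real_normed_vector"
  assumes \<theta>: "smooth_on D \<theta>" "open D" and x: "x \<in> D"
  shows "fderiv (\<lambda>a. fderiv \<theta> a v) x = (\<lambda>u. blinfun_apply (fderiv (\<lambda>a. Blinfun (fderiv \<theta> a)) x u) v)"
proof (rule fderiv_eq)
  have "((\<lambda>a. blinfun_apply (Blinfun (fderiv \<theta> a)) v) has_derivative
     (\<lambda>u. blinfun_apply (fderiv (\<lambda>a. Blinfun (fderiv \<theta> a)) x u) v)) (at x)"
    by (rule bounded_linear.has_derivative[OF blinfun.bounded_linear_left
        smooth_on_derivative[OF smooth_on_Blinfun_fderiv[OF \<theta>(2,1)] x]])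
  then show "((\<lambda>a. fderiv \<theta> a v) has_derivative
     (\<lambda>u. blinfun_apply (fderiv (\<lambda>a. Blinfun (fderiv \<theta> a)) x u) v)) (at x)"
    by (rule has_derivative_transform_within_open[OF _ \<theta>(2) x])
      (simp only: Blinfun_fderiv_apply[OF \<theta>(1)])
qed

text \<open>Point and direction both depend on the parameter, as for the velocity of an image curve
  or the second derivative of a composition; it is the product rule for applying an operator to a
  vector.\<close>

lemma has_derivative_fderiv_apply:
  fixes \<theta> :: "'k::euclidean_space \<Rightarrow> 'e::real_normed_vector"
  assumes \<theta>: "smooth_on D \<theta>" "open D" and T: "open T" "x \<in> T" "y ` T \<subseteq> D"
    and y: "(y has_derivative y') (at x)" and a: "(a has_derivative a') (at x)"
  shows "((\<lambda>r. fderiv \<theta> (y r) (a r)) has_derivative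
      (\<lambda>z. fderiv (\<lambda>q. fderiv \<theta> q (a x)) (y x) (y' z) + fderiv \<theta> (y x) (a' z))) (at x)"
proof -
  define F where "F q = Blinfun (fderiv \<theta> q)" for q
  have F_apply: "blinfun_apply (F q) = fderiv \<theta> q" if "q \<in> D" for q
    unfolding F_def by (rule Blinfun_fderiv_apply[OF \<theta>(1) that])
  have yx: "y x \<in> D" using T by auto
  have "((\<lambda>r. F (y r)) has_derivative (\<lambda>z. fderiv F (y x) (y' z))) (at x)"
    using diff_chain_at[OF y smooth_on_derivative[OF smooth_on_Blinfun_fderiv[OF \<theta>(2,1)] yx]]
    by (simp add: o_def F_def[abs_def])
  from bounded_bilinear.FDERIV[OF bounded_bilinear_blinfun_apply this a]
  have "((\<lambda>r. blinfun_apply (F (y r)) (a r)) has_derivative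
    (\<lambda>z. blinfun_apply (F (y x)) (a' z) + blinfun_apply (fderiv F (y x) (y' z)) (a x))) (at x)" .
  moreover have "blinfun_apply (F (y x)) (a' z) + blinfun_apply (fderiv F (y x) (y' z)) (a x) =
     fderiv (\<lambda>q. fderiv \<theta> q (a x)) (y x) (y' z) + fderiv \<theta> (y x) (a' z)" for z
    unfolding fderiv_fderiv_Blinfun[OF \<theta> yx] F_apply[OF yx] by (simp add: F_def[abs_def])
  ultimately have "((\<lambda>r. blinfun_apply (F (y r)) (a r)) has_derivative
    (\<lambda>z. fderiv (\<lambda>q. fderiv \<theta> q (a x)) (y x) (y' z) + fderiv \<theta> (y x) (a' z))) (at x)"
    by simp
  then show ?thesis
    by (rule has_derivative_transform_within_open[OF _ T(1,2)]) (use F_apply T(3) in auto)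
qed

lemma curve_image_velocity:
  assumes \<theta>: "smooth_on D \<theta>" and "y t \<in> D" "(y has_vector_derivative p) (at t)"
  shows "((\<lambda>r. \<theta> (y r)) has_vector_derivative fderiv \<theta> (y t) p) (at t)"
proof -
  have "((\<lambda>r. \<theta> (y r)) has_derivative (\<lambda>s. fderiv \<theta> (y t) (s *\<^sub>R p))) (at t)"
    using diff_chain_at[OF assms(3)[unfolded has_vector_derivative_def] smooth_on_derivative[OF \<theta> assms(2)]]
    by (simp add: o_def)
  then show ?thesis
    by (simp add: has_vector_derivative_def linear_cmul[OF smooth_on_linear_fderiv[OF \<theta> assms(2)]])
qed

lemma curve_image_acceleration:
  fixes \<theta> :: "'k::euclidean_space \<Rightarrow> 'e::real_normed_vector"
  assumes \<theta>: "smooth_on D \<theta>" "open D" and T: "open T" "t \<in> T" "y ` T \<subseteq> D"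
    and y: "(y has_vector_derivative p t) (at t)" and z: "(p has_vector_derivative z) (at t)"
  shows "((\<lambda>r. fderiv \<theta> (y r) (p r)) has_vector_derivative
      fderiv (\<lambda>a. fderiv \<theta> a (p t)) (y t) (p t) + fderiv \<theta> (y t) z) (at t)"
proof -
  have yt: "y t \<in> D" using T by auto
  have l: "linear (fderiv (\<lambda>a. fderiv \<theta> a (p t)) (y t))" "linear (fderiv \<theta> (y t))"
    by (rule smooth_on_linear_fderiv[OF smooth_on_fderiv[OF \<theta>(1)] yt])
      (rule smooth_on_linear_fderiv[OF \<theta>(1) yt])
  show ?thesis
    using has_derivative_fderiv_apply[OF \<theta> T y[unfolded has_vector_derivative_def]
        z[unfolded has_vector_derivative_def]]
    by (simp add: has_vector_derivative_def linear_cmul[OF l(1)] linear_cmul[OF l(2)] scaleR_add_right)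
qed

text \<open>\<open>p\<close> and \<open>z\<close> stand for velocity and coordinate acceleration of
  a curve in \<open>D\<close>: the covariant acceleration of its image is the image of the intrinsic
  one plus a normal term.\<close>

lemma isometric_curve_acceleration:
  assumes I: "isometric_map D g U h \<theta>" and x: "x \<in> D"
  shows "fderiv (\<lambda>a. fderiv \<theta> a p) x p + fderiv \<theta> x z + christoffel h (\<theta> x) (fderiv \<theta> x p) (fderiv \<theta> x p) =
    fderiv \<theta> x (z + christoffel g x p p) + second_form g h \<theta> x p p"
  by (simp add: second_form_def linear_add[OF smooth_on_linear_fderiv[OF isometric_mapD(3)[OF I] x]])

section \<open>Smooth dependence on initial velocities for the geodesic equation\<close>

section \<open>Superposition operators on bounded continuous functions\<close>

text \<open>The superposition (Nemytskii) operator. \<open>Bcontfun\<close> is meaningful only when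
  the composed function is bounded and continuous; below this is secured by a compact set of values
  on which \<open>G\<close> is continuous, or by linearity of \<open>G\<close>.\<close>

definition bcomp :: "('a::metric_space \<Rightarrow> 'b::metric_space) \<Rightarrow> (real \<Rightarrow>\<^sub>C 'a) \<Rightarrow> (real \<Rightarrow>\<^sub>C 'b)" where
  "bcomp G f = Bcontfun (\<lambda>t. G (apply_bcontfun f t))"

definition pointwise :: "('a::metric_space \<Rightarrow> 'b::metric_space \<Rightarrow> 'c::metric_space) \<Rightarrow>
    (real \<Rightarrow>\<^sub>C 'a) \<Rightarrow> (real \<Rightarrow>\<^sub>C 'b) \<Rightarrow> (real \<Rightarrow>\<^sub>C 'c)" where
  "pointwise B f g = Bcontfun (\<lambda>t. B (apply_bcontfun f t) (apply_bcontfun g t))"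

lemma bcomp_apply:
  fixes G :: "'a::real_normed_vector \<Rightarrow> 'b::real_normed_vector"
  assumes "continuous_on C G" "compact C" "\<And>t. apply_bcontfun f t \<in> C"
  shows "apply_bcontfun (bcomp G f) t = G (apply_bcontfun f t)"
proof -
  have "continuous_on UNIV (\<lambda>t. G (apply_bcontfun f t))"
    by (rule continuous_on_compose2[OF assms(1)]) (use assms(3) in auto)
  moreover have "bounded (range (\<lambda>t. G (apply_bcontfun f t)))"
    using compact_imp_bounded[OF compact_continuous_image[OF assms(1,2)]]
    by (rule bounded_subset) (use assms(3) in auto)
  ultimately show ?thesis
    unfolding bcomp_def by (subst Bcontfun_inverse) (auto simp: bcontfun_def)
qed

lemma bcomp_linear_apply:
  fixes L :: "'a::real_normed_vector \<Rightarrow> 'b::real_normed_vector"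
  assumes L: "bounded_linear L"
  shows "apply_bcontfun (bcomp L f) t = L (apply_bcontfun f t)"
proof -
  obtain K where K: "\<And>x. norm (L x) \<le> norm x * K" using bounded_linear.bounded[OF L] by blast
  have "norm (L (apply_bcontfun f t)) \<le> norm f * \<bar>K\<bar>" for t
  proof -
    have "norm (L (apply_bcontfun f t)) \<le> norm (apply_bcontfun f t) * \<bar>K\<bar>"
      using K[of "apply_bcontfun f t"] mult_left_mono[OF abs_ge_self[of K] norm_ge_zero[of "apply_bcontfun f t"]] by linarith
    then show ?thesis
      using mult_right_mono[OF norm_bounded[of f t], of "\<bar>K\<bar>"] by linarith
  qed
  moreover have "continuous_on UNIV (\<lambda>t. L (apply_bcontfun f t))"
    by (rule bounded_linear.continuous_on[OF L]) simp
  ultimately have "(\<lambda>t. L (apply_bcontfun f t)) \<in> bcontfun" by (intro bcontfun_normI)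
  then show ?thesis unfolding bcomp_def by (simp add: Bcontfun_inverse)
qed

lemma bounded_linear_bcomp:
  fixes L :: "'a::real_normed_vector \<Rightarrow> 'b::real_normed_vector"
  assumes L: "bounded_linear L"
  shows "bounded_linear (bcomp L)"
proof -
  interpret L: bounded_linear L by fact
  obtain K where K: "K > 0" "\<And>x. norm (L x) \<le> norm x * K" using L.pos_bounded by blast
  show ?thesis
  proof (rule bounded_linear_intro)
    show "norm (bcomp L f) \<le> norm f * K" for f
    proof (rule norm_bound)
      fix t
      show "norm (apply_bcontfun (bcomp L f) t) \<le> norm f * K"
        unfolding bcomp_linear_apply[OF L]
        using K(2)[of "apply_bcontfun f t"] mult_right_mono[OF norm_bounded[of f t], of K] K(1) by linarith
    qed
  qed (auto intro!: bcontfun_eqI simp: bcomp_linear_apply[OF L] L.add L.scaleR)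
qed

lemma pointwise_bound:
  fixes B :: "'a::real_normed_vector \<Rightarrow> 'b::real_normed_vector \<Rightarrow> 'c::real_normed_vector"
  assumes K: "K > 0" "\<And>a b. norm (B a b) \<le> norm a * norm b * K"
  shows "norm (B (apply_bcontfun f t) (apply_bcontfun g t)) \<le> norm f * norm g * K"
proof -
  have "norm (apply_bcontfun f t) * norm (apply_bcontfun g t) \<le> norm f * norm g"
    by (intro mult_mono norm_bounded) auto
  from mult_right_mono[OF this, of K] show ?thesis
    using K(2)[of "apply_bcontfun f t" "apply_bcontfun g t"] K(1) by linarith
qed

lemma pointwise_apply:
  fixes B :: "'a::real_normed_vector \<Rightarrow> 'b::real_normed_vector \<Rightarrow> 'c::real_normed_vector"
  assumes B: "bounded_bilinear B"
  shows "apply_bcontfun (pointwise B f g) t = B (apply_bcontfun f t) (apply_bcontfun g t)"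
proof -
  obtain K where K: "K > 0" "\<And>a b. norm (B a b) \<le> norm a * norm b * K"
    using bounded_bilinear.pos_bounded[OF B] by blast
  have "continuous_on UNIV (\<lambda>t. B (apply_bcontfun f t) (apply_bcontfun g t))"
    by (rule bounded_bilinear.continuous_on[OF B]) simp_all
  then have "(\<lambda>t. B (apply_bcontfun f t) (apply_bcontfun g t)) \<in> bcontfun"
    by (rule bcontfun_normI) (rule pointwise_bound[OF K])
  then show ?thesis unfolding pointwise_def by (simp add: Bcontfun_inverse)
qed

lemma bounded_bilinear_pointwise:
  fixes B :: "'a::real_normed_vector \<Rightarrow> 'b::real_normed_vector \<Rightarrow> 'c::real_normed_vector"
  assumes B: "bounded_bilinear B"
  shows "bounded_bilinear (pointwise B)"
proof -
  interpret B: bounded_bilinear B by fact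
  obtain K where K: "K > 0" "\<And>a b. norm (B a b) \<le> norm a * norm b * K"
    using B.pos_bounded by blast
  have "norm (pointwise B f g) \<le> norm f * norm g * K" for f g
    by (rule norm_bound) (simp only: pointwise_apply[OF B] pointwise_bound[OF K])
  then have "\<exists>K. \<forall>f g. norm (pointwise B f g) \<le> norm f * norm g * K" by blast
  moreover have "pointwise B (f + f') g = pointwise B f g + pointwise B f' g"
    "pointwise B f (g + g') = pointwise B f g + pointwise B f g'"
    "pointwise B (r *\<^sub>R f) g = r *\<^sub>R pointwise B f g"
    "pointwise B f (r *\<^sub>R g) = r *\<^sub>R pointwise B f g" for f f' g g' r
    by (auto intro!: bcontfun_eqI simp: pointwise_apply[OF B] B.add_left B.add_right B.scaleR_left B.scaleR_right)
  ultimately show ?thesis by (simp add: bounded_bilinear_def)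
qed

lemma apply_bcontfun_sum:
  "apply_bcontfun (\<Sum>i\<in>I. f i) t = (\<Sum>i\<in>I. apply_bcontfun (f i) t)"
  for f :: "'i \<Rightarrow> (real \<Rightarrow>\<^sub>C 'b::real_normed_vector)"
  by (induction I rule: infinite_finite_induct) auto

text \<open>Uniform continuity of the derivative on the compact set lets one \<open>d\<close> serve
  all base points, and convexity keeps the segments of the mean value inequality inside. This
  uniformity carries differentiability over to sup norms.\<close>

lemma uniform_linearization:
  fixes G :: "'a::euclidean_space \<Rightarrow> 'b::real_normed_vector"
  assumes G: "smooth_on W G" "open W" and C: "compact C" "convex C" "C \<subseteq> W" and e: "e > 0"
  shows "\<exists>d>0. \<forall>a\<in>C. \<forall>b\<in>C. norm (b - a) < d \<longrightarrow> norm (G b - G a - fderiv G a (b - a)) \<le> e * norm (b - a)"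
proof -
  define F where "F a = Blinfun (fderiv G a)" for a
  have F_apply: "blinfun_apply (F a) = fderiv G a" if "a \<in> C" for a
    unfolding F_def using that C(3) by (intro Blinfun_fderiv_apply[OF G(1)]) blast
  have "continuous_on C F"
    unfolding F_def using smooth_on_continuous[OF smooth_on_Blinfun_fderiv[OF G(2,1)]] C(3)
    by (rule continuous_on_subset)
  then have "uniformly_continuous_on C F" using C(1) by (rule compact_uniformly_continuous)
  then obtain d where d: "d > 0" "\<And>a b. a \<in> C \<Longrightarrow> b \<in> C \<Longrightarrow> dist b a < d \<Longrightarrow> dist (F b) (F a) < e"
    using e unfolding uniformly_continuous_on_def by metis
  have "norm (G b - G a - fderiv G a (b - a)) \<le> e * norm (b - a)"
    if ab: "a \<in> C" "b \<in> C" "norm (b - a) < d" for a b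
  proof -
    have seg: "closed_segment a b \<subseteq> C" using ab C(2) by (simp add: closed_segment_subset)
    have "norm (G b - G a - blinfun_apply (F a) (b - a)) \<le> norm (b - a) * e"
    proof (rule differentiable_bound_linearization[where S = "closed_segment a b" and f' = "\<lambda>x. blinfun_apply (F x)"])
      show "a + t *\<^sub>R (b - a) \<in> closed_segment a b" if "t \<in> {0..1}" for t
        using that by (auto simp: closed_segment_def algebra_simps intro!: exI[of _ t])
      show "(G has_derivative blinfun_apply (F x)) (at x within closed_segment a b)"
        if "x \<in> closed_segment a b" for x
      proof -
        have "x \<in> C" "x \<in> W" using that seg C(3) by auto
        then show ?thesis
          using has_derivative_at_withinI[OF smooth_on_derivative[OF G(1)]] by (simp add: F_apply)
      qed
      show "onorm (blinfun_apply (F x) - blinfun_apply (F a)) \<le> e" if "x \<in> closed_segment a b" for x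
      proof -
        have "dist x a < d" using that ab(3) segment_bound1[OF that] by (simp add: dist_norm norm_minus_commute)
        then have "norm (F x - F a) < e" using d(2)[of a x] ab seg that by (auto simp: dist_norm)
        moreover have "blinfun_apply (F x) - blinfun_apply (F a) = blinfun_apply (F x - F a)"
          by (auto simp: fun_eq_iff blinfun.diff_left)
        ultimately show ?thesis by (simp add: norm_blinfun.rep_eq)
      qed
    qed auto
    then show ?thesis by (simp add: F_apply ab mult.commute)
  qed
  then show ?thesis using d(1) by blast
qed

text \<open>The pointwise Taylor remainder is uniformly small, hence small in the sup norm. The
  derivative is taken within the functions with values in \<open>C\<close>, for which the
  superposition is under control.\<close>

lemma has_derivative_bcomp:
  fixes G :: "'a::euclidean_space \<Rightarrow> 'b::real_normed_vector"
  assumes G: "smooth_on W G" "open W" and C: "compact C" "convex C" "C \<subseteq> W"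
    and Z: "\<And>t. apply_bcontfun Z t \<in> C"
  shows "(bcomp G has_derivative pointwise blinfun_apply (bcomp (\<lambda>a. Blinfun (fderiv G a)) Z))
    (at Z within {Y. \<forall>t. apply_bcontfun Y t \<in> C})"
  unfolding has_derivative_within_alt
proof (intro conjI allI impI)
  show "bounded_linear (pointwise blinfun_apply (bcomp (\<lambda>a. Blinfun (fderiv G a)) Z))"
    by (rule bounded_bilinear.bounded_linear_right[OF bounded_bilinear_pointwise[OF bounded_bilinear_blinfun_apply]])
  fix e :: real assume e: "e > 0"
  obtain d where d: "d > 0"
    "\<And>a b. a \<in> C \<Longrightarrow> b \<in> C \<Longrightarrow> norm (b - a) < d \<Longrightarrow> norm (G b - G a - fderiv G a (b - a)) \<le> e * norm (b - a)"
    using uniform_linearization[OF G C e] by blast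
  have contG: "continuous_on C G" using smooth_on_continuous[OF G(1)] C(3) by (rule continuous_on_subset)
  have contF: "continuous_on C (\<lambda>a. Blinfun (fderiv G a))"
    using smooth_on_continuous[OF smooth_on_Blinfun_fderiv[OF G(2,1)]] C(3) by (rule continuous_on_subset)
  have "norm (bcomp G Y - bcomp G Z - pointwise blinfun_apply (bcomp (\<lambda>a. Blinfun (fderiv G a)) Z) (Y - Z))
      \<le> e * norm (Y - Z)" if Y: "\<And>t. apply_bcontfun Y t \<in> C" and YZ: "norm (Y - Z) < d" for Y
  proof (rule norm_bound)
    fix t
    have le: "norm (apply_bcontfun Y t - apply_bcontfun Z t) \<le> norm (Y - Z)"
      using norm_bounded[of "Y - Z" t] by simp
    have "norm (G (apply_bcontfun Y t) - G (apply_bcontfun Z t) -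
        fderiv G (apply_bcontfun Z t) (apply_bcontfun Y t - apply_bcontfun Z t)) \<le> e * norm (Y - Z)"
      using d(2)[OF Z[of t] Y[of t]] le YZ e mult_left_mono[OF le, of e] by linarith
    moreover have "blinfun_apply (Blinfun (fderiv G (apply_bcontfun Z t))) = fderiv G (apply_bcontfun Z t)"
      using Z[of t] C(3) by (intro Blinfun_fderiv_apply[OF G(1)]) blast
    ultimately show "norm (apply_bcontfun (bcomp G Y - bcomp G Z -
        pointwise blinfun_apply (bcomp (\<lambda>a. Blinfun (fderiv G a)) Z) (Y - Z)) t) \<le> e * norm (Y - Z)"
      by (simp add: bcomp_apply[OF contG C(1) Y] bcomp_apply[OF contG C(1) Z]
          pointwise_apply[OF bounded_bilinear_blinfun_apply] bcomp_apply[OF contF C(1) Z])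
  qed
  then show "\<exists>d>0. \<forall>y\<in>{Y. \<forall>t. apply_bcontfun Y t \<in> C}. norm (y - Z) < d \<longrightarrow>
      norm (bcomp G y - bcomp G Z - pointwise blinfun_apply (bcomp (\<lambda>a. Blinfun (fderiv G a)) Z) (y - Z))
      \<le> e * norm (y - Z)"
    using d(1) by blast
qed

text \<open>After expansion in a basis the derivative contains \<open>bcomp\<close> only for the
  partial derivatives of \<open>G\<close>, which are again smooth; the induction therefore runs over
  all \<open>G\<close> with \<open>Y\<close> fixed.\<close>

lemma times_diff_on_bcomp:
  fixes G :: "'a::euclidean_space \<Rightarrow> 'b::real_normed_vector"
  assumes G: "smooth_on W G" "open W" and C: "compact C" "convex C" "C \<subseteq> W"
    and S: "open S" and Y: "\<And>x t. x \<in> S \<Longrightarrow> apply_bcontfun (Y x) t \<in> C"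
    and "times_diff_on k S Y"
  shows "times_diff_on k S (\<lambda>x. bcomp G (Y x))"
  using G(1) assms(8)
proof (induction k arbitrary: G)
  case 0
  then have "continuous_on S Y" by simp
  moreover have "continuous_on {Y. \<forall>t. apply_bcontfun Y t \<in> C} (bcomp G)"
    by (rule has_derivative_continuous_on, rule has_derivative_bcomp[OF 0(1) G(2) C]) auto
  ultimately show ?case using Y by (auto intro: continuous_on_compose2)
next
  case (Suc k)
  note Yk = times_diff_on_SucD[OF Suc.prems(2)]
  show ?case
  proof (rule times_diff_on_SucI[OF S])
    fix x assume x: "x \<in> S"
    let ?A = "bcomp (\<lambda>a. Blinfun (fderiv G a)) (Y x)"
    have contF: "continuous_on C (\<lambda>a. Blinfun (fderiv G a))"
      using smooth_on_continuous[OF smooth_on_Blinfun_fderiv[OF G(2) Suc.prems(1)]] C(3) by (rule continuous_on_subset)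
    have contFi: "continuous_on C (\<lambda>a. fderiv G a i)" for i
      using smooth_on_continuous[OF smooth_on_fderiv[OF Suc.prems(1)]] C(3) by (rule continuous_on_subset)
    have "pointwise blinfun_apply ?A V = (\<Sum>i\<in>Basis. pointwise scaleR (bcomp (\<lambda>a. a \<bullet> i) V)
        (bcomp (\<lambda>a. fderiv G a i) (Y x)))" for V
    proof (rule bcontfun_eqI)
      fix t
      have W: "apply_bcontfun (Y x) t \<in> W" using Y[OF x] C by auto
      note d = smooth_on_derivative[OF Suc.prems(1) W]
      have "apply_bcontfun (pointwise blinfun_apply ?A V) t = fderiv G (apply_bcontfun (Y x) t) (apply_bcontfun V t)"
        by (simp add: pointwise_apply[OF bounded_bilinear_blinfun_apply] bcomp_apply[OF contF C(1) Y[OF x]]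
            Blinfun_fderiv_apply[OF Suc.prems(1) W])
      also have "\<dots> = (\<Sum>i\<in>Basis. (apply_bcontfun V t \<bullet> i) *\<^sub>R fderiv G (apply_bcontfun (Y x) t) i)"
        by (rule linear_eq_sum_Basis[OF has_derivative_linear[OF d]])
      finally show "apply_bcontfun (pointwise blinfun_apply ?A V) t = apply_bcontfun (\<Sum>i\<in>Basis.
          pointwise scaleR (bcomp (\<lambda>a. a \<bullet> i) V) (bcomp (\<lambda>a. fderiv G a i) (Y x))) t"
        by (simp add: apply_bcontfun_sum pointwise_apply[OF bounded_bilinear_scaleR]
            bcomp_linear_apply[OF bounded_linear_inner_left] bcomp_apply[OF contFi C(1) Y[OF x]])
    qed
    moreover have "((\<lambda>x. bcomp G (Y x)) has_derivative (\<lambda>v. pointwise blinfun_apply ?A (fderiv Y x v))) (at x)"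
    proof -
      have "((\<lambda>x. bcomp G (Y x)) has_derivative (\<lambda>v. pointwise blinfun_apply ?A (fderiv Y x v))) (at x within S)"
      proof (rule has_derivative_in_compose2[where g' = "\<lambda>Z. pointwise blinfun_apply
            (bcomp (\<lambda>a. Blinfun (fderiv G a)) Z)" and t = "{Y. \<forall>t. apply_bcontfun Y t \<in> C}"])
        show "(bcomp G has_derivative pointwise blinfun_apply (bcomp (\<lambda>a. Blinfun (fderiv G a)) Z))
            (at Z within {Y. \<forall>t. apply_bcontfun Y t \<in> C})" if "Z \<in> {Y. \<forall>t. apply_bcontfun Y t \<in> C}" for Z
          by (rule has_derivative_bcomp[OF Suc.prems(1) G(2) C]) (use that in auto)
        show "(Y has_derivative fderiv Y x) (at x within S)"
          by (rule has_derivative_at_withinI[OF times_diff_on_derivative[OF Suc.prems(2) x]])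
      qed (use Y x in auto)
      then show ?thesis using at_within_open[OF x S] by simp
    qed
    ultimately show "((\<lambda>x. bcomp G (Y x)) has_derivative (\<lambda>v. \<Sum>i\<in>Basis. pointwise scaleR
        (bcomp (\<lambda>a. a \<bullet> i) (fderiv Y x v)) (bcomp (\<lambda>a. fderiv G a i) (Y x)))) (at x)"
      by simp
  next
    fix v
    show "times_diff_on k S (\<lambda>x. \<Sum>i\<in>Basis. pointwise scaleR
        (bcomp (\<lambda>a. a \<bullet> i) (fderiv Y x v)) (bcomp (\<lambda>a. fderiv G a i) (Y x)))"
      by (intro times_diff_on_sum[OF S] times_diff_on_bilinear[OF bounded_bilinear_pointwise[OF bounded_bilinear_scaleR] S]
          times_diff_on_linear_comp[OF bounded_linear_bcomp[OF bounded_linear_inner_left] S] Suc.IH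
          smooth_on_fderiv Suc.prems(1) Yk Suc.prems(2)[unfolded times_diff_on.simps, THEN conjunct2, THEN spec])
  qed
qed

section \<open>Smooth dependence of fixed points on parameters\<close>

lemma smooth_on_convex_lipschitz:
  assumes G: "smooth_on W G" and C: "convex C" "C \<subseteq> W"
    and K: "\<And>x v. x \<in> C \<Longrightarrow> norm (fderiv G x v) \<le> K * norm v" "K \<ge> 0" and ab: "a \<in> C" "b \<in> C"
  shows "norm (G a - G b) \<le> K * norm (a - b)"
proof (rule differentiable_bound[OF C(1)])
  fix x assume x: "x \<in> C"
  then have "x \<in> W" using C(2) by blast
  then show "(G has_derivative fderiv G x) (at x within C)"
    by (rule has_derivative_at_withinI[OF smooth_on_derivative[OF G]])
  show "onorm (fderiv G x) \<le> K" using K x by (intro onorm_bound) auto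
qed (use ab in auto)

text \<open>In the application \<open>z v\<close> is the acceleration of a trajectory,
  \<open>J\<close> integrates it to position and velocity, and \<open>c v\<close> is the
  contribution of the initial velocity. The bound on \<open>\<eta> * \<kappa>\<close> makes the
  linearized operator \<open>w - P v (J w)\<close> invertible. Once \<open>z\<close> is of class k,
  so are the coefficients of the linear equation for its derivative, which gives class k +
  1.\<close>

lemma smooth_on_fixed_point:
  fixes G :: "'f::euclidean_space \<Rightarrow> 'e::euclidean_space"
    and z :: "'v::euclidean_space \<Rightarrow> (real \<Rightarrow>\<^sub>C 'e)"
  assumes G: "smooth_on W G" "open W" and C: "compact C" "convex C" "C \<subseteq> W"
    and V: "open V" and J: "bounded_linear J" and c: "bounded_linear c"
    and z: "\<And>v. v \<in> V \<Longrightarrow> z v = bcomp G (c0 + c v + J (z v))"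
    and zC: "\<And>v t. v \<in> V \<Longrightarrow> apply_bcontfun (c0 + c v + J (z v)) t \<in> C"
    and \<eta>: "\<And>a w. a \<in> C \<Longrightarrow> norm (fderiv G a w) \<le> \<eta> * norm w" "\<eta> \<ge> 0"
    and \<kappa>: "\<And>w. norm (J w) \<le> \<kappa> * norm w" and \<eta>\<kappa>: "\<eta> * \<kappa> \<le> 1 / 2"
  shows "smooth_on V z"
proof -
  interpret J: bounded_linear J by fact
  interpret c: bounded_linear c by fact
  define y where "y v = c0 + c v + J (z v)" for v
  define A where "A v = bcomp (\<lambda>a. Blinfun (fderiv G a)) (y v)" for v
  define P where "P v = pointwise blinfun_apply (A v)" for v
  note bb = bounded_bilinear_pointwise[OF bounded_bilinear_blinfun_apply]
  interpret P: bounded_linear "P v" for v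
    unfolding P_def by (rule bounded_bilinear.bounded_linear_right[OF bb])
  obtain Kc where Kc: "Kc > 0" "\<And>h. norm (c h) \<le> norm h * Kc" using c.pos_bounded by blast
  have yC: "apply_bcontfun (y v) t \<in> C" if "v \<in> V" for v t using zC[OF that] by (simp add: y_def)
  have zy: "z v = bcomp G (y v)" if "v \<in> V" for v using z[OF that] by (simp add: y_def)
  have contG: "continuous_on C G" using smooth_on_continuous[OF G(1)] C(3) by (rule continuous_on_subset)
  have contF: "continuous_on C (\<lambda>a. Blinfun (fderiv G a))"
    using smooth_on_continuous[OF smooth_on_Blinfun_fderiv[OF G(2,1)]] C(3) by (rule continuous_on_subset)
  have P_bound: "norm (P v w) \<le> \<eta> * norm w" if v: "v \<in> V" for v w
  proof (rule norm_bound)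
    fix t
    have "apply_bcontfun (y v) t \<in> W" using yC[OF v] C by auto
    then have "apply_bcontfun (P v w) t = fderiv G (apply_bcontfun (y v) t) (apply_bcontfun w t)"
      unfolding P_def A_def
      by (simp add: pointwise_apply[OF bounded_bilinear_blinfun_apply] bcomp_apply[OF contF C(1) yC[OF v]]
          Blinfun_fderiv_apply[OF G(1)])
    then show "norm (apply_bcontfun (P v w) t) \<le> \<eta> * norm w"
      using \<eta>(1)[OF yC[OF v, of t], of "apply_bcontfun w t"] mult_left_mono[OF norm_bounded[of w t] \<eta>(2)]
      by simp
  qed
  have PJ_bound: "norm (P v (J w)) \<le> 1 / 2 * norm w" if v: "v \<in> V" for v w
  proof -
    have "norm (P v (J w)) \<le> \<eta> * (\<kappa> * norm w)"
      using P_bound[OF v, of "J w"] mult_left_mono[OF \<kappa>[of w] \<eta>(2)] by linarith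
    also have "\<dots> \<le> 1 / 2 * norm w" using mult_right_mono[OF \<eta>\<kappa> norm_ge_zero[of w]] by (simp add: mult.assoc)
    finally show ?thesis .
  qed
  have lower: "norm w \<le> 2 * norm (w - P v (J w))" if v: "v \<in> V" for v w
    using PJ_bound[OF v, of w] norm_triangle_ineq2[of w "P v (J w)"] by linarith
  \<comment> \<open>Solving \<open>w - P v (J w) = b\<close> is again a fixed point problem, for a
    contraction with factor 1/2.\<close>
  have surj: "surj (\<lambda>w. w - P v (J w))" if v: "v \<in> V" for v
  proof -
    have "dist (b + P v (J w)) (b + P v (J w')) \<le> 1 / 2 * dist w w'" for b w w'
      using PJ_bound[OF v, of "w - w'"] by (simp add: dist_norm J.diff P.diff)
    then have "\<exists>!w. b + P v (J w) = w" for b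
      by (intro banach_fix_type[of "1/2"]) auto
    then have "\<exists>w. b + P v (J w) = w" for b by blast
    then have "\<exists>w. b = w - P v (J w)" for b by (metis add_diff_cancel_right')
    then show ?thesis unfolding surj_def by blast
  qed
  have G_lipschitz: "norm (G a - G b) \<le> \<eta> * norm (a - b)" if "a \<in> C" "b \<in> C" for a b
    using smooth_on_convex_lipschitz[OF G(1) C(2,3) \<eta>] that by blast
  have y_diff: "y v' - y v = c (v' - v) + J (z v' - z v)" for v v' by (simp add: y_def c.diff J.diff)
  \<comment> \<open>Lipschitz dependence precedes differentiability: it turns a remainder small
    relative to \<open>y v' - y v\<close> into one small relative to \<open>v' - v\<close>. The term
    with the factor \<open>\<eta> * \<kappa>\<close> is absorbed on the left.\<close>
  have z_lipschitz: "norm (z v' - z v) \<le> 2 * \<eta> * Kc * norm (v' - v)" if v: "v \<in> V" "v' \<in> V" for v v'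
  proof -
    have "norm (z v' - z v) \<le> \<eta> * norm (y v' - y v)"
    proof (rule norm_bound)
      fix t
      have "norm (apply_bcontfun (y v') t - apply_bcontfun (y v) t) \<le> norm (y v' - y v)"
        using norm_bounded[of "y v' - y v" t] by simp
      from mult_left_mono[OF this \<eta>(2)] show "norm (apply_bcontfun (z v' - z v) t) \<le> \<eta> * norm (y v' - y v)"
        using G_lipschitz[OF yC[OF v(2), of t] yC[OF v(1), of t]]
        by (simp add: zy v bcomp_apply[OF contG C(1) yC])
    qed
    also have "\<dots> \<le> \<eta> * (norm (c (v' - v)) + norm (J (z v' - z v)))"
      unfolding y_diff by (rule mult_left_mono[OF norm_triangle_ineq \<eta>(2)])
    also have "\<dots> \<le> \<eta> * (norm (v' - v) * Kc + \<kappa> * norm (z v' - z v))"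
      by (intro mult_left_mono add_mono Kc \<kappa> \<eta>)
    also have "\<dots> = \<eta> * Kc * norm (v' - v) + (\<eta> * \<kappa>) * norm (z v' - z v)" by (simp add: algebra_simps)
    also have "\<dots> \<le> \<eta> * Kc * norm (v' - v) + 1 / 2 * norm (z v' - z v)"
      by (intro add_left_mono mult_right_mono \<eta>\<kappa>) simp
    finally show ?thesis by simp
  qed
  define M where "M = Kc + \<bar>\<kappa>\<bar> * (2 * \<eta> * Kc) + 1"
  have M: "M > 0" unfolding M_def using Kc(1) \<eta>(2) by (simp add: add_pos_nonneg add_nonneg_pos)
  have y_lipschitz: "norm (y v' - y v) \<le> M * norm (v' - v)" if v: "v \<in> V" "v' \<in> V" for v v'
  proof -
    have "norm (J (z v' - z v)) \<le> \<bar>\<kappa>\<bar> * norm (z v' - z v)"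
      using \<kappa>[of "z v' - z v"] mult_right_mono[OF abs_ge_self[of \<kappa>] norm_ge_zero[of "z v' - z v"]] by linarith
    also have "\<dots> \<le> \<bar>\<kappa>\<bar> * (2 * \<eta> * Kc * norm (v' - v))"
      by (rule mult_left_mono[OF z_lipschitz[OF v]]) simp
    finally have "norm (y v' - y v) \<le> norm (v' - v) * Kc + \<bar>\<kappa>\<bar> * (2 * \<eta> * Kc * norm (v' - v))"
      unfolding y_diff using Kc(2)[of "v' - v"] norm_triangle_ineq[of "c (v' - v)" "J (z v' - z v)"] by linarith
    also have "\<dots> \<le> M * norm (v' - v)" unfolding M_def by (simp add: algebra_simps)
    finally show ?thesis .
  qed
  have deriv: "\<exists>D. (z has_derivative D) (at v) \<and> (\<forall>h. D h - P v (J (D h)) = P v (c h))" if v: "v \<in> V" for v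
  proof -
    define \<Lambda> where "\<Lambda> w = w - P v (J w)" for w
    have \<Lambda>_linear: "linear \<Lambda>"
      by (rule linearI) (simp_all add: \<Lambda>_def J.add P.add J.scaleR P.scaleR algebra_simps)
    have lower': "norm w \<le> 2 * norm (\<Lambda> w)" for w using lower[OF v] by (simp add: \<Lambda>_def)
    have \<Lambda>_inj: "w = w'" if "\<Lambda> w = \<Lambda> w'" for w w'
      using lower'[of "w - w'"] that by (simp add: linear_diff[OF \<Lambda>_linear])
    have "surj \<Lambda>" using surj[OF v] unfolding \<Lambda>_def[abs_def] .
    then have \<Lambda>_inv: "\<Lambda> (inv \<Lambda> b) = b" for b by (rule surj_f_inv_f)
    define D where "D h = inv \<Lambda> (P v (c h))" for h
    have \<Lambda>D: "\<Lambda> (D h) = P v (c h)" for h by (simp add: D_def \<Lambda>_inv)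
    have "linear D"
    proof (rule linearI)
      show "D (h + k) = D h + D k" for h k
        by (rule \<Lambda>_inj) (simp add: \<Lambda>D linear_add[OF \<Lambda>_linear] c.add P.add)
      show "D (r *\<^sub>R h) = r *\<^sub>R D h" for r h
        by (rule \<Lambda>_inj) (simp add: \<Lambda>D linear_cmul[OF \<Lambda>_linear] c.scaleR P.scaleR)
    qed
    then have D: "bounded_linear D" by (simp add: linear_conv_bounded_linear)
    have "(z has_derivative D) (at v)"
      unfolding has_derivative_at_alt
    proof (intro conjI D allI impI)
      fix e :: real assume e: "e > 0"
      have "(bcomp G has_derivative P v) (at (y v) within {Y. \<forall>t. apply_bcontfun Y t \<in> C})"
        unfolding P_def A_def by (rule has_derivative_bcomp[OF G C yC[OF v]])
      moreover have "e / (2 * M) > 0" using e M by simp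
      ultimately obtain d where d: "d > 0" "\<And>Y. (\<And>t. apply_bcontfun Y t \<in> C) \<Longrightarrow> norm (Y - y v) < d \<Longrightarrow>
          norm (bcomp G Y - bcomp G (y v) - P v (Y - y v)) \<le> e / (2 * M) * norm (Y - y v)"
        unfolding has_derivative_within_alt by blast
      obtain \<epsilon> where \<epsilon>: "\<epsilon> > 0" "ball v \<epsilon> \<subseteq> V" using V v open_contains_ball by blast
      have "norm (z v' - z v - D (v' - v)) \<le> e * norm (v' - v)" if v': "norm (v' - v) < min \<epsilon> (d / M)" for v'
      proof -
        have v'V: "v' \<in> V" using v' \<epsilon>(2) by (auto simp: dist_norm norm_minus_commute)
        have "M * norm (v' - v) < d" using v' M by (simp add: field_simps)
        then have "norm (y v' - y v) < d" using y_lipschitz[OF v v'V] by linarith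
        then have *: "norm (bcomp G (y v') - bcomp G (y v) - P v (y v' - y v)) \<le> e / (2 * M) * norm (y v' - y v)"
          using d(2)[of "y v'"] yC[OF v'V] by blast
        \<comment> \<open>\<open>\<Lambda>\<close> maps the unknown remainder of \<open>z\<close> to
          the Taylor remainder of the superposition operator at \<open>y v\<close>.\<close>
        have eq: "\<Lambda> (z v' - z v - D (v' - v)) = bcomp G (y v') - bcomp G (y v) - P v (y v' - y v)"
          unfolding linear_diff[OF \<Lambda>_linear, of "z v' - z v"] \<Lambda>D y_diff
          by (simp add: \<Lambda>_def zy[OF v] zy[OF v'V] P.add)
        have "norm (z v' - z v - D (v' - v)) \<le> 2 * norm (\<Lambda> (z v' - z v - D (v' - v)))"
          by (rule lower')
        also have "\<dots> \<le> 2 * (e / (2 * M) * norm (y v' - y v))"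
          unfolding eq by (rule mult_left_mono[OF *]) simp
        also have "\<dots> \<le> 2 * (e / (2 * M) * (M * norm (v' - v)))"
          using y_lipschitz[OF v v'V] e M by (intro mult_left_mono) auto
        also have "\<dots> = e * norm (v' - v)" using M by simp
        finally show ?thesis .
      qed
      moreover have "min \<epsilon> (d / M) > 0" using \<epsilon> d M by simp
      ultimately show "\<exists>d>0. \<forall>v'. norm (v' - v) < d \<longrightarrow> norm (z v' - z v - D (v' - v)) \<le> e * norm (v' - v)"
        by blast
    qed
    then show ?thesis using \<Lambda>D unfolding \<Lambda>_def by blast
  qed
  then obtain D where D: "\<And>v. v \<in> V \<Longrightarrow> (z has_derivative D v) (at v)"
    and D_eq: "\<And>v h. v \<in> V \<Longrightarrow> D v h - P v (J (D v h)) = P v (c h)"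
    by metis
  have "times_diff_on k V z" for k
  proof (induction k)
    case 0
    show ?case using has_derivative_continuous[OF D] V by (auto intro: continuous_at_imp_continuous_on)
  next
    case (Suc k)
    have yk: "times_diff_on k V y"
      unfolding y_def[abs_def]
      by (intro times_diff_on_add[OF V] times_diff_on_const times_diff_on_linear[OF c V]
          times_diff_on_linear_comp[OF J V] Suc.IH)
    have Ak: "times_diff_on k V A"
      unfolding A_def[abs_def]
      by (rule times_diff_on_bcomp[OF smooth_on_Blinfun_fderiv[OF G(2,1)] G(2) C V yC yk])
    \<comment> \<open>Brings the equation for \<open>D v h\<close> to the general form: the identity
      is the constant part and \<open>A\<close> the coefficient.\<close>
    have T: "bounded_bilinear (\<lambda>a w. pointwise blinfun_apply (- a) (J w) :: real \<Rightarrow>\<^sub>C 'e)"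
      by (rule bounded_bilinear.comp[OF bb bounded_linear_minus[OF bounded_linear_ident] J])
    have neg: "pointwise blinfun_apply (- A v) w = - P v w" for v w
      unfolding P_def by (rule bounded_bilinear.minus_left[OF bb])
    show ?case
    proof (rule times_diff_on_SucI[OF V D])
      fix h
      show "times_diff_on k V (\<lambda>v. D v h)"
      proof (rule times_diff_on_linear_equation[OF T bounded_linear_ident V, where a = A and b = "\<lambda>v. P v (c h)"])
        fix v assume v: "v \<in> V"
        show "D v h + pointwise blinfun_apply (- A v) (J (D v h)) = P v (c h)"
          using D_eq[OF v, of h] by (simp add: neg)
        show "\<exists>C. \<forall>w. norm w \<le> C * norm (w + pointwise blinfun_apply (- A v) (J w))"
          using lower[OF v] by (auto simp: neg)
        show "surj (\<lambda>w. w + pointwise blinfun_apply (- A v) (J w))"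
          using surj[OF v] by (simp add: neg)
      next
        show "times_diff_on k V (\<lambda>v. P v (c h))"
          unfolding P_def by (intro times_diff_on_bilinear[OF bb V] Ak times_diff_on_const)
      qed (rule Ak)
    qed
  qed
  then show ?thesis by (simp add: smooth_on_def)
qed

section \<open>Exponential maps\<close>

text \<open>Trajectories matter on [-1, 1] only; freezing time outside turns them into bounded
  continuous functions on the whole line, that is, into elements of a Banach space.\<close>

definition clip :: "real \<Rightarrow> real" where "clip t = max (- 1) (min 1 t)"

lemma clip_simps [simp]: "clip t \<in> {- 1..1}" "- 1 \<le> clip t" "clip t \<le> 1" "\<bar>clip t\<bar> \<le> 1"
  by (auto simp: clip_def)

lemma clip_id [simp]: "t \<in> {- 1..1} \<Longrightarrow> clip t = t"
  by (auto simp: clip_def)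

lemma continuous_on_clip: "continuous_on S clip"
  unfolding clip_def[abs_def] by (intro continuous_intros)

text \<open>The antiderivative vanishing at 0, frozen outside [-1, 1]. The difference of two
  integrals that start at -1 treats times of both signs alike.\<close>

definition primitive :: "(real \<Rightarrow>\<^sub>C 'e::euclidean_space) \<Rightarrow> (real \<Rightarrow>\<^sub>C 'e)" where
  "primitive z = Bcontfun (\<lambda>t. integral {- 1..clip t} (apply_bcontfun z) - integral {- 1..0} (apply_bcontfun z))"

lemma integral_bcontfun_bound:
  fixes z :: "real \<Rightarrow>\<^sub>C 'e::euclidean_space"
  assumes "- 1 \<le> t" "t \<le> 1" shows "norm (integral {- 1..t} (apply_bcontfun z)) \<le> 2 * norm z"
proof -
  have "norm (integral {- 1..t} (apply_bcontfun z)) \<le> norm z * (t - (- 1))"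
    using assms norm_bounded[of z] by (intro integral_bound) auto
  also have "\<dots> \<le> norm z * 2" using assms by (intro mult_left_mono) auto
  finally show ?thesis by simp
qed

lemma primitive_apply:
  "apply_bcontfun (primitive z) t = integral {- 1..clip t} (apply_bcontfun z) - integral {- 1..0} (apply_bcontfun z)"
  and primitive_bound: "norm (primitive z) \<le> 4 * norm z"
proof -
  let ?f = "\<lambda>t. integral {- 1..clip t} (apply_bcontfun z) - integral {- 1..0} (apply_bcontfun z)"
  have "continuous_on {- 1..1} (\<lambda>t. integral {- 1..t} (apply_bcontfun z))"
    by (intro indefinite_integral_continuous_1 integrable_continuous_real) simp
  then have "continuous_on UNIV (\<lambda>t. integral {- 1..clip t} (apply_bcontfun z))"
    by (rule continuous_on_compose2[OF _ continuous_on_clip]) (rule image_subsetI, rule clip_simps(1))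
  then have c: "continuous_on UNIV ?f" by (intro continuous_on_diff continuous_on_const)
  have b: "norm (?f t) \<le> 4 * norm z" for t
    using integral_bcontfun_bound[of "clip t" z] integral_bcontfun_bound[of 0 z]
      norm_triangle_ineq4[of "integral {- 1..clip t} (apply_bcontfun z)" "integral {- 1..0} (apply_bcontfun z)"]
    by simp
  from bcontfun_normI[OF c b] show a: "apply_bcontfun (primitive z) t = ?f t" for t
    unfolding primitive_def by (simp add: Bcontfun_inverse)
  show "norm (primitive z) \<le> 4 * norm z"
    by (rule norm_bound) (use a b in simp)
qed

lemma bounded_linear_primitive:
  "bounded_linear (primitive :: (real \<Rightarrow>\<^sub>C 'e::euclidean_space) \<Rightarrow> _)"
proof (rule bounded_linear_intro)
  have i: "apply_bcontfun z integrable_on {- 1..t}" for z :: "real \<Rightarrow>\<^sub>C 'e" and t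
    by (intro integrable_continuous_real) simp
  show "primitive (z + w) = primitive z + primitive w" for z w :: "real \<Rightarrow>\<^sub>C 'e"
    by (rule bcontfun_eqI) (simp add: primitive_apply integral_add[OF i i])
  show "primitive (r *\<^sub>R z) = r *\<^sub>R primitive z" for r and z :: "real \<Rightarrow>\<^sub>C 'e"
    by (rule bcontfun_eqI) (simp add: primitive_apply algebra_simps)
  show "norm (primitive z) \<le> norm z * 4" for z :: "real \<Rightarrow>\<^sub>C 'e" using primitive_bound[of z] by simp
qed

lemma primitive_0 [simp]: "apply_bcontfun (primitive z) 0 = 0"
  by (simp add: primitive_apply)

lemma primitive_derivative:
  assumes "t \<in> {- 1..1}"
  shows "(apply_bcontfun (primitive z) has_vector_derivative apply_bcontfun z t) (at t within {- 1..1})"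
proof -
  have "((\<lambda>t. integral {- 1..t} (apply_bcontfun z) - integral {- 1..0} (apply_bcontfun z)) has_vector_derivative
      apply_bcontfun z t - 0) (at t within {- 1..1})"
    by (intro has_vector_derivative_diff integral_has_vector_derivative assms has_vector_derivative_const) simp
  from has_vector_derivative_transform[OF assms _ this, of "apply_bcontfun (primitive z)"]
  show ?thesis by (simp add: primitive_apply)
qed

lemma primitive_eqI:
  assumes "\<And>\<tau>. \<tau> \<in> {- 1..1} \<Longrightarrow> (g has_vector_derivative apply_bcontfun z \<tau>) (at \<tau> within {- 1..1})"
  shows "apply_bcontfun (primitive z) t = g (clip t) - g 0"
proof -
  have "integral {- 1..\<tau>} (apply_bcontfun z) = g \<tau> - g (- 1)" if "- 1 \<le> \<tau>" "\<tau> \<le> 1" for \<tau>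
    using that
    by (intro integral_unique fundamental_theorem_of_calculus)
      (auto intro: has_vector_derivative_within_subset[OF assms])
  from this[of "clip t"] this[of 0] show ?thesis by (simp add: primitive_apply)
qed

lemma has_vector_derivative_rescale:
  fixes g :: "real \<Rightarrow> 'e::real_normed_vector"
  assumes s: "s \<in> {- 1..1}" and \<tau>: "\<tau> \<in> {- 1..1}"
    and g: "\<And>t. t \<in> {- 1..1} \<Longrightarrow> (g has_vector_derivative g' t) (at t within {- 1..1})"
  shows "((\<lambda>t. g (s * t)) has_vector_derivative s *\<^sub>R g' (s * \<tau>)) (at \<tau> within {- 1..1})"
proof -
  have mem: "s * t \<in> {- 1..1}" if "t \<in> {- 1..1}" for t
  proof -
    have "\<bar>s * t\<bar> \<le> 1 * 1" unfolding abs_mult by (rule mult_mono) (use s that in auto)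
    then show ?thesis by auto
  qed
  have "((\<lambda>t. s * t) has_vector_derivative s) (at \<tau> within {- 1..1})"
    by (auto intro!: derivative_eq_intros)
  from vector_diff_chain_within[OF this, of g "g' (s * \<tau>)"] show ?thesis
    using has_vector_derivative_within_subset[OF g[OF mem[OF \<tau>]]] mem by (auto simp: o_def image_subset_iff)
qed

text \<open>Displacement and velocity of uniform motion: the free part of a trajectory, to which the
  integrated acceleration is added.\<close>

definition line :: "'e::euclidean_space \<Rightarrow> (real \<Rightarrow>\<^sub>C ('e \<times> 'e))" where
  "line v = Bcontfun (\<lambda>t. (clip t *\<^sub>R v, v))"

lemma line_apply: "apply_bcontfun (line v) t = (clip t *\<^sub>R v, v)"
  and line_bound: "norm (line v) \<le> norm v * 2"
proof -
  have b: "norm (clip t *\<^sub>R v, v) \<le> norm v * 2" for t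
  proof -
    have "norm (clip t *\<^sub>R v, v) \<le> \<bar>clip t\<bar> * norm v + norm v" using norm_Pair_le[of "clip t *\<^sub>R v" v] by simp
    also have "\<dots> \<le> 1 * norm v + norm v" by (intro add_right_mono mult_right_mono) auto
    finally show ?thesis by simp
  qed
  have "(\<lambda>t. (clip t *\<^sub>R v, v)) \<in> bcontfun"
    by (rule bcontfun_normI[OF _ b]) (intro continuous_intros continuous_on_clip)
  then show a: "apply_bcontfun (line v) t = (clip t *\<^sub>R v, v)" for t
    by (simp add: line_def Bcontfun_inverse)
  show "norm (line v) \<le> norm v * 2"
    by (rule norm_bound) (simp only: a b)
qed

lemma bounded_linear_line: "bounded_linear (line :: 'e::euclidean_space \<Rightarrow> _)"
proof (rule bounded_linear_intro[where K = 2])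
  fix r :: real and v w :: 'e
  show "line (v + w) = line v + line w" "line (r *\<^sub>R v) = r *\<^sub>R line v"
    by (auto intro!: bcontfun_eqI simp: line_apply algebra_simps)
  show "norm (line v) \<le> norm v * 2" by (rule line_bound)
qed

text \<open>Along the curve \<open>(x0 + t *\<^sub>R u, t *\<^sub>R p)\<close> homogeneity extracts
  a factor \<open>t\<^sup>2\<close>, so the derivative at 0 vanishes, while the chain rule gives
  \<open>fderiv G (x0, 0) (u, p)\<close>. This makes the Lipschitz constant of \<open>G\<close> near
  \<open>(x0, 0)\<close> as small as desired.\<close>

lemma quadratic_field_fderiv_zero:
  fixes G :: "'e::euclidean_space \<times> 'e \<Rightarrow> 'e"
  assumes U: "open U" "x0 \<in> U" and G: "smooth_on (U \<times> UNIV) G"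
    and hom: "\<And>y p s. y \<in> U \<Longrightarrow> G (y, s *\<^sub>R p) = s\<^sup>2 *\<^sub>R G (y, p)"
  shows "fderiv G (x0, 0) w = 0"
proof -
  obtain u p where w: "w = (u, p)" by (cases w)
  have d0: "((\<lambda>t. (x0 + t *\<^sub>R u, t *\<^sub>R p)) has_derivative (\<lambda>t. (t *\<^sub>R u, t *\<^sub>R p))) (at 0)"
    by (auto intro!: derivative_eq_intros)
  have D1: "((\<lambda>t. G (x0 + t *\<^sub>R u, t *\<^sub>R p)) has_derivative (\<lambda>t. fderiv G (x0, 0) (t *\<^sub>R u, t *\<^sub>R p))) (at 0)"
    using diff_chain_at[OF d0, of G "fderiv G (x0, 0)"] smooth_on_derivative[OF G, of "(x0, 0)"] U
    by (simp add: o_def)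
  have d1: "((\<lambda>t. (x0 + t *\<^sub>R u, p)) has_derivative (\<lambda>t. (t *\<^sub>R u, 0))) (at 0)"
    by (auto intro!: derivative_eq_intros)
  have D2: "((\<lambda>t. G (x0 + t *\<^sub>R u, p)) has_derivative (\<lambda>t. fderiv G (x0, p) (t *\<^sub>R u, 0))) (at 0)"
    using diff_chain_at[OF d1, of G "fderiv G (x0, p)"] smooth_on_derivative[OF G, of "(x0, p)"] U
    by (simp add: o_def)
  have D3: "((\<lambda>t. t\<^sup>2 *\<^sub>R G (x0 + t *\<^sub>R u, p)) has_derivative (\<lambda>t. 0)) (at 0)"
    by (auto intro!: derivative_eq_intros D2)
  define T where "T = (\<lambda>t::real. x0 + t *\<^sub>R u) -` U"
  have T: "open T" unfolding T_def by (intro open_vimage U(1) continuous_intros)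
  have "((\<lambda>t. G (x0 + t *\<^sub>R u, t *\<^sub>R p)) has_derivative (\<lambda>t. 0)) (at 0)"
    by (rule has_derivative_transform_within_open[OF D3 T]) (use U in \<open>auto simp: T_def hom\<close>)
  from has_derivative_unique[OF D1 this] have "fderiv G (x0, 0) (1 *\<^sub>R u, 1 *\<^sub>R p) = 0" by metis
  then show ?thesis by (simp add: w)
qed

text \<open>\<open>F v\<close> is the position at time 1 of the trajectory that starts at
  \<open>x0\<close> with velocity \<open>v\<close>. By uniqueness of the fixed point and homogeneity
  of \<open>G\<close>, velocity \<open>s *\<^sub>R v\<close> gives the same trajectory run at speed
  \<open>s\<close>, so \<open>F (t *\<^sub>R v)\<close> is its position at time
  \<open>t\<close>.\<close>

lemma geodesic_flow:
  fixes G :: "'e::euclidean_space \<times> 'e \<Rightarrow> 'e"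
  assumes U: "open U" "x0 \<in> U" and G: "smooth_on (U \<times> UNIV) G"
    and hom: "\<And>y p s. y \<in> U \<Longrightarrow> G (y, s *\<^sub>R p) = s\<^sup>2 *\<^sub>R G (y, p)"
  obtains \<delta> F where "\<delta> > 0" "smooth_on (ball 0 \<delta>) F" "F ` ball 0 \<delta> \<subseteq> U" "F 0 = x0"
    "\<And>v. v \<in> ball 0 \<delta> \<Longrightarrow> \<exists>p. p 0 = v \<and> (\<forall>t\<in>{-1<..<1}.
       ((\<lambda>t. F (t *\<^sub>R v)) has_vector_derivative p t) (at t) \<and>
       (p has_vector_derivative G (F (t *\<^sub>R v), p t)) (at t))"
proof -
  define W where "W = U \<times> (UNIV :: 'e set)"
  have W: "open W" "(x0, 0) \<in> W" using U by (auto simp: W_def open_Times)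
  have GW: "smooth_on W G" using G by (simp add: W_def)
  have G0: "G (x0, 0) = 0" using hom[OF U(2), of 0 0] by simp
  define J where "J z = bcomp (\<lambda>a. (a, 0)) (primitive (primitive z)) + bcomp (\<lambda>a. (0, a)) (primitive z)"
    for z :: "real \<Rightarrow>\<^sub>C 'e"
  have pl: "bounded_linear (\<lambda>a::'e. (a, 0::'e))" "bounded_linear (\<lambda>a::'e. (0::'e, a))"
    by (intro bounded_linear_Pair bounded_linear_ident bounded_linear_zero)+
  have J: "bounded_linear J"
    unfolding J_def[abs_def]
    by (intro bounded_linear_add bounded_linear_compose[OF bounded_linear_bcomp[OF pl(1)]]
        bounded_linear_compose[OF bounded_linear_bcomp[OF pl(2)]]
        bounded_linear_compose[OF bounded_linear_primitive] bounded_linear_primitive)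
  have J_apply: "apply_bcontfun (J z) t =
      (apply_bcontfun (primitive (primitive z)) t, apply_bcontfun (primitive z) t)" for z t
    by (simp add: J_def bcomp_linear_apply[OF pl(1)] bcomp_linear_apply[OF pl(2)])
  interpret J: bounded_linear J by fact
  obtain \<kappa> where \<kappa>: "\<kappa> > 0" "\<And>z. norm (J z) \<le> norm z * \<kappa>" using J.pos_bounded by blast
  \<comment> \<open>The Lipschitz constant to be reached by shrinking the neighbourhood of
    \<open>(x0, 0)\<close>: times the bound \<open>\<kappa>\<close> of the integration operator it
    is 1/2.\<close>
  define \<eta> where "\<eta> = 1 / (2 * \<kappa>)"
  have \<eta>: "\<eta> > 0" "\<eta> * \<kappa> = 1 / 2" using \<kappa> by (auto simp: \<eta>_def)
  define F' where "F' a = Blinfun (fderiv G a)" for a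
  have F'_apply: "blinfun_apply (F' a) = fderiv G a" if "a \<in> W" for a
    unfolding F'_def by (rule Blinfun_fderiv_apply[OF GW that])
  have "F' (x0, 0) = 0"
    by (rule blinfun_eqI) (simp add: F'_apply W quadratic_field_fderiv_zero[OF U G hom])
  moreover have "isCont F' (x0, 0)"
    using smooth_on_continuous[OF smooth_on_Blinfun_fderiv[OF W(1) GW]] W
    unfolding F'_def[abs_def] by (simp add: continuous_on_eq_continuous_at)
  ultimately obtain d where d: "d > 0" "\<And>a. dist a (x0, 0) < d \<Longrightarrow> norm (F' a) < \<eta>"
    using \<eta>(1) unfolding continuous_at_eps_delta by (metis dist_0_norm dist_commute)
  obtain e where e: "e > 0" "cball (x0, 0) e \<subseteq> W" using W open_contains_cball by blast
  define r where "r = min e (d / 2)"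
  have r: "r > 0" "r \<le> e" "r < d" using d(1) e(1) by (auto simp: r_def)
  define C where "C = cball (x0, 0 :: 'e) r"
  have C: "compact C" "convex C" "C \<subseteq> W" using e(2) r(2) by (auto simp: C_def)
  have \<eta>C: "norm (fderiv G a w) \<le> \<eta> * norm w" if a: "a \<in> C" for a w
  proof -
    have "norm (F' a) \<le> \<eta>" using d(2)[of a] a r by (auto simp: C_def dist_commute)
    then have "norm (F' a) * norm w \<le> \<eta> * norm w" by (rule mult_right_mono) simp
    moreover have "blinfun_apply (F' a) = fderiv G a" using a C(3) by (intro F'_apply) auto
    ultimately show ?thesis using norm_blinfun[of "F' a" w] by auto
  qed
  have contG: "continuous_on C G" using smooth_on_continuous[OF GW] C(3) by (rule continuous_on_subset)
  have G_lipschitz: "norm (G a - G b) \<le> \<eta> * norm (a - b)" if "a \<in> C" "b \<in> C" for a b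
    using smooth_on_convex_lipschitz[OF GW C(2,3) \<eta>C less_imp_le[OF \<eta>(1)]] that by blast
  define c0 where "c0 = (const_bcontfun (x0, 0) :: real \<Rightarrow>\<^sub>C ('e \<times> 'e))"
  define Y where "Y v z = c0 + line v + J z" for v z
  \<comment> \<open>A velocity of norm below \<open>\<delta>\<close> contributes at most
    \<open>r / 2\<close> to the trajectory, and an acceleration of norm at most
    \<open>\<rho>\<close> contributes at most \<open>\<rho> * \<kappa> = r / 2\<close>, so the
    trajectory stays in \<open>C\<close>. Moreover \<open>\<rho> = \<eta> * r\<close>; together with
    \<open>G (x0, 0) = 0\<close> this makes the ball of radius \<open>\<rho>\<close>
    invariant.\<close>
  define \<rho> where "\<rho> = r / (2 * \<kappa>)"
  define \<delta> where "\<delta> = r / 4"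
  have \<rho>: "\<rho> > 0" "\<delta> > 0" using r \<kappa> by (auto simp: \<rho>_def \<delta>_def)
  have Y_apply: "apply_bcontfun (Y v z) t = (x0 + clip t *\<^sub>R v + apply_bcontfun (primitive (primitive z)) t,
      v + apply_bcontfun (primitive z) t)" for v z t
    by (simp add: Y_def c0_def line_apply J_apply)
  have YC: "apply_bcontfun (Y v z) t \<in> C" if v: "norm v < \<delta>" and z: "norm z \<le> \<rho>" for v z t
  proof -
    have "norm (J z) \<le> \<rho> * \<kappa>" using \<kappa>(2)[of z] mult_right_mono[OF z, of \<kappa>] \<kappa>(1) by linarith
    also have "\<rho> * \<kappa> = r / 2" using \<kappa>(1) by (simp add: \<rho>_def)
    finally have "norm (line v + J z) \<le> r"
      using line_bound[of v] v norm_triangle_ineq[of "line v" "J z"] by (simp add: \<delta>_def)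
    then have "norm (apply_bcontfun (line v + J z) t) \<le> r" using norm_bounded[of "line v + J z" t] by linarith
    moreover have "(x0, 0) + a \<in> C" if "norm a \<le> r" for a using that by (simp add: C_def dist_norm)
    moreover have "apply_bcontfun (Y v z) t = (x0, 0) + apply_bcontfun (line v + J z) t"
      by (simp add: Y_def c0_def add.assoc)
    ultimately show ?thesis by metis
  qed
  have N_lipschitz: "dist (bcomp G (Y v z)) (bcomp G (Y v w)) \<le> 1 / 2 * dist z w"
    if v: "norm v < \<delta>" and z: "norm z \<le> \<rho>" "norm w \<le> \<rho>" for v z w
  proof (rule dist_bound)
    fix t
    have "dist (apply_bcontfun (bcomp G (Y v z)) t) (apply_bcontfun (bcomp G (Y v w)) t)
        \<le> \<eta> * norm (apply_bcontfun (Y v z) t - apply_bcontfun (Y v w) t)"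
      using G_lipschitz[OF YC[OF v z(1), of t] YC[OF v z(2), of t]]
      by (simp add: bcomp_apply[OF contG C(1) YC[OF v z(1)]] bcomp_apply[OF contG C(1) YC[OF v z(2)]] dist_norm)
    also have "\<dots> = \<eta> * norm (apply_bcontfun (J (z - w)) t)" by (simp add: Y_def J.diff)
    also have "\<dots> \<le> \<eta> * (norm (z - w) * \<kappa>)"
      using \<eta>(1) order_trans[OF norm_bounded \<kappa>(2)] by (intro mult_left_mono) auto
    also have "\<dots> = (\<eta> * \<kappa>) * dist z w" by (simp add: dist_norm algebra_simps)
    finally show "dist (apply_bcontfun (bcomp G (Y v z)) t) (apply_bcontfun (bcomp G (Y v w)) t) \<le> 1 / 2 * dist z w"
      by (simp add: \<eta>(2))
  qed
  have N_bound: "norm (bcomp G (Y v z)) \<le> \<rho>" if v: "norm v < \<delta>" and z: "norm z \<le> \<rho>" for v z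
  proof (rule norm_bound)
    fix t
    have "(x0, 0) \<in> C" using r by (simp add: C_def)
    from G_lipschitz[OF YC[OF v z, of t] this]
    have "norm (G (apply_bcontfun (Y v z) t)) \<le> \<eta> * norm (apply_bcontfun (Y v z) t - (x0, 0))"
      by (simp add: G0)
    also have "\<dots> \<le> \<eta> * r"
      using YC[OF v z, of t] \<eta>(1) by (intro mult_left_mono) (auto simp: C_def dist_norm norm_minus_commute)
    also have "\<dots> = \<rho>" by (simp add: \<eta>_def \<rho>_def)
    finally show "norm (apply_bcontfun (bcomp G (Y v z)) t) \<le> \<rho>"
      by (simp add: bcomp_apply[OF contG C(1) YC[OF v z]])
  qed
  have ex1: "\<exists>!z. z \<in> cball 0 \<rho> \<and> bcomp G (Y v z) = z" if v: "norm v < \<delta>" for v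
  proof (rule Banach_fix[of "cball 0 \<rho>" "1 / 2"])
    show "complete (cball (0 :: real \<Rightarrow>\<^sub>C 'e) \<rho>)" by (simp add: complete_eq_closed)
    show "(\<lambda>z. bcomp G (Y v z)) ` cball 0 \<rho> \<subseteq> cball 0 \<rho>" using N_bound[OF v] by auto
  qed (use \<rho> N_lipschitz[OF v] in auto)
  define z where "z v = (THE z. z \<in> cball 0 \<rho> \<and> bcomp G (Y v z) = z)" for v
  have z: "norm (z v) \<le> \<rho>" "bcomp G (Y v (z v)) = z v" if "norm v < \<delta>" for v
    using theI'[OF ex1[OF that]] unfolding z_def[symmetric] by auto
  have z_unique: "z v = w" if "norm v < \<delta>" "norm w \<le> \<rho>" "bcomp G (Y v w) = w" for v w
    using ex1[OF that(1)] z[OF that(1)] that by (metis mem_cball_0)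
  have z_smooth: "smooth_on (ball 0 \<delta>) z"
  proof (rule smooth_on_fixed_point[OF GW W(1) C _ J bounded_linear_line, where ?c0.0 = c0 and \<eta> = \<eta> and \<kappa> = \<kappa>])
    show "apply_bcontfun (c0 + line v + J (z v)) t \<in> C" if "v \<in> ball 0 \<delta>" for v t
      using YC[of v "z v" t] z(1)[of v] that by (simp add: Y_def)
    show "z v = bcomp G (c0 + line v + J (z v))" if "v \<in> ball 0 \<delta>" for v
      using z(2)[of v] that by (simp add: Y_def)
    show "norm (J w) \<le> \<kappa> * norm w" for w using \<kappa>(2)[of w] by (simp add: mult.commute)
  qed (use \<eta> \<eta>C in auto)
  define pos where "pos v t = x0 + t *\<^sub>R v + apply_bcontfun (primitive (primitive (z v))) t" for v t
  define vel where "vel v t = v + apply_bcontfun (primitive (z v)) t" for v t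
  have posC: "(pos v t, vel v t) \<in> C" if "norm v < \<delta>" "t \<in> {- 1..1}" for v t
    using YC[OF that(1) z(1)[OF that(1)], of t] that(2) by (simp add: Y_apply pos_def vel_def)
  have z_ode: "apply_bcontfun (z v) t = G (pos v t, vel v t)" if "norm v < \<delta>" "t \<in> {- 1..1}" for v t
  proof -
    have "apply_bcontfun (z v) t = apply_bcontfun (bcomp G (Y v (z v))) t" by (simp add: z(2)[OF that(1)])
    also have "\<dots> = G (apply_bcontfun (Y v (z v)) t)"
      by (rule bcomp_apply[OF contG C(1) YC[OF that(1) z(1)[OF that(1)]]])
    finally show ?thesis using that(2) by (simp add: Y_apply pos_def vel_def)
  qed
  have pos_deriv: "(pos v has_vector_derivative vel v t) (at t within {- 1..1})"
    and vel_deriv: "(vel v has_vector_derivative apply_bcontfun (z v) t) (at t within {- 1..1})"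
    if "t \<in> {- 1..1}" for v t
    unfolding pos_def[abs_def] vel_def[abs_def]
    by (auto intro!: derivative_eq_intros primitive_derivative[OF that])
  have rescale: "pos (s *\<^sub>R v) 1 = pos v s" if v: "norm v < \<delta>" and s: "s \<in> {- 1..1}" for v s
  proof -
    have s1: "\<bar>s\<bar> \<le> 1" using s by auto
    have sv: "norm (s *\<^sub>R v) < \<delta>"
      using v s1 mult_left_le_one_le[of "norm v" "\<bar>s\<bar>"] by simp
    have mem: "s * clip t \<in> {- 1..1}" for t
    proof -
      have "\<bar>s * clip t\<bar> \<le> 1 * 1" unfolding abs_mult by (rule mult_mono) (use s in auto)
      then show ?thesis by auto
    qed
    \<comment> \<open>The acceleration of the trajectory of \<open>v\<close> run at speed
      \<open>s\<close>; it solves the equation for \<open>s *\<^sub>R v\<close>, so uniqueness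
      identifies it with \<open>z (s *\<^sub>R v)\<close>.\<close>
    define w where "w = Bcontfun (\<lambda>t. s\<^sup>2 *\<^sub>R apply_bcontfun (z v) (s * clip t))"
    have wb: "norm (s\<^sup>2 *\<^sub>R apply_bcontfun (z v) (s * clip t)) \<le> \<rho>" for t
    proof -
      have "s\<^sup>2 \<le> 1" using s1 by (simp add: abs_square_le_1)
      then have "s\<^sup>2 * norm (apply_bcontfun (z v) (s * clip t)) \<le> 1 * norm (z v)"
        by (intro mult_mono norm_bounded) auto
      then show ?thesis using z(1)[OF v] by simp
    qed
    have w_apply: "apply_bcontfun w t = s\<^sup>2 *\<^sub>R apply_bcontfun (z v) (s * clip t)" for t
    proof -
      have "continuous_on UNIV (\<lambda>t. apply_bcontfun (z v) (s * clip t))"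
        by (rule continuous_on_compose2[OF continuous_on_apply_bcontfun[of UNIV]])
          (auto intro!: continuous_intros continuous_on_clip)
      then have "continuous_on UNIV (\<lambda>t. s\<^sup>2 *\<^sub>R apply_bcontfun (z v) (s * clip t))"
        by (intro continuous_intros)
      from bcontfun_normI[OF this wb] show ?thesis by (simp add: w_def Bcontfun_inverse)
    qed
    have w_norm: "norm w \<le> \<rho>" by (rule norm_bound) (simp only: w_apply wb)
    have Pw: "apply_bcontfun (primitive w) t = s *\<^sub>R apply_bcontfun (primitive (z v)) (s * clip t)" for t
    proof -
      have "((\<lambda>\<tau>. s *\<^sub>R apply_bcontfun (primitive (z v)) (s * \<tau>)) has_vector_derivative
          apply_bcontfun w \<tau>) (at \<tau> within {- 1..1})" if "\<tau> \<in> {- 1..1}" for \<tau>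
        using bounded_linear.has_vector_derivative[OF bounded_linear_scaleR_right
            has_vector_derivative_rescale[OF s that primitive_derivative]] that
        by (simp add: w_apply power2_eq_square)
      from primitive_eqI[OF this] show ?thesis by simp
    qed
    have PPw: "apply_bcontfun (primitive (primitive w)) t = apply_bcontfun (primitive (primitive (z v))) (s * clip t)" for t
    proof -
      have "((\<lambda>\<tau>. apply_bcontfun (primitive (primitive (z v))) (s * \<tau>)) has_vector_derivative
          apply_bcontfun (primitive w) \<tau>) (at \<tau> within {- 1..1})" if "\<tau> \<in> {- 1..1}" for \<tau>
        using has_vector_derivative_rescale[OF s that primitive_derivative] that by (simp add: Pw)
      from primitive_eqI[OF this] show ?thesis by simp
    qed
    have "bcomp G (Y (s *\<^sub>R v) w) = w"
    proof (rule bcontfun_eqI)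
      fix t
      have "pos v (s * clip t) \<in> U" using posC[OF v mem[of t]] C(3) by (auto simp: W_def)
      moreover have "apply_bcontfun (Y (s *\<^sub>R v) w) t = (pos v (s * clip t), s *\<^sub>R vel v (s * clip t))"
        by (simp add: Y_apply Pw PPw pos_def vel_def algebra_simps)
      ultimately show "apply_bcontfun (bcomp G (Y (s *\<^sub>R v) w)) t = apply_bcontfun w t"
        using z_ode[OF v mem[of t]]
        by (simp add: bcomp_apply[OF contG C(1) YC[OF sv w_norm]] hom w_apply)
    qed
    then have "z (s *\<^sub>R v) = w" by (rule z_unique[OF sv w_norm])
    then show ?thesis by (simp add: pos_def PPw)
  qed
  define F where "F v = pos v 1" for v
  have ev: "bounded_linear (\<lambda>f :: real \<Rightarrow>\<^sub>C 'e. apply_bcontfun f 1)"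
    by (rule bounded_linear_intro[where K = 1]) (simp_all add: norm_bounded)
  have b: "open (ball (0::'e) \<delta>)" by simp
  have "smooth_on (ball 0 \<delta>) F"
    unfolding F_def[abs_def] pos_def scaleR_one
    by (intro smooth_on_add[OF b] smooth_on_const smooth_on_id[OF b]
        smooth_on_linear_comp[OF bounded_linear_compose[OF ev bounded_linear_compose[OF
          bounded_linear_primitive bounded_linear_primitive]] b z_smooth])
  moreover have "F ` ball 0 \<delta> \<subseteq> U"
  proof (rule image_subsetI)
    fix v :: 'e assume "v \<in> ball 0 \<delta>"
    then have "(pos v 1, vel v 1) \<in> W" using posC[of v 1] C(3) by auto
    then show "F v \<in> U" by (simp add: F_def W_def)
  qed
  moreover have "F 0 = x0" using rescale[of 0 0] \<rho> by (simp add: F_def pos_def)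
  moreover have "\<exists>p. p 0 = v \<and> (\<forall>t\<in>{-1<..<1}.
       ((\<lambda>t. F (t *\<^sub>R v)) has_vector_derivative p t) (at t) \<and>
       (p has_vector_derivative G (F (t *\<^sub>R v), p t)) (at t))" if "v \<in> ball 0 \<delta>" for v
  proof (intro exI[of _ "vel v"] conjI ballI)
    have v: "norm v < \<delta>" using that by simp
    show "vel v 0 = v" by (simp add: vel_def)
    fix t :: real assume t: "t \<in> {-1<..<1}"
    have at: "at t within {- 1..1} = at t" using t by (intro at_within_interior) simp
    have t': "t \<in> {- 1..1}" using t by auto
    have Fpos: "F (t *\<^sub>R v) = pos v t" if "t \<in> {-1<..<1}" for t
      unfolding F_def by (rule rescale[OF v]) (use that in auto)
    show "((\<lambda>t. F (t *\<^sub>R v)) has_vector_derivative vel v t) (at t)"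
      using pos_deriv[OF t', of v] unfolding at
      by (rule has_vector_derivative_transform_within_open[of _ _ _ "{-1<..<1}"]) (use t Fpos in auto)
    show "(vel v has_vector_derivative G (F (t *\<^sub>R v), vel v t)) (at t)"
      using vel_deriv[OF t', of v] unfolding at z_ode[OF v t'] Fpos[OF t] .
  qed
  ultimately show thesis using that \<rho>(2) by blast
qed

text \<open>The radial identity is the geodesic equation of \<open>F (t *\<^sub>R v)\<close>
  expressed by derivatives of \<open>F\<close> alone, since the velocity of this curve is
  \<open>fderiv F (t *\<^sub>R v) v\<close>. At time 0 that velocity is \<open>v\<close>, so the
  derivative of \<open>F\<close> at 0 is the identity and the inverse function theorem
  applies.\<close>

lemma exponential_map:
  assumes h: "riemannian_field U h" and x0: "x0 \<in> U"
  obtains \<delta> F Fi where "\<delta> > 0" "smooth_on (ball 0 \<delta>) F" "F ` ball 0 \<delta> \<subseteq> U" "F 0 = x0"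
    "\<And>w. fderiv F 0 w = w"
    "\<And>t v. t *\<^sub>R v \<in> ball 0 \<delta> \<Longrightarrow> fderiv (\<lambda>a. fderiv F a v) (t *\<^sub>R v) v +
       christoffel h (F (t *\<^sub>R v)) (fderiv F (t *\<^sub>R v) v) (fderiv F (t *\<^sub>R v) v) = 0"
    "open (F ` ball 0 \<delta>)" "homeomorphism (ball 0 \<delta>) (F ` ball 0 \<delta>) F Fi" "smooth_on (F ` ball 0 \<delta>) Fi"
    "\<And>x. x \<in> ball 0 \<delta> \<Longrightarrow> bij (fderiv F x)"
proof -
  note U = riemannian_fieldD(1)[OF h]
  define G where "G a = - christoffel h (fst a) (snd a) (snd a)" for a
  have oU: "open (U \<times> (UNIV :: 'a set))" using U by (simp add: open_Times)
  have "smooth_on (U \<times> UNIV) (\<lambda>a. christoffel h (fst a) (snd a) (snd a))"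
    by (rule smooth_on_bilinear_field[where B = "christoffel h", OF oU U _
        smooth_on_linear[OF bounded_linear_fst oU] christoffelD(1)[OF h] smooth_on_christoffel[OF h]
        smooth_on_linear[OF bounded_linear_snd oU] smooth_on_linear[OF bounded_linear_snd oU]]) auto
  then have G: "smooth_on (U \<times> UNIV) G"
    unfolding G_def[abs_def]
    by (rule smooth_on_linear_comp[OF bounded_linear_minus[OF bounded_linear_ident] oU])
  have hom: "G (y, s *\<^sub>R p) = s\<^sup>2 *\<^sub>R G (y, p)" if "y \<in> U" for y p s
    using christoffelD(1)[OF h that] by (simp add: G_def bilinear_lmul bilinear_rmul power2_eq_square)
  obtain \<delta>0 F where \<delta>0: "\<delta>0 > 0" and F: "smooth_on (ball 0 \<delta>0) F" "F ` ball 0 \<delta>0 \<subseteq> U" "F 0 = x0"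
    and flow: "\<And>v. v \<in> ball 0 \<delta>0 \<Longrightarrow> \<exists>p. p 0 = v \<and> (\<forall>t\<in>{-1<..<1}.
       ((\<lambda>t. F (t *\<^sub>R v)) has_vector_derivative p t) (at t) \<and>
       (p has_vector_derivative G (F (t *\<^sub>R v), p t)) (at t))"
    by (rule geodesic_flow[OF U x0 G]) (rule hom, assumption, rule that)
  have line: "((\<lambda>t. t *\<^sub>R v) has_vector_derivative v) (at t)" for v :: 'a and t
    by (auto intro!: derivative_eq_intros)
  have mem: "t *\<^sub>R v \<in> ball 0 \<delta>0" if "v \<in> ball 0 \<delta>0" "t \<in> {-1<..<1}" for v :: 'a and t :: real
  proof -
    have "\<bar>t\<bar> * norm v \<le> norm v" using that(2) by (intro mult_left_le_one_le) auto
    then show ?thesis using that(1) by auto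
  qed
  have radial1: "fderiv F 0 v = v \<and> (\<forall>t\<in>{-1<..<1}. fderiv (\<lambda>a. fderiv F a v) (t *\<^sub>R v) v +
       christoffel h (F (t *\<^sub>R v)) (fderiv F (t *\<^sub>R v) v) (fderiv F (t *\<^sub>R v) v) = 0)"
    if v: "v \<in> ball 0 \<delta>0" for v
  proof -
    obtain p where p0: "p 0 = v"
      and p: "\<And>t. t \<in> {-1<..<1} \<Longrightarrow> ((\<lambda>t. F (t *\<^sub>R v)) has_vector_derivative p t) (at t)"
      "\<And>t. t \<in> {-1<..<1} \<Longrightarrow> (p has_vector_derivative G (F (t *\<^sub>R v), p t)) (at t)"
      using flow[OF v] by blast
    have p_eq: "p t = fderiv F (t *\<^sub>R v) v" if t: "t \<in> {-1<..<1}" for t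
      by (rule vector_derivative_unique_at[OF p(1)[OF t] curve_image_velocity[OF F(1) mem[OF v t] line]])
    have "fderiv F 0 v = v" using p_eq[of 0] p0 by simp
    moreover have "fderiv (\<lambda>a. fderiv F a v) (t *\<^sub>R v) v +
       christoffel h (F (t *\<^sub>R v)) (fderiv F (t *\<^sub>R v) v) (fderiv F (t *\<^sub>R v) v) = 0" if t: "t \<in> {-1<..<1}" for t
    proof -
      have img: "(\<lambda>t. t *\<^sub>R v) ` {-1<..<1} \<subseteq> ball 0 \<delta>0" using mem[OF v] by blast
      have "((\<lambda>r. fderiv F (r *\<^sub>R v) v) has_vector_derivative
         fderiv (\<lambda>a. fderiv F a v) (t *\<^sub>R v) v + fderiv F (t *\<^sub>R v) 0) (at t)"
        by (rule curve_image_acceleration[OF F(1) open_ball open_greaterThanLessThan t img line has_vector_derivative_const])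
      then have "(p has_vector_derivative
         fderiv (\<lambda>a. fderiv F a v) (t *\<^sub>R v) v + fderiv F (t *\<^sub>R v) 0) (at t)"
        by (rule has_vector_derivative_transform_within_open[OF _ open_greaterThanLessThan t]) (simp add: p_eq)
      from vector_derivative_unique_at[OF this p(2)[OF t]] show ?thesis
        using linear_0[OF smooth_on_linear_fderiv[OF F(1) mem[OF v t]]] by (simp add: G_def p_eq[OF t])
    qed
    ultimately show ?thesis by blast
  qed
  have lin0: "linear (fderiv F 0)" using smooth_on_linear_fderiv[OF F(1), of 0] \<delta>0 by simp
  have dF0: "fderiv F 0 w = w" for w
  proof (cases "w = 0")
    case True
    then show ?thesis using linear_0[OF lin0] by simp
  next
    case False
    define c where "c = \<delta>0 / (2 * norm w)"
    have c: "c > 0" "c *\<^sub>R w \<in> ball 0 \<delta>0" using False \<delta>0 by (auto simp: c_def)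
    then show ?thesis using radial1[of "c *\<^sub>R w"] linear_cmul[OF lin0, of c w] by auto
  qed
  have radial: "fderiv (\<lambda>a. fderiv F a v) (t *\<^sub>R v) v +
       christoffel h (F (t *\<^sub>R v)) (fderiv F (t *\<^sub>R v) v) (fderiv F (t *\<^sub>R v) v) = 0"
    if tv: "t *\<^sub>R v \<in> ball 0 \<delta>0" for t v
  proof -
    \<comment> \<open>The flow is known for times of modulus below 1, so
      \<open>t *\<^sub>R v\<close> is read as time \<open>t / \<mu>\<close> on the ray of
      \<open>\<mu> *\<^sub>R v\<close>. Both terms of the identity are quadratic in the direction,
      so the square of \<open>\<mu>\<close> cancels.\<close>
    have "\<exists>\<mu>>\<bar>t\<bar>. \<mu> * norm v < \<delta>0"
    proof (cases "v = 0")
      case True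
      then show ?thesis using \<delta>0 by (intro exI[of _ "\<bar>t\<bar> + 1"]) auto
    next
      case False
      then have "\<bar>t\<bar> < \<delta>0 / norm v" using tv by (simp add: pos_less_divide_eq)
      then obtain \<mu> where "\<bar>t\<bar> < \<mu>" "\<mu> < \<delta>0 / norm v" using dense by blast
      then show ?thesis using False by (auto simp: pos_less_divide_eq)
    qed
    then obtain \<mu> where \<mu>: "\<bar>t\<bar> < \<mu>" "\<mu> * norm v < \<delta>0" by blast
    have \<mu>0: "\<mu> > 0" using \<mu>(1) by linarith
    have "\<mu> *\<^sub>R v \<in> ball 0 \<delta>0" "t / \<mu> \<in> {-1<..<1}" using \<mu> \<mu>0 by (auto simp: field_simps)
    then have eq: "fderiv (\<lambda>a. fderiv F a (\<mu> *\<^sub>R v)) (t *\<^sub>R v) (\<mu> *\<^sub>R v) +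
       christoffel h (F (t *\<^sub>R v)) (fderiv F (t *\<^sub>R v) (\<mu> *\<^sub>R v)) (fderiv F (t *\<^sub>R v) (\<mu> *\<^sub>R v)) = 0"
      using radial1[of "\<mu> *\<^sub>R v"] \<mu>0 by fastforce
    have l: "fderiv F x (\<mu> *\<^sub>R v) = \<mu> *\<^sub>R fderiv F x v" if "x \<in> ball 0 \<delta>0" for x
      by (rule linear_cmul[OF smooth_on_linear_fderiv[OF F(1) that]])
    have "fderiv (\<lambda>a. fderiv F a (\<mu> *\<^sub>R v)) (t *\<^sub>R v) = fderiv (\<lambda>a. \<mu> *\<^sub>R fderiv F a v) (t *\<^sub>R v)"
      by (rule fderiv_cong[OF open_ball tv l])
    also have "\<dots> = (\<lambda>w. \<mu> *\<^sub>R fderiv (\<lambda>a. fderiv F a v) (t *\<^sub>R v) w)"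
      by (rule fderiv_eq[OF has_derivative_scaleR_right[OF smooth_on_derivative[OF smooth_on_fderiv[OF F(1)] tv]]])
    finally have 1: "fderiv (\<lambda>a. fderiv F a (\<mu> *\<^sub>R v)) (t *\<^sub>R v) (\<mu> *\<^sub>R v) =
        \<mu> *\<^sub>R \<mu> *\<^sub>R fderiv (\<lambda>a. fderiv F a v) (t *\<^sub>R v) v"
      by (simp only: linear_cmul[OF smooth_on_linear_fderiv[OF smooth_on_fderiv[OF F(1)] tv]])
    have "F (t *\<^sub>R v) \<in> U" using F(2) tv by blast
    note bil = christoffelD(1)[OF h this]
    have "\<mu> *\<^sub>R \<mu> *\<^sub>R (fderiv (\<lambda>a. fderiv F a v) (t *\<^sub>R v) v +
       christoffel h (F (t *\<^sub>R v)) (fderiv F (t *\<^sub>R v) v) (fderiv F (t *\<^sub>R v) v)) = 0"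
      using eq unfolding 1 l[OF tv] bilinear_lmul[OF bil] bilinear_rmul[OF bil] by (simp add: scaleR_add_right)
    then show ?thesis using \<mu>0 by simp
  qed
  have "inj (fderiv F 0)" by (simp add: dF0 inj_on_def)
  moreover have "0 \<in> ball (0::'a) \<delta>0" using \<delta>0 by simp
  ultimately obtain U' V Fi where U': "open U'" "U' \<subseteq> ball 0 \<delta>0" "0 \<in> U'" and V: "open V"
    and hom': "homeomorphism U' V F Fi" and Fi: "smooth_on V Fi" and bij: "\<And>x. x \<in> U' \<Longrightarrow> bij (fderiv F x)"
    using smooth_inverse_function[OF open_ball F(1), of 0] by metis
  obtain \<delta> where \<delta>: "\<delta> > 0" "ball 0 \<delta> \<subseteq> U'" using U' open_contains_ball by blast
  have sub: "ball 0 \<delta> \<subseteq> ball (0::'a) \<delta>0" using \<delta> U' by blast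
  have FV: "F ` ball 0 \<delta> \<subseteq> V" using \<delta> hom' by (auto simp: homeomorphism_def)
  have img: "F ` ball 0 \<delta> = V \<inter> Fi -` ball 0 \<delta>"
    using \<delta>(2) hom' unfolding homeomorphism_def by (auto intro!: rev_image_eqI)
  have open_img: "open (F ` ball 0 \<delta>)"
    unfolding img by (rule continuous_open_preimage[OF _ V open_ball]) (use hom' in \<open>simp add: homeomorphism_def\<close>)
  have "homeomorphism (ball 0 \<delta>) (F ` ball 0 \<delta>) F Fi"
    by (rule homeomorphism_of_subsets[OF hom' \<delta>(2) order_refl refl])
  moreover have "smooth_on (F ` ball 0 \<delta>) Fi" by (rule smooth_on_subset[OF Fi FV])
  moreover have "smooth_on (ball 0 \<delta>) F" by (rule smooth_on_subset[OF F(1) sub])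
  moreover have "F ` ball 0 \<delta> \<subseteq> U" using F(2) sub by blast
  moreover have "bij (fderiv F x)" if "x \<in> ball 0 \<delta>" for x using bij \<delta>(2) that by blast
  ultimately show thesis using that[OF \<delta>(1) _ _ F(3) dF0 radial open_img] sub by blast
qed

section \<open>Linear algebra of traces and normal projections\<close>

section \<open>Orthonormal frames\<close>

text \<open>Unlike \<open>orthonormal_frame\<close> it fixes no cardinality, so it also describes
  bases of proper subspaces.\<close>

definition orthonormal_set :: "('k \<Rightarrow> 'k \<Rightarrow> real) \<Rightarrow> 'k set \<Rightarrow> bool" where
  "orthonormal_set B E \<longleftrightarrow> (\<forall>u\<in>E. \<forall>v\<in>E. B u v = (if u = v then 1 else 0))"

lemma orthonormal_frame_iff: "orthonormal_frame B E \<longleftrightarrow> card E = DIM('k) \<and> orthonormal_set B E"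
  for B :: "'k::euclidean_space \<Rightarrow> 'k \<Rightarrow> real"
  by (simp add: orthonormal_frame_def orthonormal_set_def)

lemma bilinear_sum_left:
  assumes "bilinear B"
  shows "B (\<Sum>e\<in>E. c e *\<^sub>R e) v = (\<Sum>e\<in>E. c e *\<^sub>R B e v)"
proof -
  have l: "linear (\<lambda>u. B u v)" using assms by (simp add: bilinear_def)
  show ?thesis
    by (simp add: linear_sum[OF l] linear_cmul[OF l])
qed

lemma bilinear_sum_right:
  assumes "bilinear B"
  shows "B v (\<Sum>e\<in>E. c e *\<^sub>R e) = (\<Sum>e\<in>E. c e *\<^sub>R B v e)"
proof -
  have l: "linear (B v)" using assms by (simp add: bilinear_def)
  show ?thesis
    by (simp add: linear_sum[OF l] linear_cmul[OF l])
qed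

lemma bilinear_sums:
  assumes "bilinear B"
  shows "B (\<Sum>e\<in>E. c e *\<^sub>R e) (\<Sum>f\<in>F. d f *\<^sub>R f) = (\<Sum>e\<in>E. \<Sum>f\<in>F. (c e * d f) *\<^sub>R B e f)"
  by (subst bilinear_sum_left[OF assms]) (simp add: bilinear_sum_right[OF assms] scaleR_sum_right)

lemma orthonormal_set_coefficient:
  assumes B: "bilinear B" and E: "orthonormal_set B E" "finite E" "f \<in> E"
  shows "B (\<Sum>e\<in>E. c e *\<^sub>R e) f = c f"
proof -
  have "B (\<Sum>e\<in>E. c e *\<^sub>R e) f = (\<Sum>e\<in>E. if e = f then c e else 0)"
    unfolding bilinear_sum_left[OF B] using E by (intro sum.cong) (auto simp: orthonormal_set_def)
  then show ?thesis using E by simp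
qed

lemma orthonormal_set_independent:
  fixes B :: "'k::euclidean_space \<Rightarrow> 'k \<Rightarrow> real"
  assumes B: "bilinear B" and E: "orthonormal_set B E" "finite E"
  shows "independent E"
proof (rule independent_if_scalars_zero[OF E(2)])
  fix c x assume "(\<Sum>x\<in>E. c x *\<^sub>R x) = 0" "x \<in> E"
  then show "c x = 0" using orthonormal_set_coefficient[OF B E, of x c] bilinear_lzero[OF B] by simp
qed

lemma orthonormal_frame_finite: "orthonormal_frame B E \<Longrightarrow> finite E"
  for B :: "'k::euclidean_space \<Rightarrow> 'k \<Rightarrow> real"
  using DIM_positive[where 'a = 'k] by (intro card_ge_0_finite) (simp add: orthonormal_frame_def)

lemma orthonormal_frame_expand:
  fixes B :: "'k::euclidean_space \<Rightarrow> 'k \<Rightarrow> real"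
  assumes B: "bilinear B" and E: "orthonormal_frame B E"
  shows "x = (\<Sum>e\<in>E. B x e *\<^sub>R e)"
proof -
  note fin = orthonormal_frame_finite[OF E]
  have on: "orthonormal_set B E" and card: "card E = DIM('k)" using E by (auto simp: orthonormal_frame_iff)
  have "independent E" by (rule orthonormal_set_independent[OF B on fin])
  then have "UNIV \<subseteq> span E" using card by (intro card_ge_dim_independent) auto
  then have "x \<in> span E" by blast
  then obtain c where x: "x = (\<Sum>e\<in>E. c e *\<^sub>R e)" by (auto simp: span_finite[OF fin])
  then show ?thesis using orthonormal_set_coefficient[OF B on fin, of _ c] by (auto intro!: sum.cong)
qed

text \<open>Gram-Schmidt, one vector at a time: as long as the dimension is not reached, some
  \<open>x\<close> lies outside the span of \<open>E\<close>, and its component orthogonal to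
  \<open>E\<close> can be normalized.\<close>

lemma orthonormal_frame_exists:
  fixes B :: "'k::euclidean_space \<Rightarrow> 'k \<Rightarrow> real"
  assumes B: "bilinear B" and sym: "\<And>u v. B u v = B v u" and pos: "\<And>u. u \<noteq> 0 \<Longrightarrow> B u u > 0"
  shows "\<exists>E. orthonormal_frame B E"
proof -
  have "\<exists>E. finite E \<and> card E = k \<and> orthonormal_set B E" if "k \<le> DIM('k)" for k
    using that
  proof (induction k)
    case 0
    then show ?case by (intro exI[of _ "{}"]) (auto simp: orthonormal_set_def)
  next
    case (Suc k)
    then obtain E where E: "finite E" "card E = k" "orthonormal_set B E" by auto
    have "dim (span E) < DIM('k)"
      using dim_le_card'[OF E(1)] E(2) Suc.prems by simp
    then obtain x where x: "x \<notin> span E" using dim_UNIV[where 'a = 'k] by (metis UNIV_eq_I less_irrefl)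
    define y where "y = x - (\<Sum>e\<in>E. B x e *\<^sub>R e)"
    have "(\<Sum>e\<in>E. B x e *\<^sub>R e) \<in> span E" by (intro span_sum span_scale span_base)
    with x have "y \<noteq> 0" by (auto simp: y_def)
    then have yy: "B y y > 0" by (rule pos)
    have ye: "B y e = 0" if "e \<in> E" for e
      using orthonormal_set_coefficient[OF B E(3,1) that] by (simp add: y_def bilinear_lsub[OF B])
    define u where "u = (1 / sqrt (B y y)) *\<^sub>R y"
    have uu: "B u u = 1" using yy by (simp add: u_def bilinear_lmul[OF B] bilinear_rmul[OF B])
    have ue: "B u e = 0" if "e \<in> E" for e using ye[OF that] by (simp add: u_def bilinear_lmul[OF B])
    have "u \<notin> E" using uu ue by force
    moreover have "orthonormal_set B (insert u E)"
      unfolding orthonormal_set_def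
    proof (intro ballI)
      fix a b assume "a \<in> insert u E" "b \<in> insert u E"
      then consider "a = u" "b = u" | "a = u" "b \<in> E" | "a \<in> E" "b = u" | "a \<in> E" "b \<in> E" by blast
      then show "B a b = (if a = b then 1 else 0)"
        by cases (use uu ue sym[of a u] \<open>u \<notin> E\<close> E(3) in \<open>auto simp: orthonormal_set_def\<close>)
    qed
    ultimately show ?case using E by (intro exI[of _ "insert u E"]) auto
  qed
  from this[of "DIM('k)"] show ?thesis by (auto simp: orthonormal_frame_iff)
qed

text \<open>Expanding the vectors of \<open>E\<close> in \<open>F\<close> leaves the sums of
  \<open>B e f * B e f'\<close> over \<open>E\<close>, which equal \<open>B f f'\<close> by
  expansion in \<open>E\<close>. This frees \<open>mean_curvature\<close> from the frame that its
  choice operator picks.\<close>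

lemma trace_frame_independent:
  fixes B :: "'k::euclidean_space \<Rightarrow> 'k \<Rightarrow> real" and Q :: "'k \<Rightarrow> 'k \<Rightarrow> 'e::real_vector"
  assumes B: "bilinear B" "\<And>u v. B u v = B v u" and Q: "bilinear Q"
    and E: "orthonormal_frame B E" and F: "orthonormal_frame B F"
  shows "(\<Sum>e\<in>E. Q e e) = (\<Sum>f\<in>F. Q f f)"
proof -
  note fin = orthonormal_frame_finite[OF E] orthonormal_frame_finite[OF F]
  have "Q e e = (\<Sum>f\<in>F. \<Sum>f'\<in>F. (B e f * B e f') *\<^sub>R Q f f')" for e
  proof -
    have "Q e e = Q (\<Sum>f\<in>F. B e f *\<^sub>R f) (\<Sum>f\<in>F. B e f *\<^sub>R f)"
      using orthonormal_frame_expand[OF B(1) F, of e] by simp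
    then show ?thesis by (simp add: bilinear_sums[OF Q])
  qed
  then have "(\<Sum>e\<in>E. Q e e) = (\<Sum>e\<in>E. \<Sum>f\<in>F. \<Sum>f'\<in>F. (B e f * B e f') *\<^sub>R Q f f')" by simp
  also have "\<dots> = (\<Sum>f\<in>F. \<Sum>e\<in>E. \<Sum>f'\<in>F. (B e f * B e f') *\<^sub>R Q f f')" by (rule sum.swap)
  also have "\<dots> = (\<Sum>f\<in>F. \<Sum>f'\<in>F. \<Sum>e\<in>E. (B e f * B e f') *\<^sub>R Q f f')"
    by (rule sum.cong[OF refl], rule sum.swap)
  also have "\<dots> = (\<Sum>f\<in>F. \<Sum>f'\<in>F. B f f' *\<^sub>R Q f f')"
  proof (intro sum.cong refl)
    fix f f'
    have "B f f' = B (\<Sum>e\<in>E. B f e *\<^sub>R e) f'" using orthonormal_frame_expand[OF B(1) E, of f] by simp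
    also have "\<dots> = (\<Sum>e\<in>E. B e f * B e f')" by (simp add: bilinear_sum_left[OF B(1)] B(2)[of f])
    finally show "(\<Sum>e\<in>E. (B e f * B e f') *\<^sub>R Q f f') = B f f' *\<^sub>R Q f f'" by (simp add: scaleR_sum_left)
  qed
  also have "\<dots> = (\<Sum>f\<in>F. \<Sum>f'\<in>F. if f' = f then Q f f' else 0)"
    using F by (intro sum.cong refl) (auto simp: orthonormal_frame_def)
  also have "\<dots> = (\<Sum>f\<in>F. Q f f)" using fin by simp
  finally show ?thesis .
qed

text \<open>Exchanging one unit vector of an orthonormal \<open>s\<close>-frame shows that \<open>Q\<close> takes the same value
  on \<open>e\<close>, on \<open>e'\<close> and on \<open>(e + e') / sqrt 2\<close>, so \<open>Q\<close> is diagonal with equal entries.\<close>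

lemma bilinear_umbilic_if_partial_traces_constant:
  fixes B :: "'k::euclidean_space \<Rightarrow> 'k \<Rightarrow> real" and Q :: "'k \<Rightarrow> 'k \<Rightarrow> 'e::real_vector"
  assumes B: "bilinear B" "\<And>u v. B u v = B v u" and Q: "bilinear Q" "\<And>u v. Q u v = Q v u"
    and E: "orthonormal_frame B E" and s: "0 < s" "s \<le> DIM('k) - 1"
    and const: "\<And>T. finite T \<Longrightarrow> card T = s \<Longrightarrow> orthonormal_set B T \<Longrightarrow> (\<Sum>e\<in>T. Q e e) = K"
  shows "Q u v = B u v *\<^sub>R ((1 / real DIM('k)) *\<^sub>R (\<Sum>e\<in>E. Q e e))"
proof -
  note fin = orthonormal_frame_finite[OF E]
  have on: "orthonormal_set B E" and card: "card E = DIM('k)" using E by (auto simp: orthonormal_frame_iff)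
  have key: "Q e e = Q e' e' \<and> Q e e' = 0" if e: "e \<in> E" "e' \<in> E" "e \<noteq> e'" for e e'
  proof -
    have "card (E - {e, e'}) = DIM('k) - 2" using e card fin by (simp add: card_Diff_subset)
    \<comment> \<open>The bound on \<open>s\<close> enters here: besides \<open>e\<close> and
      \<open>e'\<close> the frame still has \<open>s - 1\<close> vectors, so either of the two can
      be completed to an \<open>s\<close>-set without the other.\<close>
    then have "s - 1 \<le> card (E - {e, e'})" using s by simp
    then obtain W where W: "W \<subseteq> E - {e, e'}" "card W = s - 1" "finite W"
      by (rule obtain_subset_with_card_n)
    have ortho: "B e e = 1" "B e' e' = 1" "B e e' = 0" "B e' e = 0"
      using on e by (auto simp: orthonormal_set_def)
    \<comment> \<open>Every unit vector orthogonal to \<open>W\<close> completes it to an admissible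
      set, so \<open>Q\<close> takes the same value on all of them.\<close>
    have unit_val: "Q a a = K - (\<Sum>e\<in>W. Q e e)" if aa: "B a a = 1" and aw: "\<And>w. w \<in> W \<Longrightarrow> B a w = 0" for a
    proof -
      have "a \<notin> W" using aa aw by force
      have onW: "orthonormal_set B W" using on W(1) unfolding orthonormal_set_def by blast
      have "orthonormal_set B (insert a W)"
        unfolding orthonormal_set_def
      proof (intro ballI)
        fix x y assume "x \<in> insert a W" "y \<in> insert a W"
        then consider "x = a" "y = a" | "x = a" "y \<in> W" | "x \<in> W" "y = a" | "x \<in> W" "y \<in> W" by blast
        then show "B x y = (if x = y then 1 else 0)"
          by cases (use aa aw B(2)[of x a] \<open>a \<notin> W\<close> onW in \<open>auto simp: orthonormal_set_def\<close>)
      qed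
      then have "(\<Sum>e\<in>insert a W. Q e e) = K"
        using W(2,3) s(1) \<open>a \<notin> W\<close> by (intro const) auto
      then show ?thesis using W(3) \<open>a \<notin> W\<close> by (simp add: algebra_simps)
    qed
    have we: "B e w = 0" "B e' w = 0" if "w \<in> W" for w
    proof -
      have "w \<in> E" "w \<noteq> e" "w \<noteq> e'" using that W(1) by auto
      then show "B e w = 0" "B e' w = 0" using on e by (auto simp: orthonormal_set_def)
    qed
    define a where "a = (1 / sqrt 2) *\<^sub>R (e + e')"
    have Ba: "B a a = 1"
      by (simp add: a_def bilinear_lmul[OF B(1)] bilinear_rmul[OF B(1)] bilinear_ladd[OF B(1)]
          bilinear_radd[OF B(1)] ortho)
    have Qa: "Q a a = (1 / 2) *\<^sub>R (Q e e + Q e' e' + 2 *\<^sub>R Q e e')"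
      by (simp add: a_def bilinear_lmul[OF Q(1)] bilinear_rmul[OF Q(1)] bilinear_ladd[OF Q(1)]
          bilinear_radd[OF Q(1)] Q(2)[of e' e] scaleR_add_right scaleR_2 algebra_simps)
    have 1: "Q e e = K - (\<Sum>e\<in>W. Q e e)" by (rule unit_val[OF ortho(1) we(1)])
    have 2: "Q e' e' = K - (\<Sum>e\<in>W. Q e e)" by (rule unit_val[OF ortho(2) we(2)])
    have 3: "Q a a = K - (\<Sum>e\<in>W. Q e e)"
      by (rule unit_val[OF Ba]) (simp add: a_def bilinear_lmul[OF B(1)] bilinear_ladd[OF B(1)] we)
    have "Q a a = Q e e + Q e e'"
      unfolding Qa using 1 2 by (simp add: scaleR_add_right scaleR_half_double flip: scaleR_2)
    then have "Q e e' = 0" using 1 3 by simp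
    then show ?thesis using 1 2 by simp
  qed
  obtain e0 where e0: "e0 \<in> E" using card DIM_positive[where 'a = 'k] by (metis card.empty equals0I less_irrefl)
  have Qee: "Q e e = Q e0 e0" if "e \<in> E" for e using key[OF that e0] by metis
  have Quv: "Q u v = B u v *\<^sub>R Q e0 e0"
  proof -
    have "Q u v = Q (\<Sum>e\<in>E. B u e *\<^sub>R e) (\<Sum>e\<in>E. B v e *\<^sub>R e)"
      using orthonormal_frame_expand[OF B(1) E] by metis
    also have "\<dots> = (\<Sum>e\<in>E. \<Sum>e'\<in>E. (B u e * B v e') *\<^sub>R Q e e')"
      by (rule bilinear_sums[OF Q(1)])
    also have "\<dots> = (\<Sum>e\<in>E. \<Sum>e'\<in>E. if e' = e then (B u e * B v e) *\<^sub>R Q e0 e0 else 0)"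
      using key Qee by (intro sum.cong refl) auto
    also have "\<dots> = (\<Sum>e\<in>E. B u e * B v e) *\<^sub>R Q e0 e0" using fin by (simp add: scaleR_sum_left)
    also have "(\<Sum>e\<in>E. B u e * B v e) = B u (\<Sum>e\<in>E. B v e *\<^sub>R e)"
      by (simp add: bilinear_sum_right[OF B(1)] mult.commute)
    also have "\<dots> = B u v" using orthonormal_frame_expand[OF B(1) E, of v] by simp
    finally show ?thesis .
  qed
  have "(\<Sum>e\<in>E. Q e e) = real DIM('k) *\<^sub>R Q e0 e0" using Qee card by (simp add: sum_constant_scaleR)
  then show ?thesis unfolding Quv by simp
qed

text \<open>\<open>P\<close> is the pseudo-inverse of \<open>A\<close> with respect to
  \<open>h\<close>: it gives the coordinates of the orthogonal projection onto the range of
  \<open>A\<close>. With the normal space as its kernel, the sum of the image of a subspace and the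
  normal space becomes a preimage under \<open>P\<close>.\<close>

lemma normal_projection:
  fixes A :: "'m::euclidean_space \<Rightarrow> 'e::euclidean_space" and h :: "'e \<Rightarrow> 'e \<Rightarrow> real"
  assumes h: "bilinear h" "\<And>u v. h u v = h v u" and A: "linear A"
    and E: "orthonormal_frame (\<lambda>u v. h (A u) (A v)) E"
  defines "P \<equiv> \<lambda>w. \<Sum>e\<in>E. h w (A e) *\<^sub>R e"
  shows "linear P" "P (A u) = u" "P w = 0 \<longleftrightarrow> (\<forall>u. h (A u) w = 0)"
proof -
  show "linear P"
    unfolding P_def
    by (rule linearI) (simp_all add: bilinear_ladd[OF h(1)] bilinear_lmul[OF h(1)] scaleR_add_left
        sum.distrib scaleR_sum_right)
  have B: "bilinear (\<lambda>u v. h (A u) (A v))"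
    unfolding bilinear_def
    by (auto intro!: linearI simp: linear_add[OF A] linear_cmul[OF A] bilinear_ladd[OF h(1)] bilinear_lmul[OF h(1)]
        bilinear_radd[OF h(1)] bilinear_rmul[OF h(1)])
  show "P (A u) = u" for u unfolding P_def using orthonormal_frame_expand[OF B E, of u] by simp
  show "P w = 0 \<longleftrightarrow> (\<forall>u. h (A u) w = 0)"
  proof
    assume Pw: "P w = 0"
    have on: "orthonormal_set (\<lambda>u v. h (A u) (A v)) E" using E by (simp add: orthonormal_frame_iff)
    have c: "h w (A e) = 0" if "e \<in> E" for e
    proof -
      have "h w (A e) = h (A (P w)) (A e)"
        using orthonormal_set_coefficient[OF B on orthonormal_frame_finite[OF E] that, of "\<lambda>e. h w (A e)"]
        by (simp add: P_def)
      then show ?thesis by (simp add: Pw linear_0[OF A] bilinear_lzero[OF h(1)])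
    qed
    show "\<forall>u. h (A u) w = 0"
    proof
      fix u
      have Au: "A u = (\<Sum>e\<in>E. h (A u) (A e) *\<^sub>R A e)"
      proof -
        have "A u = A (\<Sum>e\<in>E. h (A u) (A e) *\<^sub>R e)" using orthonormal_frame_expand[OF B E, of u] by simp
        then show ?thesis by (simp add: linear_sum[OF A] linear_cmul[OF A])
      qed
      have l: "linear (h w)" using h(1) by (simp add: bilinear_def)
      have "h w (A u) = h w (\<Sum>e\<in>E. h (A u) (A e) *\<^sub>R A e)" by (rule arg_cong[OF Au])
      also have "\<dots> = (\<Sum>e\<in>E. h (A u) (A e) *\<^sub>R h w (A e))"
        by (simp add: linear_sum[OF l] linear_cmul[OF l])
      finally have "h w (A u) = (\<Sum>e\<in>E. h (A u) (A e) *\<^sub>R h w (A e))" .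
      then show "h (A u) w = 0" using c h(2)[of w] by simp
    qed
  next
    assume "\<forall>u. h (A u) w = 0"
    then show "P w = 0" using h(2)[of w] by (simp add: P_def)
  qed
qed

text \<open>The preimage of \<open>V\<close> is the direct sum of the image of \<open>V\<close>
  under \<open>A\<close> and the kernel of \<open>P\<close>; comparing \<open>W\<close> with the
  whole space eliminates the dimension of the kernel.\<close>

lemma dim_linear_vimage:
  fixes A :: "'m::euclidean_space \<Rightarrow> 'e::euclidean_space"
  assumes A: "linear A" and P: "linear P" and PA: "\<And>u. P (A u) = u" and W: "subspace W"
  shows "subspace {x. P x \<in> W}" "dim {x. P x \<in> W} + DIM('m) = dim W + DIM('e)"
proof -
  show "subspace {x. P x \<in> W}"
    using linear_subspace_vimage[OF P W] by (simp add: vimage_def)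
  have injA: "inj A" by (rule inj_on_inverseI[of _ P]) (simp add: PA)
  define N where "N = {x. P x = 0}"
  have N: "subspace N" unfolding N_def by (rule linear_subspace_kernel[OF P])
  have split: "dim {x. P x \<in> V} = dim V + dim N" if V: "subspace V" for V
  proof -
    have "{x. P x \<in> V} = {x + y |x y. x \<in> A ` V \<and> y \<in> N}"
    proof (intro set_eqI iffI)
      fix x assume "x \<in> {x. P x \<in> V}"
      then show "x \<in> {x + y |x y. x \<in> A ` V \<and> y \<in> N}"
        by (intro CollectI exI[of _ "A (P x)"] exI[of _ "x - A (P x)"])
          (auto simp: N_def linear_diff[OF P] PA)
    qed (use linear_add[OF P] in \<open>auto simp: PA N_def\<close>)
    moreover have "A ` V \<inter> N = {0}"
      using subspace_0[OF V] linear_0[OF A] linear_0[OF P] by (auto simp: N_def PA image_iff)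
    moreover have "dim (A ` V) = dim V" by (rule dim_image_eq[OF A]) (use injA in \<open>auto intro: inj_on_subset\<close>)
    ultimately show ?thesis
      using dim_sums_Int[OF linear_subspace_image[OF A V] N] by simp
  qed
  show "dim {x. P x \<in> W} + DIM('m) = dim W + DIM('e)"
    using split[OF W] split[of UNIV] by simp
qed

section \<open>From coordinates to manifolds: coordinate changes, embedded patches and
  geodesics\<close>

section \<open>Isometric maps between charts\<close>

lemma isometric_map_cong:
  assumes I: "isometric_map D g U h \<theta>" and eq: "\<And>x. x \<in> D \<Longrightarrow> \<theta>' x = \<theta> x"
  shows "isometric_map D g U h \<theta>'"
proof -
  note D = isometric_mapD[OF I]
  have "fderiv \<theta>' x = fderiv \<theta> x" if "x \<in> D" for x by (rule fderiv_cong[OF D(6) that eq])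
  moreover have "smooth_on D \<theta>'" by (rule smooth_on_transform[OF D(3,6) eq])
  ultimately show ?thesis using D eq unfolding isometric_map_def by auto
qed

lemma isometric_map_compose:
  assumes I: "isometric_map D g U h \<theta>" and T: "isometric_map V h W k T"
  shows "isometric_map {x \<in> D. \<theta> x \<in> V} g W k (\<lambda>x. T (\<theta> x))"
proof -
  note D = isometric_mapD[OF I] and E = isometric_mapD[OF T]
  define D' where "D' = {x \<in> D. \<theta> x \<in> V}"
  have "D' = D \<inter> \<theta> -` V" by (auto simp: D'_def)
  then have D': "open D'"
    using continuous_open_preimage[OF smooth_on_continuous[OF D(3)] D(6) E(6)] by simp
  have sub: "D' \<subseteq> D" "\<theta> ` D' \<subseteq> V" by (auto simp: D'_def)
  have sm: "smooth_on D' \<theta>" by (rule smooth_on_subset[OF D(3) sub(1)])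
  have "smooth_on D' (\<lambda>x. T (\<theta> x))" by (rule smooth_on_compose[OF D' E(6) sub(2) sm E(3)])
  moreover have "g x u v = k (T (\<theta> x)) (fderiv (\<lambda>x. T (\<theta> x)) x u) (fderiv (\<lambda>x. T (\<theta> x)) x v)"
    if x: "x \<in> D'" for x u v
  proof -
    have "x \<in> D" "\<theta> x \<in> V" using x by (auto simp: D'_def)
    then show ?thesis by (simp add: D(5) E(5) fderiv_compose[OF D(3) E(3)])
  qed
  ultimately show ?thesis
    using riemannian_field_subset[OF D(1) D' sub(1)] E(2,4) sub(2)
    unfolding isometric_map_def D'_def[symmetric] by auto
qed

lemma isometric_map_surj:
  fixes T :: "'e::euclidean_space \<Rightarrow> 'e"
  assumes "isometric_map U h W k T" "x \<in> U"
  shows "surj (fderiv T x)"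
  by (rule linear_injective_imp_surjective[OF smooth_on_linear_fderiv[OF isometric_mapD(3)[OF assms(1)] assms(2)]
        isometric_map_inj[OF assms] refl])

text \<open>The second form is orthogonal to the range of the differential, which is the whole
  space. This is the transformation law of Christoffel maps, and it makes the geodesic equation
  independent of the chart.\<close>

lemma second_form_equidimensional:
  fixes T :: "'e::euclidean_space \<Rightarrow> 'e"
  assumes T: "isometric_map U h W k T" and x: "x \<in> U"
  shows "second_form h k T x u v = 0"
proof (rule riemannian_field_nondegenerate[OF isometric_mapD(2)[OF T] isometric_mapD(4)[OF T x]])
  fix z
  obtain w where "z = fderiv T x w" using isometric_map_surj[OF T x] by (metis surjD)
  then show "k (T x) (second_form h k T x u v) z = k (T x) 0 z"
    using second_form_normal[OF T x]
      bilinear_lzero[OF riemannian_fieldD(2)[OF isometric_mapD(2)[OF T] isometric_mapD(4)[OF T x]]]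
    by simp
qed

lemma chart_homeomorphism:
  assumes "riemannian_manifold R" "c \<in> charts R"
  shows "homeomorphism (cdom c) (cmap c ` cdom c) (cmap c) (cinv c)"
    "open (cmap c ` cdom c)" "openin (top_of_set (points R)) (cdom c)" "cdom c \<subseteq> points R"
  using assms unfolding riemannian_manifold_def smooth_manifold_def by auto

lemma chart_inverse:
  assumes "riemannian_manifold R" "c \<in> charts R"
  shows "z \<in> cdom c \<Longrightarrow> cinv c (cmap c z) = z" "x \<in> cmap c ` cdom c \<Longrightarrow> cmap c (cinv c x) = x"
    "x \<in> cmap c ` cdom c \<Longrightarrow> cinv c x \<in> cdom c"
  using chart_homeomorphism(1)[OF assms] unfolding homeomorphism_def by auto

lemma chart_riemannian_field:
  assumes "riemannian_manifold R" "c \<in> charts R"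
  shows "riemannian_field (cmap c ` cdom c) (metric R c)"
  using assms chart_homeomorphism(2)[OF assms] unfolding riemannian_manifold_def riemannian_field_def by auto

lemma rep_dom_subset: "rep_dom b c f \<subseteq> cmap b ` cdom b"
  by (auto simp: rep_dom_def)

lemma rep_dom_iff:
  assumes "riemannian_manifold N" "b \<in> charts N"
  shows "x \<in> rep_dom b c f \<longleftrightarrow> x \<in> cmap b ` cdom b \<and> f (cinv b x) \<in> cdom c"
proof
  assume "x \<in> rep_dom b c f"
  then obtain z where "z \<in> cdom b" "f z \<in> cdom c" "x = cmap b z" by (auto simp: rep_dom_def)
  then show "x \<in> cmap b ` cdom b \<and> f (cinv b x) \<in> cdom c" by (simp add: chart_inverse[OF assms])
next
  assume "x \<in> cmap b ` cdom b \<and> f (cinv b x) \<in> cdom c"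
  then have "cinv b x \<in> {z \<in> cdom b. f z \<in> cdom c}" "cmap b (cinv b x) = x"
    using chart_inverse[OF assms] by auto
  then show "x \<in> rep_dom b c f" unfolding rep_dom_def by (metis imageI)
qed

lemma open_rep_dom:
  assumes N: "riemannian_manifold N" "b \<in> charts N" and R: "riemannian_manifold R" "c \<in> charts R"
    and f: "continuous_on (points N) f" "f ` points N \<subseteq> points R"
  shows "open (rep_dom b c f)"
proof -
  have "openin (top_of_set (points N)) (points N \<inter> f -` cdom c)"
    by (rule continuous_openin_preimage[OF f(1) _ chart_homeomorphism(3)[OF R]]) (use f(2) in auto)
  then have "openin (top_of_set (points N)) (cdom b \<inter> (points N \<inter> f -` cdom c))"
    by (rule openin_Int[OF chart_homeomorphism(3)[OF N]])
  then have "openin (top_of_set (cdom b)) (cdom b \<inter> (points N \<inter> f -` cdom c))"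
    by (rule openin_subset_trans) (use chart_homeomorphism(4)[OF N] in auto)
  then have "openin (top_of_set (cmap b ` cdom b)) (cmap b ` (cdom b \<inter> (points N \<inter> f -` cdom c)))"
    by (rule homeomorphism_imp_open_map[OF chart_homeomorphism(1)[OF N]])
  then have "open (cmap b ` (cdom b \<inter> (points N \<inter> f -` cdom c)))"
    using chart_homeomorphism(2)[OF N] by (metis openin_open_trans)
  moreover have "cdom b \<inter> (points N \<inter> f -` cdom c) = {z \<in> cdom b. f z \<in> cdom c}"
    using chart_homeomorphism(4)[OF N] by auto
  ultimately show ?thesis by (simp add: rep_dom_def)
qed

lemma rep_in_image:
  assumes "x \<in> rep_dom b c f" "riemannian_manifold N" "b \<in> charts N"
  shows "rep b c f x \<in> cmap c ` cdom c"
  using assms(1) unfolding rep_dom_iff[OF assms(2,3)] by (simp add: rep_def)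

lemma transition_isometric:
  assumes R: "riemannian_manifold R" and c: "c \<in> charts R" and d: "d \<in> charts R"
  shows "isometric_map (rep_dom c d (\<lambda>z. z)) (metric R c) (cmap d ` cdom d) (metric R d) (rep c d (\<lambda>z. z))"
proof -
  have o: "open (rep_dom c d (\<lambda>z. z))"
    by (rule open_rep_dom[OF R c R d]) auto
  have "smooth_on (rep_dom c d (\<lambda>z. z)) (rep c d (\<lambda>z. z))"
    using R c d unfolding riemannian_manifold_def smooth_manifold_def by blast
  moreover have "metric R c x u v = metric R d (rep c d (\<lambda>z. z) x)
      (fderiv (rep c d (\<lambda>z. z)) x u) (fderiv (rep c d (\<lambda>z. z)) x v)" if "x \<in> rep_dom c d (\<lambda>z. z)" for x u v
    using R c d that unfolding riemannian_manifold_def Let_def by blast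
  ultimately show ?thesis
    unfolding isometric_map_def
    using riemannian_field_subset[OF chart_riemannian_field[OF R c] o rep_dom_subset]
      chart_riemannian_field[OF R d] rep_in_image[OF _ R c] by blast
qed

lemma immersion_isometric:
  assumes N: "riemannian_manifold N" "b \<in> charts N" and R: "riemannian_manifold R" "c \<in> charts R"
    and f: "isometric_immersion N R f"
  shows "isometric_map (rep_dom b c f) (metric N b) (cmap c ` cdom c) (metric R c) (rep b c f)"
proof -
  have o: "open (rep_dom b c f)"
    using f by (intro open_rep_dom[OF N R]) (auto simp: isometric_immersion_def smooth_immersion_def)
  have "smooth_on (rep_dom b c f) (rep b c f)"
    using f N R unfolding isometric_immersion_def smooth_immersion_def by blast
  moreover have "metric N b x u v = metric R c (rep b c f x)
      (fderiv (rep b c f) x u) (fderiv (rep b c f) x v)" if "x \<in> rep_dom b c f" for x u v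
    using f N R that unfolding isometric_immersion_def Let_def by blast
  ultimately show ?thesis
    unfolding isometric_map_def
    using riemannian_field_subset[OF chart_riemannian_field[OF N] o rep_dom_subset]
      chart_riemannian_field[OF R] rep_in_image[OF _ N] by blast
qed

lemma second_fundamental_form_eq:
  "second_fundamental_form N R f b c p = second_form (metric N b) (metric R c) (rep b c f) (cmap b p)"
  by (intro ext) (simp add: second_fundamental_form_def second_form_def cov_deriv_def Let_def)

section \<open>Submanifolds given by one parametrization\<close>

text \<open>A single chart makes compatibility of charts trivial, and the pulled back metric makes
  the inclusion isometric by construction.\<close>

definition param_submanifold :: "('p, 'e::euclidean_space) riem \<Rightarrow> ('p, 'e) chart \<Rightarrow> 'k::euclidean_space set \<Rightarrow>
    ('k \<Rightarrow> 'e) \<Rightarrow> ('e \<Rightarrow> 'k) \<Rightarrow> ('p, 'k) riem" where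
  "param_submanifold R c D \<theta> \<eta> = \<lparr>points = cinv c ` \<theta> ` D, charts = {(cinv c ` \<theta> ` D, \<eta> \<circ> cmap c)},
     metric = (\<lambda>_ x u v. metric R c (\<theta> x) (fderiv \<theta> x u) (fderiv \<theta> x v))\<rparr>"

text \<open>An embedded patch inside the chart \<open>c\<close>, used twice: for \<open>M\<close> in
  the ambient manifold and for \<open>S\<close> in \<Sigma>. The continuous inverse
  \<open>\<eta>\<close> on the image makes the chart \<open>\<kappa>\<close> a homeomorphism for the
  subspace topology.\<close>

locale parametrization =
  fixes R :: "('p::{t2_space,second_countable_topology}, 'e::euclidean_space) riem"
    and c :: "('p, 'e) chart" and D :: "'k::euclidean_space set" and \<theta> :: "'k \<Rightarrow> 'e" and \<eta> :: "'e \<Rightarrow> 'k"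
  assumes R: "riemannian_manifold R" and c: "c \<in> charts R"
    and D: "open D" and \<theta>: "smooth_on D \<theta>" "\<theta> ` D \<subseteq> cmap c ` cdom c"
    and hom: "homeomorphism D (\<theta> ` D) \<theta> \<eta>" and inj: "\<And>x. x \<in> D \<Longrightarrow> inj (fderiv \<theta> x)"
begin

abbreviation "M \<equiv> param_submanifold R c D \<theta> \<eta>"

definition "\<kappa> = (cinv c ` \<theta> ` D, \<eta> \<circ> cmap c)"

lemma points_M: "points M = cinv c ` \<theta> ` D" and charts_M: "charts M = {\<kappa>}"
  and metric_M: "metric M b x u v = metric R c (\<theta> x) (fderiv \<theta> x u) (fderiv \<theta> x v)"
  and cdom_\<kappa>: "cdom \<kappa> = cinv c ` \<theta> ` D" and cmap_\<kappa>: "cmap \<kappa> z = \<eta> (cmap c z)"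
  by (simp_all add: param_submanifold_def \<kappa>_def)

lemma \<theta>_in: "x \<in> D \<Longrightarrow> \<theta> x \<in> cmap c ` cdom c"
  using \<theta>(2) by blast

lemma \<eta>_\<theta>: "x \<in> D \<Longrightarrow> \<eta> (\<theta> x) = x"
  using hom by (simp add: homeomorphism_def)

lemma cmap_\<kappa>_cinv: "x \<in> D \<Longrightarrow> cmap \<kappa> (cinv c (\<theta> x)) = x"
  by (simp add: cmap_\<kappa> chart_inverse[OF R c] \<theta>_in \<eta>_\<theta>)

lemma image_\<kappa>: "cmap \<kappa> ` cdom \<kappa> = D"
  by (auto simp: cdom_\<kappa> image_image cmap_\<kappa>_cinv)

lemma cinv_\<kappa>: "x \<in> D \<Longrightarrow> cinv \<kappa> x = cinv c (\<theta> x)"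
  unfolding cinv_def[of \<kappa>]
  by (rule inv_into_f_eq) (auto simp: inj_on_def cdom_\<kappa> cmap_\<kappa>_cinv)

lemma points_subset: "points M \<subseteq> cdom c"
  using chart_inverse(3)[OF R c] \<theta>_in by (auto simp: points_M)

lemma homeomorphism_\<kappa>: "homeomorphism (cdom \<kappa>) (cmap \<kappa> ` cdom \<kappa>) (cmap \<kappa>) (cinv \<kappa>)"
  unfolding image_\<kappa>
proof (rule homeomorphismI)
  have "continuous_on (cdom \<kappa>) (cmap c)"
    using chart_homeomorphism(1)[OF R c] points_subset
    by (auto simp: homeomorphism_def points_M cdom_\<kappa> intro: continuous_on_subset)
  moreover have "cmap c ` cdom \<kappa> \<subseteq> \<theta> ` D"
    using \<theta>_in chart_inverse(2)[OF R c] by (auto simp: cdom_\<kappa>)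
  ultimately show "continuous_on (cdom \<kappa>) (cmap \<kappa>)"
    using continuous_on_compose2[OF homeomorphism_cont2[OF hom]] by (simp add: cmap_\<kappa>[abs_def])
  have "continuous_on D (\<lambda>x. cinv c (\<theta> x))"
    using continuous_on_compose2[OF homeomorphism_cont2[OF chart_homeomorphism(1)[OF R c]]
        homeomorphism_cont1[OF hom] \<theta>(2)] .
  then show "continuous_on D (cinv \<kappa>)" by (simp add: cinv_\<kappa> cong: continuous_on_cong)
qed (auto simp: cinv_\<kappa> cdom_\<kappa> cmap_\<kappa>_cinv)

lemma rep_\<kappa>: "x \<in> D \<Longrightarrow> rep \<kappa> d f x = rep c d f (\<theta> x)"
  by (simp add: rep_def cinv_\<kappa>)

lemma rep_dom_\<kappa>: "rep_dom \<kappa> d f = {x \<in> D. \<theta> x \<in> rep_dom c d f}"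
proof (intro set_eqI iffI)
  fix x assume "x \<in> rep_dom \<kappa> d f"
  then obtain y where "y \<in> D" "f (cinv c (\<theta> y)) \<in> cdom d" "x = cmap \<kappa> (cinv c (\<theta> y))"
    by (auto simp: rep_dom_def cdom_\<kappa>)
  then show "x \<in> {x \<in> D. \<theta> x \<in> rep_dom c d f}"
    unfolding rep_dom_iff[OF R c] by (simp add: cmap_\<kappa>_cinv \<theta>_in)
next
  fix x assume "x \<in> {x \<in> D. \<theta> x \<in> rep_dom c d f}"
  then have "x \<in> D" "f (cinv c (\<theta> x)) \<in> cdom d" unfolding rep_dom_iff[OF R c] by auto
  then have "cinv c (\<theta> x) \<in> {z \<in> cdom \<kappa>. f z \<in> cdom d}" "x = cmap \<kappa> (cinv c (\<theta> x))"
    by (auto simp: cdom_\<kappa> cmap_\<kappa>_cinv)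
  then show "x \<in> rep_dom \<kappa> d f" unfolding rep_dom_def by (rule rev_image_eqI)
qed

lemma riemannian_field_M: "riemannian_field D (metric M b)"
proof -
  note h = chart_riemannian_field[OF R c]
  have "smooth_on D (\<lambda>x. metric M b x u v)" for u v
    unfolding metric_M
    by (rule smooth_on_bilinear_field[where B = "metric R c", OF D riemannian_fieldD(1)[OF h] \<theta>(2,1)
          riemannian_fieldD(2)[OF h] riemannian_fieldD(5)[OF h] smooth_on_fderiv[OF \<theta>(1)] smooth_on_fderiv[OF \<theta>(1)]])
  moreover have "bilinear (metric M b x)" "metric M b x u v = metric M b x v u" "u \<noteq> 0 \<Longrightarrow> metric M b x u u > 0"
    if x: "x \<in> D" for x u v
  proof -
    note l = smooth_on_linear_fderiv[OF \<theta>(1) x] and bil = riemannian_fieldD(2)[OF h \<theta>_in[OF x]]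
    show "bilinear (metric M b x)"
      unfolding bilinear_def metric_M
      by (auto intro!: linearI simp: linear_add[OF l] linear_cmul[OF l] bilinear_ladd[OF bil] bilinear_lmul[OF bil]
          bilinear_radd[OF bil] bilinear_rmul[OF bil])
    show "metric M b x u v = metric M b x v u"
      unfolding metric_M by (rule riemannian_fieldD(3)[OF h \<theta>_in[OF x]])
    assume "u \<noteq> 0"
    then have "fderiv \<theta> x u \<noteq> 0" using inj[OF x] linear_injective_0[OF l] by blast
    then show "metric M b x u u > 0"
      unfolding metric_M by (rule riemannian_fieldD(4)[OF h \<theta>_in[OF x]])
  qed
  ultimately show ?thesis using D unfolding riemannian_field_def by blast
qed

lemma isometric_\<theta>: "isometric_map D (metric M b) (cmap c ` cdom c) (metric R c) \<theta>"
  unfolding isometric_map_def using riemannian_field_M chart_riemannian_field[OF R c] \<theta> by (auto simp: metric_M)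

lemma riemannian_manifold_M: "riemannian_manifold M"
proof -
  have rd: "rep_dom \<kappa> \<kappa> (\<lambda>z. z) = D" using image_\<kappa> by (simp add: rep_dom_def)
  have r: "rep \<kappa> \<kappa> (\<lambda>z. z) x = x" if "x \<in> D" for x using that by (simp add: rep_def cinv_\<kappa> cmap_\<kappa>_cinv)
  have "fderiv (rep \<kappa> \<kappa> (\<lambda>z. z)) x = (\<lambda>v. v)" if "x \<in> D" for x
    using fderiv_cong[OF D that r] by simp
  moreover have "smooth_on D (rep \<kappa> \<kappa> (\<lambda>z. z))"
    by (rule smooth_on_transform[OF smooth_on_id[OF D] D r])
  moreover have "points M = cdom \<kappa>" by (simp add: points_M cdom_\<kappa>)
  ultimately show ?thesis
    using riemannian_field_M homeomorphism_\<kappa> D r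
    unfolding riemannian_manifold_def smooth_manifold_def riemannian_field_def
    by (simp add: charts_M rd image_\<kappa> Let_def)
qed

text \<open>An arbitrary ambient chart \<open>d\<close> is reached from \<open>c\<close> by a
  coordinate change, which is isometric.\<close>

lemma isometric_rep_\<kappa>:
  assumes d: "d \<in> charts R"
  shows "isometric_map (rep_dom \<kappa> d (\<lambda>z. z)) (metric M b) (cmap d ` cdom d) (metric R d) (rep \<kappa> d (\<lambda>z. z))"
  unfolding rep_dom_\<kappa>
  by (rule isometric_map_cong[OF isometric_map_compose[OF isometric_\<theta> transition_isometric[OF R c d]]])
    (simp add: rep_\<kappa>)

lemma submanifold_M: "submanifold M R"
proof -
  have "points M \<subseteq> points R" using points_subset chart_homeomorphism(4)[OF R c] by blast
  then have "smooth_immersion M R (\<lambda>z. z)"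
    unfolding smooth_immersion_def
    using isometric_mapD(3)[OF isometric_rep_\<kappa>] isometric_map_inj[OF isometric_rep_\<kappa>]
    by (auto simp: charts_M)
  then have "isometric_immersion M R (\<lambda>z. z)"
    unfolding isometric_immersion_def
    using isometric_mapD(5)[OF isometric_rep_\<kappa>] by (auto simp: charts_M Let_def)
  then show ?thesis using riemannian_manifold_M by (simp add: submanifold_def)
qed

end

section \<open>Geodesics in charts\<close>

lemma smooth_on_locally_lipschitz:
  fixes G :: "'a::euclidean_space \<Rightarrow> 'b::real_normed_vector"
  assumes G: "smooth_on W G" "open W" and a0: "a0 \<in> W"
  shows "\<exists>r>0. \<exists>K>0. cball a0 r \<subseteq> W \<and> (\<forall>a\<in>cball a0 r. \<forall>b\<in>cball a0 r. norm (G a - G b) \<le> K * norm (a - b))"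
proof -
  define F where "F a = Blinfun (fderiv G a)" for a
  have F_apply: "blinfun_apply (F a) = fderiv G a" if "a \<in> W" for a
    unfolding F_def by (rule Blinfun_fderiv_apply[OF G(1) that])
  obtain r where r: "r > 0" "cball a0 r \<subseteq> W" using G(2) a0 open_contains_cball by blast
  have "continuous_on (cball a0 r) F"
    unfolding F_def using smooth_on_continuous[OF smooth_on_Blinfun_fderiv[OF G(2,1)]] r(2)
    by (rule continuous_on_subset)
  then have "bounded (F ` cball a0 r)"
    by (intro compact_imp_bounded compact_continuous_image compact_cball)
  then obtain K where K: "K > 0" "\<And>a. a \<in> cball a0 r \<Longrightarrow> norm (F a) \<le> K"
    unfolding bounded_pos by blast
  have "norm (G a - G b) \<le> K * norm (a - b)" if ab: "a \<in> cball a0 r" "b \<in> cball a0 r" for a b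
  proof (rule smooth_on_convex_lipschitz[OF G(1) convex_cball r(2) _ less_imp_le[OF K(1)] ab])
    fix x v assume x: "x \<in> cball a0 r"
    then have "x \<in> W" using r(2) by blast
    then show "norm (fderiv G x v) \<le> K * norm v"
      using norm_blinfun[of "F x" v] mult_right_mono[OF K(2)[OF x] norm_ge_zero[of v]] F_apply by simp
  qed
  then show ?thesis using r K(1) by blast
qed

lemma curve_increment_bound:
  fixes g :: "real \<Rightarrow> 'b::real_normed_vector"
  assumes "\<And>s. \<bar>s\<bar> \<le> e \<Longrightarrow> (g has_vector_derivative g' s) (at s)" "\<And>s. \<bar>s\<bar> \<le> e \<Longrightarrow> norm (g' s) \<le> B"
    and t: "\<bar>t\<bar> \<le> e"
  shows "norm (g t - g 0) \<le> B * \<bar>t\<bar>"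
proof -
  have "B \<ge> 0" using norm_ge_zero[of "g' t"] assms(2)[OF t] by linarith
  have "norm (g t - g 0) \<le> B * norm (t - 0)"
  proof (rule differentiable_bound[of "{- e..e}" g "\<lambda>s h. h *\<^sub>R g' s"])
    fix s assume "s \<in> {- e..e}"
    then have s: "\<bar>s\<bar> \<le> e" by auto
    show "(g has_derivative (\<lambda>h. h *\<^sub>R g' s)) (at s within {- e..e})"
      using has_derivative_at_withinI[OF assms(1)[OF s, unfolded has_vector_derivative_def]] .
    show "onorm (\<lambda>h. h *\<^sub>R g' s) \<le> B"
      using assms(2)[OF s] \<open>B \<ge> 0\<close>
      by (intro onorm_bound) (auto simp: mult.commute[of B] intro: mult_left_mono)
  qed (use t in auto)
  then show ?thesis by simp
qed

text \<open>Let \<open>m\<close> be the largest deviation of the velocity from its initial value on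
  [-e, e]. The position then deviates from the ray by at most \<open>m * \<bar>t\<bar>\<close>, and
  since \<open>\<Gamma>\<close> vanishes along the ray, a Lipschitz bound controls the acceleration
  by \<open>2 * K * m\<close>. Integrating it gives \<open>m \<le> m / 2\<close>.\<close>

lemma radial_solution_unique:
  fixes y :: "real \<Rightarrow> 'k::euclidean_space"
  assumes D: "open D" and \<Gamma>: "\<And>x. x \<in> D \<Longrightarrow> bilinear (\<Gamma> x)" "\<And>u v. smooth_on D (\<lambda>x. \<Gamma> x u v)"
    and J: "open J" "0 \<in> J" and y: "\<And>t. t \<in> J \<Longrightarrow> y t \<in> D" "y 0 = 0"
    and yp: "\<And>t. t \<in> J \<Longrightarrow> (y has_vector_derivative p t) (at t)"
    and pp: "\<And>t. t \<in> J \<Longrightarrow> (p has_vector_derivative - \<Gamma> (y t) (p t) (p t)) (at t)"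
    and radial: "\<And>t. t *\<^sub>R p 0 \<in> D \<Longrightarrow> \<Gamma> (t *\<^sub>R p 0) (p 0) (p 0) = 0"
  shows "\<exists>e>0. {- e<..<e} \<subseteq> J \<and> (\<forall>t\<in>{- e<..<e}. t *\<^sub>R p 0 \<in> D \<and> y t = t *\<^sub>R p 0)"
proof -
  define v where "v = p 0"
  define W where "W = D \<times> (UNIV :: 'k set)"
  have W: "open W" using D by (simp add: W_def open_Times)
  define G where "G a = \<Gamma> (fst a) (snd a) (snd a)" for a
  have G: "smooth_on W G"
    unfolding G_def[abs_def]
    by (rule smooth_on_bilinear_field[where B = \<Gamma>, OF W D _ smooth_on_linear[OF bounded_linear_fst W] \<Gamma>
        smooth_on_linear[OF bounded_linear_snd W] smooth_on_linear[OF bounded_linear_snd W]]) (auto simp: W_def)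
  have "0 \<in> D" using y J by metis
  then have "(0, v) \<in> W" by (simp add: W_def)
  from smooth_on_locally_lipschitz[OF G W this] obtain r K where r: "r > 0" "cball (0, v) r \<subseteq> W" and K: "K > 0"
    and lip: "\<And>a b. a \<in> cball (0, v) r \<Longrightarrow> b \<in> cball (0, v) r \<Longrightarrow> norm (G a - G b) \<le> K * norm (a - b)"
    by blast
  have "isCont (\<lambda>t. (y t, p t)) 0"
    by (intro isCont_Pair has_vector_derivative_continuous[OF yp[OF J(2)]] has_vector_derivative_continuous[OF pp[OF J(2)]])
  then have "\<forall>\<^sub>F t in nhds 0. dist (y t, p t) (y 0, p 0) < r"
    using r(1) by (simp add: isCont_def tendsto_iff eventually_nhds_conv_at)
  moreover have "\<forall>\<^sub>F t in nhds 0. t \<in> J" using J eventually_nhds by blast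
  moreover have "isCont (\<lambda>t. (t *\<^sub>R v, v)) 0" by (intro continuous_intros)
  then have "\<forall>\<^sub>F t in nhds 0. dist (t *\<^sub>R v, v) (0 *\<^sub>R v, v) < r"
    using r(1) by (simp add: isCont_def tendsto_iff eventually_nhds_conv_at)
  ultimately have "\<forall>\<^sub>F t in nhds 0. t \<in> J \<and> dist (y t, p t) (0, v) < r \<and> dist (t *\<^sub>R v, v) (0, v) < r"
    by eventually_elim (simp add: y(2) v_def)
  then obtain e0 where e0: "e0 > 0" "\<And>t. \<bar>t\<bar> < e0 \<Longrightarrow> t \<in> J \<and> dist (y t, p t) (0, v) < r \<and> dist (t *\<^sub>R v, v) (0, v) < r"
    unfolding eventually_nhds_metric by (auto simp: dist_real_def)
  \<comment> \<open>Half of \<open>e0\<close> keeps the closed interval inside,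
    \<open>e \<le> 1\<close> bounds \<open>m * \<bar>t\<bar>\<close> by \<open>m\<close>, and
    \<open>K * e \<le> 1 / 4\<close> gives the factor 1/2 at the end.\<close>
  define e where "e = min (e0 / 2) (min 1 (1 / (4 * K)))"
  have "e \<le> e0 / 2" "e \<le> 1" "e \<le> 1 / (4 * K)" "e > 0" using e0(1) K by (auto simp: e_def)
  moreover have "K * (1 / (4 * K)) = 1 / 4" using K by simp
  ultimately have e: "e > 0" "e < e0" "e \<le> 1" "K * e \<le> 1 / 4"
    using e0(1) K mult_left_mono[of e "1 / (4 * K)" K] by auto
  have in_J: "t \<in> J" and in_ball: "(y t, p t) \<in> cball (0, v) r" "(t *\<^sub>R v, v) \<in> cball (0, v) r" if "\<bar>t\<bar> \<le> e" for t
    using e0(2)[of t] e(2) that by (auto simp: dist_commute)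
  have "continuous_on {- e..e} (\<lambda>t. norm (p t - v))"
    by (intro continuous_intros continuous_at_imp_continuous_on ballI has_vector_derivative_continuous[OF pp] in_J) auto
  then have "\<exists>t0\<in>{- e..e}. \<forall>t\<in>{- e..e}. norm (p t - v) \<le> norm (p t0 - v)"
    using e(1) by (intro continuous_attains_sup) auto
  then obtain t0 where t0': "t0 \<in> {- e..e}" "\<forall>t\<in>{- e..e}. norm (p t - v) \<le> norm (p t0 - v)"
    by blast
  have t0: "\<bar>t0\<bar> \<le> e" using t0'(1) by auto
  have sup: "norm (p t - v) \<le> norm (p t0 - v)" if "\<bar>t\<bar> \<le> e" for t
    using that by (intro t0'(2)[rule_format]) auto
  define m where "m = norm (p t0 - v)"
  have yv: "norm (y t - t *\<^sub>R v) \<le> m * \<bar>t\<bar>" if "\<bar>t\<bar> \<le> e" for t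
  proof -
    have "((\<lambda>s. y s - s *\<^sub>R v) has_vector_derivative p s - v) (at s)" if "\<bar>s\<bar> \<le> e" for s
      by (auto intro!: derivative_eq_intros yp[OF in_J[OF that]])
    from curve_increment_bound[OF this sup that] show ?thesis by (simp add: y(2) m_def)
  qed
  have p': "norm (- \<Gamma> (y t) (p t) (p t)) \<le> 2 * K * m" if t: "\<bar>t\<bar> \<le> e" for t
  proof -
    have "t *\<^sub>R v \<in> D" using in_ball(2)[OF t] r(2) by (auto simp: W_def)
    then have "\<Gamma> (t *\<^sub>R v) v v = 0" using radial by (simp add: v_def)
    then have "norm (- \<Gamma> (y t) (p t) (p t)) = norm (G (y t, p t) - G (t *\<^sub>R v, v))" by (simp add: G_def)
    also have "\<dots> \<le> K * norm ((y t, p t) - (t *\<^sub>R v, v))" by (rule lip[OF in_ball[OF t]])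
    also have "\<dots> \<le> K * (norm (y t - t *\<^sub>R v) + norm (p t - v))"
      using K norm_Pair_le[of "y t - t *\<^sub>R v" "p t - v"] by (intro mult_left_mono) auto
    also have "\<dots> \<le> K * (m * 1 + m)"
    proof -
      have "m * \<bar>t\<bar> \<le> m * 1" using t e(3) by (intro mult_left_mono) (auto simp: m_def)
      then show ?thesis using K yv[OF t] sup[OF t] by (intro mult_left_mono) (auto simp: m_def)
    qed
    finally show ?thesis by simp
  qed
  have "m \<le> 2 * K * m * \<bar>t0\<bar>"
    using curve_increment_bound[OF pp[OF in_J] p' t0] by (simp add: m_def v_def)
  also have "\<dots> \<le> 2 * K * m * e" using t0 K by (intro mult_left_mono) (auto simp: m_def)
  also have "\<dots> = 2 * m * (K * e)" by simp
  also have "\<dots> \<le> 2 * m * (1 / 4)" using e(4) by (intro mult_left_mono) (auto simp: m_def)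
  finally have "m = 0" using norm_ge_zero[of "p t0 - v"] by (simp add: m_def)
  then have "y t = t *\<^sub>R v" if "\<bar>t\<bar> \<le> e" for t using yv[OF that] by simp
  moreover have "t *\<^sub>R v \<in> D" if "\<bar>t\<bar> \<le> e" for t using in_ball(2)[OF that] r(2) by (auto simp: W_def)
  moreover have "\<bar>t\<bar> \<le> e" if "t \<in> {- e<..<e}" for t using that by auto
  ultimately have "{- e<..<e} \<subseteq> J \<and> (\<forall>t\<in>{- e<..<e}. t *\<^sub>R p 0 \<in> D \<and> y t = t *\<^sub>R p 0)"
    using in_J unfolding v_def by blast
  then show ?thesis using e(1) by blast
qed

lemma fderiv_vector: "(f has_vector_derivative a) (at t) \<Longrightarrow> fderiv f t 1 = a"
  unfolding has_vector_derivative_def by (simp add: fderiv_eq)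

lemma smooth_on_vector_derivative:
  assumes "smooth_on S f" "t \<in> S" shows "(f has_vector_derivative fderiv f t 1) (at t)"
proof -
  note d = smooth_on_derivative[OF assms]
  have "fderiv f t h = h *\<^sub>R fderiv f t 1" for h
    using linear_cmul[OF has_derivative_linear[OF d], of h 1] by simp
  then have "(f has_derivative (\<lambda>h. h *\<^sub>R fderiv f t 1)) (at t)"
    by (intro has_derivative_eq_rhs[OF d] ext)
  then show ?thesis by (simp only: has_vector_derivative_def)
qed

text \<open>\<open>geodesic\<close> demands the equation in every chart. A coordinate change is
  isometric with vanishing second form, so it maps covariant accelerations to covariant
  accelerations, and checking one chart suffices.\<close>

lemma geodesic_of_chart_curve:
  fixes R :: "('p::{t2_space,second_countable_topology}, 'e::euclidean_space) riem"
  assumes R: "riemannian_manifold R" and c: "c \<in> charts R"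
    and S: "open S" "is_interval S" and \<sigma>: "smooth_on S \<sigma>" "\<sigma> ` S \<subseteq> cmap c ` cdom c"
    and \<gamma>: "\<And>t. t \<in> S \<Longrightarrow> \<gamma> t = cinv c (\<sigma> t)"
    and acc: "\<And>t. t \<in> S \<Longrightarrow> fderiv (\<lambda>r. fderiv \<sigma> r 1) t 1 +
      christoffel (metric R c) (\<sigma> t) (fderiv \<sigma> t 1) (fderiv \<sigma> t 1) = 0"
  shows "geodesic R S \<gamma>"
proof -
  have "continuous_on S (\<lambda>t. cinv c (\<sigma> t))"
    by (rule continuous_on_compose2[OF homeomorphism_cont2[OF chart_homeomorphism(1)[OF R c]]
          smooth_on_continuous[OF \<sigma>(1)] \<sigma>(2)])
  then have cont: "continuous_on S \<gamma>" using \<gamma> by (simp cong: continuous_on_cong)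
  have img: "\<gamma> ` S \<subseteq> points R"
    using \<gamma> \<sigma>(2) chart_inverse(3)[OF R c] chart_homeomorphism(4)[OF R c] by fastforce
  have "smooth_on {t \<in> S. \<gamma> t \<in> cdom d} (cmap d \<circ> \<gamma>) \<and>
        (\<forall>t\<in>S. \<gamma> t \<in> cdom d \<longrightarrow> cov_deriv (metric R d) (cmap d \<circ> \<gamma>)
          (\<lambda>r. frechet_derivative (cmap d \<circ> \<gamma>) (at r) 1) t 1 = 0)" if d: "d \<in> charts R" for d
  proof -
    define T where "T = rep c d (\<lambda>z. z)"
    define U where "U = rep_dom c d (\<lambda>z. z)"
    define Sd where "Sd = {t \<in> S. \<gamma> t \<in> cdom d}"
    define y where "y = cmap d \<circ> \<gamma>"
    define p where "p r = fderiv \<sigma> r 1" for r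
    have I: "isometric_map U (metric R c) (cmap d ` cdom d) (metric R d) T"
      unfolding U_def T_def by (rule transition_isometric[OF R c d])
    note T = isometric_mapD[OF I]
    have "\<gamma> t \<in> cdom d \<longleftrightarrow> \<sigma> t \<in> U" if "t \<in> S" for t
      using rep_dom_iff[OF R c, of "\<sigma> t" d "\<lambda>z. z"] \<gamma>[OF that] \<sigma>(2) that by (auto simp: U_def)
    then have Sd_eq: "Sd = S \<inter> \<sigma> -` U" unfolding Sd_def by blast
    then have Sd: "open Sd"
      using continuous_open_preimage[OF smooth_on_continuous[OF \<sigma>(1)] S(1) T(6)] by simp
    have SdS: "Sd \<subseteq> S" and \<sigma>U: "\<sigma> ` Sd \<subseteq> U" using Sd_eq by auto
    have y_eq: "y t = T (\<sigma> t)" if "t \<in> Sd" for t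
      using that \<gamma> SdS by (auto simp: y_def T_def rep_def)
    have "smooth_on Sd (\<lambda>t. T (\<sigma> t))"
      by (rule smooth_on_compose[OF Sd T(6) \<sigma>U smooth_on_subset[OF \<sigma>(1) SdS] T(3)])
    then have "smooth_on Sd y" by (rule smooth_on_transform[OF _ Sd y_eq])
    moreover have "cov_deriv (metric R d) y (\<lambda>r. fderiv y r 1) t 1 = 0" if t: "t \<in> Sd" for t
    proof -
      have \<sigma>p: "(\<sigma> has_vector_derivative p r) (at r)" if "r \<in> Sd" for r
        unfolding p_def using smooth_on_vector_derivative[OF \<sigma>(1)] that SdS by blast
      have pz: "(p has_vector_derivative fderiv p t 1) (at t)"
        unfolding p_def[abs_def] using smooth_on_vector_derivative[OF smooth_on_fderiv[OF \<sigma>(1)]] t SdS by blast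
      have y': "fderiv y r 1 = fderiv T (\<sigma> r) (p r)" if r: "r \<in> Sd" for r
      proof -
        have "\<sigma> r \<in> U" using \<sigma>U r by blast
        then have "fderiv (\<lambda>t. T (\<sigma> t)) r 1 = fderiv T (\<sigma> r) (p r)"
          by (rule fderiv_vector[OF curve_image_velocity[OF T(3) _ \<sigma>p[OF r]]])
        then show ?thesis using fderiv_cong[OF Sd r y_eq] by simp
      qed
      have "fderiv (\<lambda>r. fderiv y r 1) t 1 = fderiv (\<lambda>r. fderiv T (\<sigma> r) (p r)) t 1"
        using fderiv_cong[OF Sd t y'] by simp
      also have "\<dots> = fderiv (\<lambda>a. fderiv T a (p t)) (\<sigma> t) (p t) + fderiv T (\<sigma> t) (fderiv p t 1)"
        by (rule fderiv_vector[OF curve_image_acceleration[OF T(3,6) Sd t \<sigma>U \<sigma>p[OF t] pz]])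
      finally have "cov_deriv (metric R d) y (\<lambda>r. fderiv y r 1) t 1 =
          fderiv (\<lambda>a. fderiv T a (p t)) (\<sigma> t) (p t) + fderiv T (\<sigma> t) (fderiv p t 1) +
          christoffel (metric R d) (T (\<sigma> t)) (fderiv T (\<sigma> t) (p t)) (fderiv T (\<sigma> t) (p t))"
        by (simp add: cov_deriv_def y'[OF t] y_eq[OF t])
      also have "\<dots> = fderiv T (\<sigma> t) (fderiv p t 1 + christoffel (metric R c) (\<sigma> t) (p t) (p t))"
      proof -
        have "\<sigma> t \<in> U" using \<sigma>U t by blast
        then show ?thesis by (simp add: isometric_curve_acceleration[OF I] second_form_equidimensional[OF I])
      qed
      also have "\<dots> = 0"
      proof -
        have "fderiv p t 1 + christoffel (metric R c) (\<sigma> t) (p t) (p t) = 0"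
          unfolding p_def[abs_def] using acc[of t] t SdS by blast
        moreover have "\<sigma> t \<in> U" using \<sigma>U t by blast
        ultimately show ?thesis using linear_0[OF smooth_on_linear_fderiv[OF T(3)]] by simp
      qed
      finally show ?thesis .
    qed
    ultimately show ?thesis unfolding Sd_def y_def by auto
  qed
  then show ?thesis unfolding geodesic_def Let_def using S cont img by blast
qed

context parametrization
begin

text \<open>The zero ambient acceleration is the sum of a tangential vector, the image of the
  intrinsic acceleration, and the normal second form; as these are orthogonal, both vanish.\<close>

lemma radial_christoffel:
  assumes radial: "fderiv (\<lambda>a. fderiv \<theta> a v) x v + christoffel (metric R c) (\<theta> x) (fderiv \<theta> x v) (fderiv \<theta> x v) = 0"
    and x: "x \<in> D"
  shows "christoffel (metric M b) x v v = 0" "second_form (metric M b) (metric R c) \<theta> x v v = 0"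
proof -
  let ?h = "metric R c (\<theta> x)"
  note h = chart_riemannian_field[OF R c] and l = smooth_on_linear_fderiv[OF \<theta>(1) x]
  note bil = riemannian_fieldD(2)[OF h \<theta>_in[OF x]]
  have eq: "fderiv \<theta> x (christoffel (metric M b) x v v) + second_form (metric M b) (metric R c) \<theta> x v v = 0"
    using radial by (simp add: second_form_def)
  have "metric M b x (christoffel (metric M b) x v v) w = metric M b x 0 w" for w
  proof -
    have "0 = ?h (fderiv \<theta> x (christoffel (metric M b) x v v) + second_form (metric M b) (metric R c) \<theta> x v v) (fderiv \<theta> x w)"
      unfolding eq by (simp add: bilinear_lzero[OF bil])
    also have "\<dots> = metric M b x (christoffel (metric M b) x v v) w"
      using second_form_normal[OF isometric_\<theta> x] by (simp add: bilinear_ladd[OF bil] metric_M)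
    finally show ?thesis by (simp add: metric_M linear_0[OF l] bilinear_lzero[OF bil])
  qed
  then show *: "christoffel (metric M b) x v v = 0"
    by (rule riemannian_field_nondegenerate[OF riemannian_field_M x])
  show "second_form (metric M b) (metric R c) \<theta> x v v = 0" using eq by (simp add: * linear_0[OF l])
qed

text \<open>In the chart \<open>\<kappa>\<close>, where the base point has coordinates 0, rays solve
  the geodesic equation of \<open>M\<close>. By uniqueness every geodesic of \<open>M\<close>
  through the base point is a ray for short times, and images of rays are ambient geodesics.\<close>

lemma totally_geodesic:
  assumes zero: "0 \<in> D"
    and radial: "\<And>t v. t *\<^sub>R v \<in> D \<Longrightarrow> fderiv (\<lambda>a. fderiv \<theta> a v) (t *\<^sub>R v) v +
      christoffel (metric R c) (\<theta> (t *\<^sub>R v)) (fderiv \<theta> (t *\<^sub>R v) v) (fderiv \<theta> (t *\<^sub>R v) v) = 0"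
  shows "totally_geodesic_at M R (cinv c (\<theta> 0))"
  unfolding totally_geodesic_at_def
proof (intro allI impI, elim conjE)
  fix J \<gamma> assume geo: "geodesic M J \<gamma>" and J0: "0 \<in> J" and \<gamma>0: "\<gamma> 0 = cinv c (\<theta> 0)"
  define y where "y = cmap \<kappa> \<circ> \<gamma>"
  define p where "p r = fderiv y r 1" for r
  have J: "open J" and \<gamma>M: "\<gamma> ` J \<subseteq> points M" using geo by (auto simp: geodesic_def)
  have in\<kappa>: "\<gamma> t \<in> cdom \<kappa>" if "t \<in> J" for t using \<gamma>M that by (auto simp: points_M cdom_\<kappa>)
  then have "{t \<in> J. \<gamma> t \<in> cdom \<kappa>} = J" by auto
  then have sm: "smooth_on J y" and cov: "\<And>t. t \<in> J \<Longrightarrow> cov_deriv (metric M \<kappa>) y p t 1 = 0"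
    using geo in\<kappa> unfolding geodesic_def Let_def y_def p_def[abs_def] by (auto simp: charts_M)
  have yD: "y t \<in> D" if "t \<in> J" for t using in\<kappa>[OF that] image_\<kappa> by (auto simp: y_def)
  have y0: "y 0 = 0" using zero by (simp add: y_def \<gamma>0 cmap_\<kappa>_cinv)
  have yp: "(y has_vector_derivative p t) (at t)" if "t \<in> J" for t
    unfolding p_def by (rule smooth_on_vector_derivative[OF sm that])
  have pp: "(p has_vector_derivative - christoffel (metric M \<kappa>) (y t) (p t) (p t)) (at t)" if t: "t \<in> J" for t
  proof -
    have "fderiv p t 1 + christoffel (metric M \<kappa>) (y t) (p t) (p t) = 0"
      using cov[OF t] by (simp add: cov_deriv_def flip: p_def)
    then have "fderiv p t 1 = - christoffel (metric M \<kappa>) (y t) (p t) (p t)" by (simp add: eq_neg_iff_add_eq_0)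
    moreover have "(p has_vector_derivative fderiv p t 1) (at t)"
      unfolding p_def[abs_def] by (rule smooth_on_vector_derivative[OF smooth_on_fderiv[OF sm] t])
    ultimately show ?thesis by simp
  qed
  define v where "v = p 0"
  have "\<exists>e>0. {- e<..<e} \<subseteq> J \<and> (\<forall>t\<in>{- e<..<e}. t *\<^sub>R p 0 \<in> D \<and> y t = t *\<^sub>R p 0)"
    by (rule radial_solution_unique[where \<Gamma> = "christoffel (metric M \<kappa>)", OF D christoffelD(1)[OF riemannian_field_M]
        smooth_on_christoffel[OF riemannian_field_M] J J0 yD y0 yp pp radial_christoffel(1)[OF radial]])
  then obtain e where e: "e > 0" "{- e<..<e} \<subseteq> J"
    and ev: "\<And>t. t \<in> {- e<..<e} \<Longrightarrow> t *\<^sub>R v \<in> D" "\<And>t. t \<in> {- e<..<e} \<Longrightarrow> y t = t *\<^sub>R v"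
    unfolding v_def by blast
  let ?S = "{- e<..<e}"
  have S: "open ?S" "is_interval ?S" by (auto simp: is_interval_oo)
  have line: "((\<lambda>t. t *\<^sub>R v) has_vector_derivative v) (at t)" for t
    by (auto intro!: derivative_eq_intros)
  have lineD: "(\<lambda>t. t *\<^sub>R v) ` ?S \<subseteq> D" using ev(1) by blast
  have "geodesic R ?S \<gamma>"
  proof (rule geodesic_of_chart_curve[OF R c S])
    show "smooth_on ?S (\<lambda>t. \<theta> (t *\<^sub>R v))"
      by (rule smooth_on_compose[OF S(1) D lineD smooth_on_linear[OF bounded_linear_scaleR_left S(1)] \<theta>(1)])
    show "(\<lambda>t. \<theta> (t *\<^sub>R v)) ` ?S \<subseteq> cmap c ` cdom c" using ev(1) \<theta>_in by blast
    fix t assume t: "t \<in> ?S"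
    have "\<gamma> t = cinv \<kappa> (y t)"
      using in\<kappa>[of t] e(2) t homeomorphism_apply1[OF homeomorphism_\<kappa>] by (auto simp: y_def)
    then show "\<gamma> t = cinv c (\<theta> (t *\<^sub>R v))" using ev t by (simp add: cinv_\<kappa>)
    have d1: "fderiv (\<lambda>t. \<theta> (t *\<^sub>R v)) r 1 = fderiv \<theta> (r *\<^sub>R v) v" if "r \<in> ?S" for r
      by (rule fderiv_vector[OF curve_image_velocity[OF \<theta>(1) ev(1)[OF that] line]])
    have "fderiv (\<lambda>r. fderiv (\<lambda>t. \<theta> (t *\<^sub>R v)) r 1) t 1 = fderiv (\<lambda>r. fderiv \<theta> (r *\<^sub>R v) v) t 1"
      using fderiv_cong[OF S(1) t d1] by simp
    also have "\<dots> = fderiv (\<lambda>a. fderiv \<theta> a v) (t *\<^sub>R v) v + fderiv \<theta> (t *\<^sub>R v) 0"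
      by (rule fderiv_vector[OF curve_image_acceleration[OF \<theta>(1) D S(1) t lineD line has_vector_derivative_const]])
    finally show "fderiv (\<lambda>r. fderiv (\<lambda>t. \<theta> (t *\<^sub>R v)) r 1) t 1 + christoffel (metric R c) (\<theta> (t *\<^sub>R v))
        (fderiv (\<lambda>t. \<theta> (t *\<^sub>R v)) t 1) (fderiv (\<lambda>t. \<theta> (t *\<^sub>R v)) t 1) = 0"
      using radial[OF ev(1)[OF t]] by (simp add: d1[OF t] linear_0[OF smooth_on_linear_fderiv[OF \<theta>(1) ev(1)[OF t]]])
  qed
  then show "\<exists>\<epsilon>>0. {- \<epsilon><..<\<epsilon>} \<subseteq> J \<and> geodesic R {- \<epsilon><..<\<epsilon>} \<gamma>" using e by blast
qed

end

section \<open>The intersection of \<Sigma> with a totally geodesic submanifold, and its mean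
  curvature\<close>

section \<open>Second fundamental forms of compositions\<close>

lemma fderiv2_compose:
  fixes \<theta> :: "'k::euclidean_space \<Rightarrow> 'e::real_normed_vector" and j :: "'l::euclidean_space \<Rightarrow> 'k"
  assumes \<theta>: "smooth_on D \<theta>" "open D" and j: "smooth_on V j" "open V" "j ` V \<subseteq> D" and x: "x \<in> V"
  shows "fderiv (\<lambda>a. fderiv (\<lambda>r. \<theta> (j r)) a u) x w =
    fderiv (\<lambda>a. fderiv \<theta> a (fderiv j x u)) (j x) (fderiv j x w) + fderiv \<theta> (j x) (fderiv (\<lambda>a. fderiv j a u) x w)"
proof -
  have "fderiv (\<lambda>r. \<theta> (j r)) a u = fderiv \<theta> (j a) (fderiv j a u)" if "a \<in> V" for a
    by (rule fderiv_compose[OF j(1) \<theta>(1) that]) (use j(3) that in blast)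
  then have "fderiv (\<lambda>a. fderiv (\<lambda>r. \<theta> (j r)) a u) x = fderiv (\<lambda>a. fderiv \<theta> (j a) (fderiv j a u)) x"
    by (rule fderiv_cong[OF j(2) x])
  also have "\<dots> = (\<lambda>z. fderiv (\<lambda>q. fderiv \<theta> q (fderiv j x u)) (j x) (fderiv j x z) +
      fderiv \<theta> (j x) (fderiv (\<lambda>a. fderiv j a u) x z))"
    by (rule fderiv_eq[OF has_derivative_fderiv_apply[OF \<theta> j(2) x j(3) smooth_on_derivative[OF j(1) x]
          smooth_on_derivative[OF smooth_on_fderiv[OF j(1)] x]]])
  finally show ?thesis by simp
qed

text \<open>Up to a vector tangent to the image of \<open>\<theta>\<close>, the second form of a
  composition is that of \<open>\<theta>\<close>. The formula is used for \<open>S\<close> inside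
  \<Sigma> and for \<open>S\<close> inside \<open>M\<close>.\<close>

lemma second_form_compose:
  fixes j :: "'l::euclidean_space \<Rightarrow> 'k::euclidean_space"
  assumes I: "isometric_map D g U h \<theta>" and j: "smooth_on V j" "open V" "j ` V \<subseteq> D" and x: "x \<in> V"
  shows "second_form g' h (\<lambda>r. \<theta> (j r)) x u u = second_form g h \<theta> (j x) (fderiv j x u) (fderiv j x u) +
    fderiv \<theta> (j x) (fderiv (\<lambda>a. fderiv j a u) x u + christoffel g (j x) (fderiv j x u) (fderiv j x u) -
      fderiv j x (christoffel g' x u u))"
proof -
  note T = isometric_mapD[OF I]
  have jx: "j x \<in> D" using j(3) x by blast
  note l = smooth_on_linear_fderiv[OF T(3) jx]
  have d: "fderiv (\<lambda>r. \<theta> (j r)) x v = fderiv \<theta> (j x) (fderiv j x v)" for v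
    by (rule fderiv_compose[OF j(1) T(3) x jx])
  show ?thesis
    unfolding second_form_def fderiv2_compose[OF T(3,6) j x] d
    by (simp add: linear_add[OF l] linear_diff[OF l])
qed

lemma second_form_cong:
  assumes V: "open V" "x \<in> V" and eq: "\<And>a. a \<in> V \<Longrightarrow> y a = y' a"
  shows "second_form g h y x = second_form g h y' x"
proof -
  have d: "fderiv y a = fderiv y' a" if "a \<in> V" for a by (rule fderiv_cong[OF V(1) that eq])
  then have "fderiv (\<lambda>a. fderiv y a v) x = fderiv (\<lambda>a. fderiv y' a v) x" for v
    by (intro fderiv_cong[OF V]) simp
  then show ?thesis by (intro ext) (simp add: second_form_def d[OF V(2)] eq[OF V(2)])
qed

lemma bilinear_second_form:
  assumes I: "isometric_map D g U h \<theta>" and x: "x \<in> D"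
  shows "bilinear (second_form g h \<theta> x)"
proof -
  note T = isometric_mapD[OF I]
  note l = smooth_on_linear_fderiv[OF T(3) x]
  note bg = christoffelD(1)[OF T(1) x] and bh = christoffelD(1)[OF T(2) T(4)[OF x]]
  have lin: "linear (\<lambda>u. second_form g h \<theta> x u v)" for v
  proof -
    have l2: "linear (fderiv (\<lambda>a. fderiv \<theta> a v) x)"
      by (rule smooth_on_linear_fderiv[OF smooth_on_fderiv[OF T(3)] x])
    show ?thesis
      by (rule linearI) (simp_all add: second_form_def linear_add[OF l] linear_cmul[OF l] linear_add[OF l2]
          linear_cmul[OF l2] bilinear_ladd[OF bg] bilinear_lmul[OF bg] bilinear_ladd[OF bh] bilinear_lmul[OF bh]
          algebra_simps)
  qed
  moreover have "linear (second_form g h \<theta> x u)" for u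
  proof -
    have eq: "second_form g h \<theta> x u = (\<lambda>v. second_form g h \<theta> x v u)"
      by (rule ext) (rule second_form_symmetric[OF I x])
    show ?thesis by (subst eq) (rule lin)
  qed
  ultimately show ?thesis unfolding bilinear_def by blast
qed

section \<open>Totally geodesic sections of a submanifold\<close>

text \<open>In the chart \<open>c\<close>, \<open>M\<close> is the image under the exponential map \<open>F\<close> of the linear space
  \<open>{y. P y \<in> W}\<close>, which is the sum of the image of \<open>W\<close> and of the normal space. In these terms \<open>S\<close> is
  the preimage of \<open>W\<close> under the local diffeomorphism \<open>\<psi> = P \<circ> F\<inverse> \<circ> f\<close>.\<close>

locale geodesic_section =
  fixes R :: "('p::{t2_space,second_countable_topology}, 'e::euclidean_space) riem"
    and N :: "('b::{t2_space,second_countable_topology}, 'm::euclidean_space) riem"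
    and f :: "'b \<Rightarrow> 'p" and q :: 'b and b :: "('b, 'm) chart" and c :: "('p, 'e) chart"
    and W :: "'m set" and P :: "'e \<Rightarrow> 'm"
    and L :: "'k::euclidean_space \<Rightarrow> 'e" and L' :: "'e \<Rightarrow> 'k"
    and l :: "'l::euclidean_space \<Rightarrow> 'm" and l' :: "'m \<Rightarrow> 'l"
    and F F' :: "'e \<Rightarrow> 'e" and \<delta> :: real
  assumes R: "riemannian_manifold R" and N: "riemannian_manifold N" and f: "isometric_immersion N R f"
    and b: "b \<in> charts N" "q \<in> cdom b" and c: "c \<in> charts R" "f q \<in> cdom c"
    and P: "linear P" "\<And>u. P (fderiv (rep b c f) (cmap b q) u) = u"
      "\<And>w. P w = 0 \<longleftrightarrow> (\<forall>u. metric R c (cmap c (f q)) (fderiv (rep b c f) (cmap b q) u) w = 0)"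
    and L: "linear L" "linear L'" "\<And>x. L' (L x) = x" "\<And>y. y \<in> range L \<longleftrightarrow> P y \<in> W"
    and l: "linear l" "linear l'" "\<And>x. l' (l x) = x" "range l = W"
    and l_isometric: "\<And>u v. metric N b (cmap b q) (l u) (l v) = u \<bullet> v"
    and \<delta>: "\<delta> > 0" and F: "smooth_on (ball 0 \<delta>) F" "F ` ball 0 \<delta> \<subseteq> cmap c ` cdom c" "F 0 = cmap c (f q)"
      "\<And>w. fderiv F 0 w = w"
      "\<And>t v. t *\<^sub>R v \<in> ball 0 \<delta> \<Longrightarrow> fderiv (\<lambda>a. fderiv F a v) (t *\<^sub>R v) v +
         christoffel (metric R c) (F (t *\<^sub>R v)) (fderiv F (t *\<^sub>R v) v) (fderiv F (t *\<^sub>R v) v) = 0"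
      "open (F ` ball 0 \<delta>)" "homeomorphism (ball 0 \<delta>) (F ` ball 0 \<delta>) F F'" "smooth_on (F ` ball 0 \<delta>) F'"
      "\<And>x. x \<in> ball 0 \<delta> \<Longrightarrow> bij (fderiv F x)"
begin

abbreviation "xq \<equiv> cmap b q"
abbreviation "fh \<equiv> rep b c f"
abbreviation "A \<equiv> fderiv fh xq"
abbreviation "h \<equiv> metric R c (cmap c (f q))"

lemma isometric_fh: "isometric_map (rep_dom b c f) (metric N b) (cmap c ` cdom c) (metric R c) fh"
  by (rule immersion_isometric[OF N b(1) R c(1) f])

lemma base_point: "xq \<in> rep_dom b c f" "cinv b xq = q" "fh xq = cmap c (f q)"
proof -
  show q: "cinv b xq = q" by (rule chart_inverse(1)[OF N b])
  then show "fh xq = cmap c (f q)" by (simp add: rep_def)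
  show "xq \<in> rep_dom b c f" unfolding rep_dom_iff[OF N b(1)] q using b(2) c(2) by simp
qed

lemma ambient_metric: "bilinear h" "h u v = h v u" "u \<noteq> 0 \<Longrightarrow> h u u > 0"
proof -
  have "cmap c (f q) \<in> cmap c ` cdom c" using c(2) by blast
  note * = riemannian_fieldD[OF chart_riemannian_field[OF R c(1)]]
  show "bilinear h" "h u v = h v u" "u \<noteq> 0 \<Longrightarrow> h u u > 0"
    using *(2-4)[OF \<open>cmap c (f q) \<in> cmap c ` cdom c\<close>] by blast+
qed

lemma F'_F: "x \<in> ball 0 \<delta> \<Longrightarrow> F' (F x) = x" and F_F': "y \<in> F ` ball 0 \<delta> \<Longrightarrow> F (F' y) = y"
  and F'_ball: "y \<in> F ` ball 0 \<delta> \<Longrightarrow> F' y \<in> ball 0 \<delta>"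
  using F(7) by (auto simp: homeomorphism_def)

lemma zero_ball: "0 \<in> ball (0::'e) \<delta>"
  using \<delta> by simp

lemma fderiv_F'0: "fderiv F' (cmap c (f q)) w = w"
proof -
  have "fderiv (\<lambda>x. F' (F x)) 0 w = fderiv F' (F 0) (fderiv F 0 w)"
    by (rule fderiv_compose[OF F(1,8) zero_ball]) (use zero_ball in blast)
  moreover have "fderiv (\<lambda>x. F' (F x)) 0 = fderiv (\<lambda>x. x) 0"
    by (rule fderiv_cong[OF open_ball zero_ball F'_F])
  ultimately show ?thesis by (simp add: F(3,4))
qed

definition "DM = L -` ball 0 \<delta>"

lemma DM: "open DM" "0 \<in> DM" "L ` DM \<subseteq> ball 0 \<delta>"
  using \<delta> linear_0[OF L(1)] linear_continuous_on[OF linear_conv_bounded_linear[THEN iffD1, OF L(1)]]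
  by (auto simp: DM_def intro!: open_vimage)

lemma smooth_L: "smooth_on DM L"
  by (rule smooth_on_linear[OF linear_conv_bounded_linear[THEN iffD1, OF L(1)] DM(1)])

lemma fderiv_L: "fderiv L x = L"
  by (rule fderiv_eq[OF bounded_linear_imp_has_derivative[OF linear_conv_bounded_linear[THEN iffD1, OF L(1)]]])

lemma fderiv_FL: "x \<in> DM \<Longrightarrow> fderiv (\<lambda>x. F (L x)) x v = fderiv F (L x) (L v)"
  using fderiv_compose[OF smooth_L F(1), of x v] DM(3) by (auto simp: fderiv_L)

sublocale M: parametrization R c DM "\<lambda>x. F (L x)" "\<lambda>y. L' (F' y)"
proof
  show "smooth_on DM (\<lambda>x. F (L x))"
    by (rule smooth_on_compose[OF DM(1) open_ball DM(3) smooth_L F(1)])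
  show "(\<lambda>x. F (L x)) ` DM \<subseteq> cmap c ` cdom c" using F(2) DM(3) by blast
  show "homeomorphism DM ((\<lambda>x. F (L x)) ` DM) (\<lambda>x. F (L x)) (\<lambda>y. L' (F' y))"
  proof (rule homeomorphismI)
    show "continuous_on DM (\<lambda>x. F (L x))"
      by (rule continuous_on_compose2[OF smooth_on_continuous[OF F(1)] smooth_on_continuous[OF smooth_L] DM(3)])
    have "(\<lambda>x. F (L x)) ` DM \<subseteq> F ` ball 0 \<delta>" using DM(3) by blast
    then show "continuous_on ((\<lambda>x. F (L x)) ` DM) (\<lambda>y. L' (F' y))"
      by (intro linear_continuous_on_compose[OF _ L(2)] continuous_on_subset[OF smooth_on_continuous[OF F(8)]])
  qed (use DM(3) in \<open>auto simp: F'_F L(3) image_subset_iff\<close>)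
  fix x assume x: "x \<in> DM"
  then have "inj (fderiv F (L x))" using F(9) DM(3) by (auto simp: bij_def)
  moreover have "inj L" by (rule inj_on_inverseI[of _ L']) (rule L(3))
  ultimately show "inj (fderiv (\<lambda>x. F (L x)) x)"
    by (simp add: inj_on_def fderiv_FL[OF x])
qed (use R c DM in auto)

abbreviation "Mf \<equiv> param_submanifold R c DM (\<lambda>x. F (L x)) (\<lambda>y. L' (F' y))"

lemma M_radial:
  assumes "t *\<^sub>R v \<in> DM"
  shows "fderiv (\<lambda>a. fderiv (\<lambda>x. F (L x)) a v) (t *\<^sub>R v) v + christoffel (metric R c) (F (L (t *\<^sub>R v)))
    (fderiv (\<lambda>x. F (L x)) (t *\<^sub>R v) v) (fderiv (\<lambda>x. F (L x)) (t *\<^sub>R v) v) = 0"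
proof -
  have tv: "L (t *\<^sub>R v) = t *\<^sub>R L v" by (rule linear_cmul[OF L(1)])
  have "t *\<^sub>R L v \<in> ball 0 \<delta>" using assms DM(3) tv by auto
  from F(5)[OF this] fderiv2_compose[OF F(1) open_ball smooth_L DM(1,3) assms, of v v]
    linear_0[OF smooth_on_linear_fderiv[OF F(1) this]] show ?thesis
    by (simp add: fderiv_L fderiv_FL[OF assms] tv)
qed

lemma base_M: "cinv c (F (L 0)) = f q"
  by (simp add: linear_0[OF L(1)] F(3) chart_inverse(1)[OF R c])

lemma fq_in_M: "f q \<in> points Mf"
  using DM(2) base_M by (auto simp: M.points_M intro!: rev_image_eqI)

lemma M_totally_geodesic: "totally_geodesic_at Mf R (f q)"
  using M.totally_geodesic[OF DM(2) M_radial] by (simp add: base_M)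

text \<open>Pulled back to the chart \<open>c\<close>, a normal vector lies in the kernel of
  \<open>P\<close>, hence in the range of \<open>L\<close>, which is the tangent space of
  \<open>M\<close> there because \<open>F\<close> has identity derivative at 0. The coordinate
  change \<open>T\<close> transports both memberships to \<open>d\<close>.\<close>

lemma normal_subset_tangent:
  assumes "d \<in> charts_at R (f q)"
  shows "normal_subspace N R f d q \<subseteq> tangent_subspace Mf (\<lambda>z. z) d (f q)"
proof
  fix w assume w: "w \<in> normal_subspace N R f d q"
  have d: "d \<in> charts R" "f q \<in> cdom d" using assms by (auto simp: charts_at_def)
  define T where "T = rep c d (\<lambda>z. z)"
  define V where "V = rep_dom c d (\<lambda>z. z)"
  have IT: "isometric_map V (metric R c) (cmap d ` cdom d) (metric R d) T"
    unfolding V_def T_def by (rule transition_isometric[OF R c(1) d(1)])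
  note T = isometric_mapD[OF IT]
  have x0: "cmap c (f q) \<in> V"
    unfolding V_def rep_dom_iff[OF R c(1)] using c(2) d(2) by (simp add: chart_inverse(1)[OF R c])
  have Tx0: "T (cmap c (f q)) = cmap d (f q)" by (simp add: T_def rep_def chart_inverse(1)[OF R c])
  obtain w0 where w0: "w = fderiv T (cmap c (f q)) w0" using isometric_map_surj[OF IT x0] by (metis surjD)
  note If = isometric_mapD[OF isometric_fh]
  define V' where "V' = rep_dom b c f \<inter> fh -` V"
  have V': "open V'" "xq \<in> V'"
    unfolding V'_def using continuous_open_preimage[OF smooth_on_continuous[OF If(3)] If(6) T(6)] base_point x0 by auto
  have rep_d: "rep b d f x = T (fh x)" if "x \<in> V'" for x
  proof -
    have "f (cinv b x) \<in> cdom c" using that rep_dom_iff[OF N b(1), of x c f] by (auto simp: V'_def)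
    then show ?thesis by (simp add: T_def rep_def chart_inverse(1)[OF R c(1)])
  qed
  have "h (A u) w0 = 0" for u
  proof -
    have "fderiv (rep b d f) xq u = fderiv (\<lambda>x. T (fh x)) xq u"
      using fderiv_cong[OF V' rep_d] by simp
    also have "\<dots> = fderiv T (cmap c (f q)) (A u)"
      using fderiv_compose[OF If(3) T(3) base_point(1), of u] x0 by (simp add: base_point(3))
    finally have "fderiv T (cmap c (f q)) (A u) \<in> range (fderiv (rep b d f) xq)" by (metis rangeI)
    moreover have "b \<in> charts_at N q" using b by (simp add: charts_at_def)
    ultimately have "fderiv T (cmap c (f q)) (A u) \<in> tangent_subspace N f d q"
      unfolding tangent_subspace_def by (rule UN_I[rotated])
    then have "metric R d (cmap d (f q)) (fderiv T (cmap c (f q)) (A u)) w = 0"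
      using w by (auto simp: normal_subspace_def)
    then show ?thesis using T(5)[OF x0, of "A u" w0] by (simp add: w0 Tx0)
  qed
  then have "P w0 = 0" using P(3) by blast
  moreover have "0 \<in> W" using l(4) linear_0[OF l(1)] by (metis rangeI)
  ultimately obtain k where k: "w0 = L k" using L(4)[of w0] by auto
  have D0: "0 \<in> {x \<in> DM. F (L x) \<in> V}" using DM(2) x0 by (simp add: linear_0[OF L(1)] F(3))
  have opn: "open {x \<in> DM. F (L x) \<in> V}"
    using continuous_open_preimage[OF smooth_on_continuous[OF M.\<theta>(1)] DM(1) T(6)]
    by (simp add: vimage_def Int_def)
  have "fderiv (rep M.\<kappa> d (\<lambda>z. z)) 0 k = fderiv (\<lambda>x. T (F (L x))) 0 k"
    using fderiv_cong[OF opn D0, of "rep M.\<kappa> d (\<lambda>z. z)" "\<lambda>x. T (F (L x))"] by (simp add: M.rep_\<kappa> T_def)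
  also have "\<dots> = fderiv T (F (L 0)) (fderiv (\<lambda>x. F (L x)) 0 k)"
    by (rule fderiv_compose[OF M.\<theta>(1) T(3) DM(2)]) (use D0 in simp)
  also have "\<dots> = w" by (simp add: fderiv_FL[OF DM(2)] linear_0[OF L(1)] F(3,4) w0 k)
  finally have "w \<in> range (fderiv (rep M.\<kappa> d (\<lambda>z. z)) 0)" by blast
  moreover have "cmap M.\<kappa> (f q) = 0" using M.cmap_\<kappa>_cinv[OF DM(2)] by (simp add: base_M)
  moreover have "M.\<kappa> \<in> charts_at Mf (f q)"
    using fq_in_M by (simp add: charts_at_def M.charts_M M.cdom_\<kappa> M.points_M)
  ultimately show "w \<in> tangent_subspace Mf (\<lambda>z. z) d (f q)"
    unfolding tangent_subspace_def by (intro UN_I[of M.\<kappa>]) simp_all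
qed

end

context geodesic_section
begin

text \<open>Normal coordinates, centred at \<open>f q\<close>, of the points of \<Sigma>.
  \<open>BF\<close> is where they are available, and \<open>\<psi>\<close> projects them to the
  tangent space along the normal space at \<open>q\<close>.\<close>

definition "g x = F' (fh x)"
definition "BF = rep_dom b c f \<inter> fh -` (F ` ball 0 \<delta>)"
definition "\<psi> x = P (g x)"

lemma BF: "open BF" "xq \<in> BF" "BF \<subseteq> rep_dom b c f" "x \<in> BF \<Longrightarrow> fh x \<in> F ` ball 0 \<delta>"
proof -
  show "open BF"
    unfolding BF_def
    by (rule continuous_open_preimage[OF smooth_on_continuous[OF isometric_mapD(3)[OF isometric_fh]] isometric_mapD(6)[OF isometric_fh] F(6)])
  have "fh xq \<in> F ` ball 0 \<delta>" using base_point(3) F(3) zero_ball by (metis imageI)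
  then show "xq \<in> BF" using base_point(1) by (simp add: BF_def)
qed (auto simp: BF_def)

lemma smooth_fh: "smooth_on BF fh"
  by (rule smooth_on_subset[OF isometric_mapD(3)[OF isometric_fh] BF(3)])

lemma smooth_g: "smooth_on BF g"
  unfolding g_def[abs_def]
  by (rule smooth_on_compose[OF BF(1) F(6) _ smooth_fh F(8)]) (use BF(4) in blast)

lemma bounded_linear_P: "bounded_linear P"
  using P(1) by (simp add: linear_conv_bounded_linear)

lemma smooth_\<psi>: "smooth_on BF \<psi>"
  unfolding \<psi>_def[abs_def] by (rule smooth_on_linear_comp[OF bounded_linear_P BF(1) smooth_g])

text \<open>The derivative of \<open>F'\<close> at the base point is the identity and
  \<open>P\<close> is a left inverse of \<open>A\<close>. Hence \<open>\<psi>\<close> has a smooth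
  local inverse, which straightens the intersection to a piece of \<open>W\<close>.\<close>

lemma fderiv_\<psi>: "fderiv \<psi> xq u = u"
proof -
  have "(g has_derivative (\<lambda>u. fderiv F' (fh xq) (A u))) (at xq)"
    unfolding g_def[abs_def]
    using diff_chain_at[OF smooth_on_derivative[OF smooth_fh BF(2)] smooth_on_derivative[OF F(8) BF(4)[OF BF(2)]]]
    by (simp add: o_def)
  then have "(\<psi> has_derivative (\<lambda>u. P (fderiv F' (fh xq) (A u)))) (at xq)"
    unfolding \<psi>_def[abs_def] by (rule bounded_linear.has_derivative[OF bounded_linear_P])
  then show ?thesis by (simp add: fderiv_eq base_point(3) fderiv_F'0 P(2))
qed

lemma g_xq: "g xq = 0" and \<psi>_xq: "\<psi> xq = 0"
  using F'_F[OF zero_ball] by (simp_all add: g_def \<psi>_def base_point(3) F(3) linear_0[OF P(1)])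

end

text \<open>A second locale, because \<open>U\<close>, \<open>V\<close> and \<open>\<psi>'\<close>
  come from the inverse function theorem only after \<open>\<psi>\<close> has been built in the
  first one.\<close>

locale geodesic_section_inverse = geodesic_section R N f q b c W P L L' l l' F F' \<delta>
  for R :: "('p::{t2_space,second_countable_topology}, 'e::euclidean_space) riem"
    and N :: "('b::{t2_space,second_countable_topology}, 'm::euclidean_space) riem"
    and f q b c W P and L :: "'k::euclidean_space \<Rightarrow> 'e" and L'
    and l :: "'l::euclidean_space \<Rightarrow> 'm" and l' F F' \<delta> +
  fixes U V \<psi>'
  assumes U: "open U" "U \<subseteq> BF" "xq \<in> U" and V: "open V" "\<psi> xq \<in> V"
    and \<psi>_hom: "homeomorphism U V \<psi> \<psi>'" and smooth_\<psi>': "smooth_on V \<psi>'"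
begin

definition "DS = l -` V"

definition "\<theta> w = \<psi>' (l w)"

lemma \<psi>'_\<psi>: "x \<in> U \<Longrightarrow> \<psi>' (\<psi> x) = x" and \<psi>_\<psi>': "y \<in> V \<Longrightarrow> \<psi> (\<psi>' y) = y"
  and \<psi>'_U: "y \<in> V \<Longrightarrow> \<psi>' y \<in> U" and \<psi>_V: "x \<in> U \<Longrightarrow> \<psi> x \<in> V"
  using \<psi>_hom by (auto simp: homeomorphism_def)

lemma bounded_linear_l: "bounded_linear l"
  using l(1) by (simp add: linear_conv_bounded_linear)

lemma DS: "open DS" "0 \<in> DS" "l ` DS \<subseteq> V"
proof -
  show "open DS" unfolding DS_def
    by (rule open_vimage[OF V(1) linear_continuous_on[OF bounded_linear_l]])
qed (use V(2) in \<open>auto simp: DS_def linear_0[OF l(1)] \<psi>_xq\<close>)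

lemma smooth_l: "smooth_on DS l"
  by (rule smooth_on_linear[OF bounded_linear_l DS(1)])

lemma smooth_\<theta>: "smooth_on DS \<theta>"
  unfolding \<theta>_def[abs_def] by (rule smooth_on_compose[OF DS(1) V(1) DS(3) smooth_l smooth_\<psi>'])

lemma \<theta>_U: "w \<in> DS \<Longrightarrow> \<theta> w \<in> U" and \<psi>_\<theta>: "w \<in> DS \<Longrightarrow> \<psi> (\<theta> w) = l w"
  by (auto simp: \<theta>_def DS_def \<psi>'_U \<psi>_\<psi>')

lemma \<theta>_BF: "\<theta> ` DS \<subseteq> BF"
  using \<theta>_U U(2) by blast

lemma \<theta>_0: "\<theta> 0 = xq"
  using \<psi>'_\<psi>[OF U(3)] by (simp add: \<theta>_def linear_0[OF l(1)] \<psi>_xq)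

lemma fderiv_\<psi>_\<theta>: "w \<in> DS \<Longrightarrow> fderiv \<psi> (\<theta> w) (fderiv \<theta> w u) = l u"
proof -
  assume w: "w \<in> DS"
  have "fderiv (\<lambda>w. \<psi> (\<theta> w)) w u = fderiv \<psi> (\<theta> w) (fderiv \<theta> w u)"
    by (rule fderiv_compose[OF smooth_\<theta> smooth_\<psi> w]) (use \<theta>_BF w in blast)
  moreover have "fderiv (\<lambda>w. \<psi> (\<theta> w)) w = fderiv l w"
    by (rule fderiv_cong[OF DS(1) w \<psi>_\<theta>])
  ultimately show ?thesis
    by (simp add: fderiv_eq[OF bounded_linear_imp_has_derivative[OF bounded_linear_l]])
qed

lemma fderiv_\<theta>_0: "fderiv \<theta> 0 u = l u"
  using fderiv_\<psi>_\<theta>[OF DS(2), of u] by (simp add: \<theta>_0 fderiv_\<psi>)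

sublocale S: parametrization N b DS \<theta> "\<lambda>x. l' (\<psi> x)"
proof
  show "\<theta> ` DS \<subseteq> cmap b ` cdom b"
    by (rule order_trans[OF \<theta>_BF order_trans[OF BF(3) rep_dom_subset]])
  show "homeomorphism DS (\<theta> ` DS) \<theta> (\<lambda>x. l' (\<psi> x))"
  proof (rule homeomorphismI)
    show "continuous_on DS \<theta>" by (rule smooth_on_continuous[OF smooth_\<theta>])
    show "continuous_on (\<theta> ` DS) (\<lambda>x. l' (\<psi> x))"
      by (rule linear_continuous_on_compose[OF continuous_on_subset[OF smooth_on_continuous[OF smooth_\<psi>] \<theta>_BF] l(2)])
  qed (auto simp: \<psi>_\<theta> l(3))
  fix w assume w: "w \<in> DS"
  show "inj (fderiv \<theta> w)"
    by (rule inj_on_inverseI[of _ "\<lambda>x. l' (fderiv \<psi> (\<theta> w) x)"]) (simp add: fderiv_\<psi>_\<theta>[OF w] l(3))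
qed (use N b DS smooth_\<theta> in auto)

abbreviation "Sf \<equiv> param_submanifold N b DS \<theta> (\<lambda>x. l' (\<psi> x))"

lemma base_S: "cinv b (\<theta> 0) = q"
  by (simp add: \<theta>_0 base_point(2))

lemma q_in_S: "q \<in> points Sf"
  using DS(2) base_S by (auto simp: S.points_M intro!: rev_image_eqI)

lemma cmap_S_q: "cmap S.\<kappa> q = 0"
  using S.cmap_\<kappa>_cinv[OF DS(2)] by (simp add: base_S)

lemma fh_eq: "x \<in> BF \<Longrightarrow> fh x = F (g x)" and g_ball: "x \<in> BF \<Longrightarrow> g x \<in> ball 0 \<delta>"
  unfolding g_def using F_F'[OF BF(4)] F'_ball[OF BF(4)] by simp_all

text \<open>Near the base point, \<open>M\<close> consists of the points whose normal coordinates
  lie in the range of \<open>L\<close>, and this range is the preimage of \<open>W\<close> under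
  \<open>P\<close>.\<close>

lemma section_iff:
  assumes z: "z \<in> cdom b" "cmap b z \<in> U"
  shows "f z \<in> points Mf \<longleftrightarrow> \<psi> (cmap b z) \<in> W"
proof -
  define x where "x = cmap b z"
  have x: "x \<in> BF" "cinv b x = z" using z U(2) by (auto simp: x_def chart_inverse(1)[OF N b(1)])
  have fz: "f z \<in> cdom c" using BF(3) x rep_dom_iff[OF N b(1), of x c f] by auto
  have fhx: "fh x = cmap c (f z)" by (simp add: rep_def x(2))
  have "f z \<in> points Mf \<longleftrightarrow> g x \<in> range L"
  proof
    assume "f z \<in> points Mf"
    then obtain k where k: "k \<in> DM" "f z = cinv c (F (L k))" by (auto simp: M.points_M)
    then have "fh x = F (L k)" using chart_inverse(2)[OF R c(1) M.\<theta>_in[OF k(1)]] by (simp add: fhx)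
    then have "g x = L k" using k(1) DM(3) by (auto simp: g_def F'_F)
    then show "g x \<in> range L" by blast
  next
    assume "g x \<in> range L"
    then obtain k where k: "g x = L k" by blast
    then have "k \<in> DM" using g_ball[OF x(1)] by (simp add: DM_def)
    moreover have "f z = cinv c (F (L k))"
      using fh_eq[OF x(1)] fhx chart_inverse(1)[OF R c(1) fz] by (simp add: k)
    ultimately show "f z \<in> points Mf" by (auto simp: M.points_M)
  qed
  then show ?thesis by (simp add: L(4) \<psi>_def x_def)
qed

lemma S_local_intersection: "local_intersection Sf Mf N f q"
proof -
  \<comment> \<open>The part of \<Sigma> on which \<open>\<psi>\<close> is invertible serves as the
    neighbourhood of \<open>q\<close>.\<close>
  define V' where "V' = cdom b \<inter> cmap b -` U"
  have "openin (top_of_set (cdom b)) V'"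
    unfolding V'_def
    by (rule continuous_openin_preimage_gen[OF homeomorphism_cont1[OF chart_homeomorphism(1)[OF N b(1)]] U(1)])
  then have "openin (top_of_set (points N)) V'"
    by (rule openin_trans[OF _ chart_homeomorphism(3)[OF N b(1)]])
  moreover have "q \<in> V'" using b(2) U(3) by (simp add: V'_def)
  moreover have "points Sf = {z \<in> V'. f z \<in> points Mf}"
  proof (intro set_eqI iffI)
    fix z assume "z \<in> points Sf"
    then obtain w where w: "w \<in> DS" "z = cinv b (\<theta> w)" by (auto simp: S.points_M)
    then have z: "z \<in> cdom b" "cmap b z = \<theta> w"
      using chart_inverse(2,3)[OF N b(1) S.\<theta>_in[OF w(1)]] by auto
    then have "z \<in> V'" using \<theta>_U[OF w(1)] by (simp add: V'_def)
    moreover have "\<psi> (cmap b z) \<in> W" using \<psi>_\<theta>[OF w(1)] l(4) by (auto simp: z)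
    ultimately show "z \<in> {z \<in> V'. f z \<in> points Mf}" using section_iff[of z] by (simp add: V'_def)
  next
    fix z assume "z \<in> {z \<in> V'. f z \<in> points Mf}"
    then have z: "z \<in> cdom b" "cmap b z \<in> U" "\<psi> (cmap b z) \<in> W"
      using section_iff[of z] by (auto simp: V'_def)
    then obtain w where w: "\<psi> (cmap b z) = l w" using l(4) by auto
    then have "w \<in> DS" using \<psi>_V[OF z(2)] by (simp add: DS_def)
    moreover have "\<theta> w = cmap b z" using \<psi>'_\<psi>[OF z(2)] by (simp add: \<theta>_def w)
    ultimately show "z \<in> points Sf" using chart_inverse(1)[OF N b(1) z(1)] by (auto simp: S.points_M intro!: rev_image_eqI)
  qed
  ultimately show ?thesis unfolding local_intersection_def using S.submanifold_M by blast
qed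

text \<open>The two sides differ by a vector tangent to \<open>N\<close>. It lies in the image of \<open>W\<close>, because the second
  fundamental form of \<open>S\<close> is tangent to the totally geodesic \<open>M\<close>, and it is orthogonal to that image.\<close>

lemma second_form_S:
  "second_form (metric Sf S.\<kappa>) (metric R c) (rep S.\<kappa> c f) 0 u u =
   second_form (metric N b) (metric R c) fh xq (l u) (l u)" (is "?lhs = ?rhs")
proof -
  let ?gS = "metric Sf S.\<kappa>" and ?hR = "metric R c"
  note DS0 = DS(2)
  have img: "\<theta> ` DS \<subseteq> rep_dom b c f" using \<theta>_BF BF(3) by blast
  have rep: "rep S.\<kappa> c f w = fh (\<theta> w)" if "w \<in> DS" for w by (rule S.rep_\<kappa>[OF that])
  have lhs: "?lhs = second_form ?gS ?hR (\<lambda>w. fh (\<theta> w)) 0 u u"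
    by (rule fun_cong[OF fun_cong[OF second_form_cong[OF DS(1) DS0 rep]]])
  \<comment> \<open>\<open>S\<close> as a submanifold of \<Sigma>: the two sides differ by a vector
    tangent to \<Sigma>.\<close>
  obtain a1 where a1: "?lhs = ?rhs + A a1"
    using second_form_compose[OF isometric_fh smooth_\<theta> DS(1) img DS0, of ?gS u] unfolding lhs
    by (simp add: \<theta>_0 fderiv_\<theta>_0)
  \<comment> \<open>\<open>S\<close> as a submanifold of \<open>M\<close>: \<open>j\<close> is the
    inclusion in the coordinates of \<open>M\<close>.\<close>
  define j where "j w = L' (g (\<theta> w))" for w
  have g\<theta>: "smooth_on DS (\<lambda>w. g (\<theta> w))"
    by (rule smooth_on_compose[OF DS(1) BF(1) \<theta>_BF smooth_\<theta> smooth_g])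
  have j: "smooth_on DS j"
    unfolding j_def[abs_def]
    by (rule smooth_on_linear_comp[OF linear_conv_bounded_linear[THEN iffD1, OF L(2)] DS(1) g\<theta>])
  have Lj: "L (j w) = g (\<theta> w)" if w: "w \<in> DS" for w
  proof -
    have "P (g (\<theta> w)) \<in> W" using \<psi>_\<theta>[OF w] l(4) by (auto simp: \<psi>_def)
    then have "g (\<theta> w) \<in> range L" using L(4) by blast
    then show ?thesis by (auto simp: j_def L(3))
  qed
  have jDM: "j ` DS \<subseteq> DM"
  proof (rule image_subsetI)
    fix w assume w: "w \<in> DS"
    then have "g (\<theta> w) \<in> ball 0 \<delta>" using g_ball \<theta>_BF by blast
    then show "j w \<in> DM" by (simp add: DM_def Lj[OF w])
  qed
  have rep': "rep S.\<kappa> c f w = F (L (j w))" if w: "w \<in> DS" for w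
    using rep[OF w] fh_eq[of "\<theta> w"] \<theta>_BF w by (auto simp: Lj)
  have lhs': "?lhs = second_form ?gS ?hR (\<lambda>w. F (L (j w))) 0 u u"
    by (rule fun_cong[OF fun_cong[OF second_form_cong[OF DS(1) DS0 rep']]])
  have j0: "j 0 = 0" by (simp add: j_def \<theta>_0 g_xq linear_0[OF L(2)])
  \<comment> \<open>The radial identity at \<open>t = 0\<close> holds in every direction, so the
    second form of \<open>M\<close> vanishes on the diagonal at the base point.\<close>
  have "second_form (metric Mf M.\<kappa>) ?hR (\<lambda>x. F (L x)) 0 v v = 0" for v
    using M.radial_christoffel(2)[OF _ DM(2), of v] M_radial[of 0 v] DM(2) by simp
  then obtain a2 where a2: "?lhs = L a2"
    using second_form_compose[OF M.isometric_\<theta> j DS(1) jDM DS0, of ?gS u M.\<kappa>] unfolding lhs'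
    by (simp add: j0 fderiv_FL[OF DM(2)] linear_0[OF L(1)] F(4))
  have x0: "fh xq = cmap c (f q)" by (rule base_point(3))
  have rhs_normal: "h ?rhs (A w) = 0" for w
    using second_form_normal[OF isometric_fh base_point(1), of "l u" "l u" w] by (simp add: x0)
  have IS: "isometric_map DS ?gS (cmap c ` cdom c) ?hR (\<lambda>w. fh (\<theta> w))"
  proof -
    have "{w \<in> DS. \<theta> w \<in> rep_dom b c f} = DS" using img by blast
    then show ?thesis using isometric_map_compose[OF S.isometric_\<theta> isometric_fh, of S.\<kappa>] by simp
  qed
  have "fderiv (\<lambda>w. fh (\<theta> w)) 0 w = A (l w)" for w
    using fderiv_compose[OF smooth_\<theta> smooth_fh DS0, of w] BF(2) by (simp add: \<theta>_0 fderiv_\<theta>_0)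
  then have lhs_normal: "h ?lhs (A (l w)) = 0" for w
    using second_form_normal[OF IS DS0, of u u w] unfolding lhs by (simp add: \<theta>_0 x0)
  \<comment> \<open>\<open>P\<close> annihilates the normal vector and reads off \<open>a1\<close>.
    As the left side lies in the range of \<open>L\<close>, \<open>a1\<close> lies in
    \<open>W\<close>; orthogonality of both sides to the image of \<open>W\<close> then forces
    \<open>A a1\<close> to vanish.\<close>
  have "P ?rhs = 0" using P(3)[of ?rhs] rhs_normal ambient_metric(2)[of ?rhs] by simp
  then have "P ?lhs = a1" unfolding a1 by (simp add: linear_add[OF P(1)] P(2))
  moreover have "P ?lhs \<in> W" unfolding a2 using L(4) by blast
  ultimately obtain w where w: "a1 = l w" using l(4) by auto
  have "h (A a1) (A a1) = h ?lhs (A (l w)) - h ?rhs (A (l w))"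
    using a1 bilinear_ladd[OF ambient_metric(1), of ?rhs "A a1" "A (l w)"] w by simp
  then have "h (A a1) (A a1) = 0" by (simp add: lhs_normal rhs_normal)
  then have "A a1 = 0" using ambient_metric(3)[of "A a1"] by force
  then show ?thesis using a1 by simp
qed

lemma metric_S: "metric Sf S.\<kappa> 0 u v = u \<bullet> v"
  by (simp add: S.metric_M fderiv_\<theta>_0 \<theta>_0 l_isometric)

text \<open>At \<open>q\<close> the metric of \<open>S\<close> is the standard inner product, so
  \<open>Basis\<close> is an orthonormal frame and may replace the one chosen in
  \<open>mean_curvature\<close>.\<close>

lemma mean_curvature_S:
  "mean_curvature Sf R f S.\<kappa> c q = (1 / real DIM('l)) *\<^sub>R
     (\<Sum>i\<in>Basis. second_form (metric N b) (metric R c) fh xq (l i) (l i))"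
proof -
  define Q where "Q u v = second_form (metric N b) (metric R c) fh xq (l u) (l v)" for u v
  note bil = bilinear_second_form[OF isometric_fh base_point(1)]
  have Q: "bilinear Q"
    unfolding bilinear_def Q_def
    by (auto intro!: linearI simp: linear_add[OF l(1)] linear_cmul[OF l(1)] bilinear_ladd[OF bil] bilinear_lmul[OF bil]
        bilinear_radd[OF bil] bilinear_rmul[OF bil])
  define E where "E = (SOME E. orthonormal_frame (\<lambda>u v :: 'l. u \<bullet> v) E)"
  have Basis: "orthonormal_frame (\<lambda>u v :: 'l. u \<bullet> v) Basis"
    by (simp add: orthonormal_frame_def inner_Basis)
  then have "orthonormal_frame (\<lambda>u v :: 'l. u \<bullet> v) E" unfolding E_def by (rule someI)
  moreover have "bilinear (\<lambda>u v :: 'l. u \<bullet> v)"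
    using bilinear_conv_bounded_bilinear bounded_bilinear_inner by blast
  ultimately have "(\<Sum>e\<in>E. Q e e) = (\<Sum>i\<in>Basis. Q i i)"
    using trace_frame_independent[OF _ inner_commute Q _ Basis] by blast
  moreover have "metric Sf S.\<kappa> 0 = (\<lambda>u v. u \<bullet> v)" by (intro ext) (rule metric_S)
  ultimately show ?thesis
    unfolding mean_curvature_def second_fundamental_form_eq cmap_S_q by (simp add: E_def second_form_S Q_def)
qed

end

text \<open>The data of the two locales are assembled for the span \<open>W\<close> of
  \<open>T\<close>. The dimension condition says that the image of \<open>W\<close> plus the normal
  space has the dimension of \<open>'k\<close>.\<close>

lemma totally_geodesic_section_exists:
  fixes R :: "('p::{t2_space,second_countable_topology}, 'e::euclidean_space) riem"
    and N :: "('b::{t2_space,second_countable_topology}, 'm::euclidean_space) riem"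
  assumes R: "riemannian_manifold R" and N: "riemannian_manifold N" and f: "isometric_immersion N R f"
    and b: "b \<in> charts_at N q" and c: "c \<in> charts_at R (f q)"
    and dim: "DIM('k::euclidean_space) + DIM('m) = DIM('l::euclidean_space) + DIM('e)"
    and T: "finite T" "card T = DIM('l)" "orthonormal_set (metric N b (cmap b q)) T"
  shows "\<exists>(M :: ('p, 'k) riem) (S :: ('b, 'l) riem). submanifold M R \<and> f q \<in> points M \<and>
    totally_geodesic_at M R (f q) \<and>
    (\<forall>d\<in>charts_at R (f q). normal_subspace N R f d q \<subseteq> tangent_subspace M (\<lambda>z. z) d (f q)) \<and>
    local_intersection S M N f q \<and>
    (\<exists>b'\<in>charts_at S q. mean_curvature S R f b' c q = (1 / real DIM('l)) *\<^sub>R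
      (\<Sum>e\<in>T. second_form (metric N b) (metric R c) (rep b c f) (cmap b q) e e))"
proof -
  have b': "b \<in> charts N" "q \<in> cdom b" and c': "c \<in> charts R" "f q \<in> cdom c"
    using b c by (auto simp: charts_at_def)
  define xq where "xq = cmap b q"
  define x0 where "x0 = cmap c (f q)"
  define A where "A = fderiv (rep b c f) xq"
  define B where "B = metric N b xq"
  define h where "h = metric R c x0"
  note I = immersion_isometric[OF N b'(1) R c'(1) f]
  have x0: "x0 \<in> cmap c ` cdom c" using c'(2) by (auto simp: x0_def)
  have xq: "xq \<in> rep_dom b c f" "rep b c f xq = x0"
    using b'(2) c'(2) by (simp_all add: rep_dom_iff[OF N b'(1)] xq_def x0_def rep_def chart_inverse(1)[OF N b'(1)])
  have hh: "bilinear h" "\<And>u v. h u v = h v u"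
    using riemannian_fieldD(2,3)[OF isometric_mapD(2)[OF I] x0] by (simp_all add: h_def)
  have BB: "bilinear B" "\<And>u v. B u v = B v u" "\<And>u. u \<noteq> 0 \<Longrightarrow> B u u > 0"
    using riemannian_fieldD(2-4)[OF isometric_mapD(1)[OF I] xq(1)] unfolding B_def by blast+
  have hA: "h (A u) (A v) = B u v" for u v
    using isometric_mapD(5)[OF I xq(1)] by (simp add: h_def A_def B_def xq(2))
  have A: "linear A"
    unfolding A_def by (rule smooth_on_linear_fderiv[OF isometric_mapD(3)[OF I] xq(1)])
  obtain E where E: "orthonormal_frame B E" using orthonormal_frame_exists[OF BB] by blast
  have E': "orthonormal_frame (\<lambda>u v. h (A u) (A v)) E" using E by (simp add: hA)
  define P where "P w = (\<Sum>e\<in>E. h w (A e) *\<^sub>R e)" for w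
  have P: "linear P" "\<And>u. P (A u) = u" "\<And>w. P w = 0 \<longleftrightarrow> (\<forall>u. h (A u) w = 0)"
    using normal_projection[OF hh A E'] unfolding P_def[abs_def] by blast+
  define W where "W = span T"
  have on: "orthonormal_set B T" using T(3) by (simp add: B_def xq_def)
  have dimW: "dim W = DIM('l)"
    unfolding W_def using dim_span_eq_card_independent[OF orthonormal_set_independent[OF BB(1) on T(1)]] T(2) by simp
  have W: "subspace W" by (simp add: W_def)
  define Y where "Y = {x. P x \<in> W}"
  have Y: "subspace Y" "dim Y = DIM('k)"
    using dim_linear_vimage[OF A P(1,2) W] dim dimW by (simp_all add: Y_def)
  have dimk: "dim (UNIV :: 'k set) = dim Y" using Y(2) by simp
  obtain L :: "'k \<Rightarrow> 'e" and L' where L: "linear L" "linear L'" "L ` UNIV = Y" "\<And>x. L' (L x) = x"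
    by (rule isometries_subspaces[OF subspace_UNIV Y(1) dimk]) (auto intro: that)
  have L_range: "y \<in> range L \<longleftrightarrow> P y \<in> W" for y using L(3) by (simp add: Y_def)
  obtain \<phi> where \<phi>: "bij_betw \<phi> T (Basis :: 'l set)"
    using finite_same_card_bij[OF T(1) finite_Basis] T(2) by metis
  \<comment> \<open>\<open>l\<close> maps the standard basis bijectively onto \<open>T\<close>,
    hence is isometric for \<open>B\<close>, and the trace over the basis of \<open>'l\<close>
    becomes the trace over \<open>T\<close>.\<close>
  define l where "l u = (\<Sum>e\<in>T. (u \<bullet> \<phi> e) *\<^sub>R e)" for u
  have l: "linear l"
    by (rule linearI) (simp_all add: l_def inner_add_left scaleR_add_left sum.distrib scaleR_sum_right)
  have Bl: "B (l u) (l v) = u \<bullet> v" for u v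
  proof -
    have "B (l u) (l v) = (\<Sum>e\<in>T. (u \<bullet> \<phi> e) *\<^sub>R B e (l v))"
      unfolding l_def[of u] by (rule bilinear_sum_left[OF BB(1)])
    also have "\<dots> = (\<Sum>e\<in>T. (u \<bullet> \<phi> e) * (v \<bullet> \<phi> e))"
    proof (rule sum.cong[OF refl])
      fix e assume "e \<in> T"
      then show "(u \<bullet> \<phi> e) *\<^sub>R B e (l v) = (u \<bullet> \<phi> e) * (v \<bullet> \<phi> e)"
        using orthonormal_set_coefficient[OF BB(1) on T(1), of e "\<lambda>e. v \<bullet> \<phi> e"] BB(2)[of e] by (simp add: l_def)
    qed
    also have "\<dots> = (\<Sum>i\<in>Basis. (u \<bullet> i) * (v \<bullet> i))" by (rule sum.reindex_bij_betw[OF \<phi>])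
    finally show ?thesis by (simp add: euclidean_inner[of u v])
  qed
  have "inj l"
    unfolding linear_injective_0[OF l]
  proof (intro allI impI)
    fix u assume "l u = 0"
    then have "u \<bullet> u = 0" using Bl[of u u] bilinear_lzero[OF BB(1)] by simp
    then show "u = 0" by simp
  qed
  then obtain l' where l': "linear l'" "l' \<circ> l = id" using linear_injective_left_inverse[OF l] by blast
  have l_T: "l (\<phi> e) = e" if e: "e \<in> T" for e
  proof -
    have "(\<phi> e \<bullet> \<phi> e') *\<^sub>R e' = (if e' = e then e' else 0)" if "e' \<in> T" for e'
    proof -
      have "\<phi> e \<in> Basis" "\<phi> e' \<in> Basis" "\<phi> e = \<phi> e' \<longleftrightarrow> e = e'"
        using \<phi> e that by (auto simp: bij_betw_def inj_on_eq_iff)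
      then show ?thesis by (simp add: inner_Basis)
    qed
    then have "l (\<phi> e) = (\<Sum>e'\<in>T. if e' = e then e' else 0)" unfolding l_def by (rule sum.cong[OF refl])
    then show ?thesis using T(1) e by simp
  qed
  have l_range: "range l = W"
  proof
    show "range l \<subseteq> W"
      unfolding W_def l_def by (intro image_subsetI span_sum span_scale) (rule span_base)
    have "T \<subseteq> range l" using l_T by (metis rangeI subsetI)
    then show "W \<subseteq> range l" unfolding W_def by (rule span_minimal) (rule linear_subspace_image[OF l subspace_UNIV])
  qed
  obtain \<delta> F F' where F: "\<delta> > 0" "smooth_on (ball 0 \<delta>) F" "F ` ball 0 \<delta> \<subseteq> cmap c ` cdom c" "F 0 = x0"
    "\<And>w. fderiv F 0 w = w"
    "\<And>t v. t *\<^sub>R v \<in> ball 0 \<delta> \<Longrightarrow> fderiv (\<lambda>a. fderiv F a v) (t *\<^sub>R v) v +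
       christoffel (metric R c) (F (t *\<^sub>R v)) (fderiv F (t *\<^sub>R v) v) (fderiv F (t *\<^sub>R v) v) = 0"
    "open (F ` ball 0 \<delta>)" "homeomorphism (ball 0 \<delta>) (F ` ball 0 \<delta>) F F'" "smooth_on (F ` ball 0 \<delta>) F'"
    "\<And>x. x \<in> ball 0 \<delta> \<Longrightarrow> bij (fderiv F x)"
    by (rule exponential_map[OF chart_riemannian_field[OF R c'(1)] x0]) (rule that)
  have l'l: "l' (l x) = x" for x using l'(2) by (metis comp_apply id_apply)
  note facts = P(2,3)[unfolded A_def h_def xq_def x0_def] Bl[unfolded B_def xq_def] F(4)[unfolded x0_def]
  interpret G: geodesic_section R N f q b c W P L L' l l' F F' \<delta>
    by (rule geodesic_section.intro)
      (fact R N f b' c' P(1) L(1,2,4) L_range l l'(1) l'l l_range facts F(1-3) F(5-10))+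
  have "inj (fderiv G.\<psi> G.xq)" by (simp add: inj_on_def G.fderiv_\<psi>)
  then obtain U V \<psi>' where UV: "open U" "U \<subseteq> G.BF" "G.xq \<in> U" "open V" "G.\<psi> G.xq \<in> V"
    "homeomorphism U V G.\<psi> \<psi>'" "smooth_on V \<psi>'"
    by (rule smooth_inverse_function[OF G.BF(1) G.smooth_\<psi> G.BF(2)]) (rule that)
  interpret S: geodesic_section_inverse R N f q b c W P L L' l l' F F' \<delta> U V \<psi>'
    by unfold_locales (use UV in simp_all)
  have "(\<Sum>i\<in>Basis. second_form (metric N b) (metric R c) (rep b c f) xq (l i) (l i)) =
     (\<Sum>e\<in>T. second_form (metric N b) (metric R c) (rep b c f) xq (l (\<phi> e)) (l (\<phi> e)))"
    by (rule sum.reindex_bij_betw[OF \<phi>, symmetric])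
  also have "\<dots> = (\<Sum>e\<in>T. second_form (metric N b) (metric R c) (rep b c f) xq e e)"
    by (rule sum.cong[OF refl]) (simp add: l_T)
  finally have "mean_curvature S.Sf R f S.S.\<kappa> c q = (1 / real DIM('l)) *\<^sub>R
      (\<Sum>e\<in>T. second_form (metric N b) (metric R c) (rep b c f) (cmap b q) e e)"
    using S.mean_curvature_S by (simp add: xq_def)
  moreover have "S.S.\<kappa> \<in> charts_at S.Sf q"
    using S.q_in_S by (simp add: charts_at_def S.S.charts_M S.S.cdom_\<kappa> S.S.points_M)
  ultimately show ?thesis
    using G.M.submanifold_M G.fq_in_M G.M_totally_geodesic G.normal_subset_tangent S.S_local_intersection
    by blast
qed

text \<open>The dimensions of \<open>M\<close> and \<open>S\<close> are carried by the types
  \<open>'k\<close> and \<open>'l\<close>. \<open>H\<close> is a function of the chart because a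
  mean curvature vector is given by its components.\<close>

theorem theorem2:
  fixes Mbar :: "('p::{t2_space,second_countable_topology}, 'e::euclidean_space) riem"
    and Sigma :: "('b::{t2_space,second_countable_topology}, 'm::euclidean_space) riem"
    and f :: "'b \<Rightarrow> 'p" and q :: 'b and m n s :: nat
  assumes "riemannian_manifold Mbar" and "DIM('e) = m + n"
    and "riemannian_manifold Sigma" and "DIM('m) = m" and "m \<ge> 2"
    and "isometric_immersion Sigma Mbar f" and "q \<in> points Sigma"
    and "0 < s" and "s \<le> m - 1"
    and "DIM('k::euclidean_space) = s + n" and "DIM('l::euclidean_space) = s"
    and "\<exists>H. \<forall>(M :: ('p, 'k) riem) (S :: ('b, 'l) riem).
           submanifold M Mbar \<and> f q \<in> points M \<and> totally_geodesic_at M Mbar (f q) \<and>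
           (\<forall>c\<in>charts_at Mbar (f q).
              normal_subspace Sigma Mbar f c q \<subseteq> tangent_subspace M (\<lambda>z. z) c (f q)) \<and>
           local_intersection S M Sigma f q \<longrightarrow>
           (\<forall>b\<in>charts_at S q. \<forall>c\<in>charts_at Mbar (f q).
              mean_curvature S Mbar f b c q = H c)"
  shows "umbilic_at Sigma Mbar f q"
proof -
  obtain H where H: "\<And>(M :: ('p, 'k) riem) (S :: ('b, 'l) riem) b c.
      submanifold M Mbar \<Longrightarrow> f q \<in> points M \<Longrightarrow> totally_geodesic_at M Mbar (f q) \<Longrightarrow>
      (\<forall>c\<in>charts_at Mbar (f q). normal_subspace Sigma Mbar f c q \<subseteq> tangent_subspace M (\<lambda>z. z) c (f q)) \<Longrightarrow>
      local_intersection S M Sigma f q \<Longrightarrow> b \<in> charts_at S q \<Longrightarrow> c \<in> charts_at Mbar (f q) \<Longrightarrow>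
      mean_curvature S Mbar f b c q = H c"
    using assms(12) by blast
  have dim: "DIM('k) + DIM('m) = DIM('l) + DIM('e)" using assms by simp
  have "second_fundamental_form Sigma Mbar f b c q u v =
      metric Mbar c (cmap c (f q)) (fderiv (rep b c f) (cmap b q) u) (fderiv (rep b c f) (cmap b q) v) *\<^sub>R
        mean_curvature Sigma Mbar f b c q"
    if b: "b \<in> charts_at Sigma q" and c: "c \<in> charts_at Mbar (f q)" for b c u v
  proof -
    have b': "b \<in> charts Sigma" "q \<in> cdom b" and c': "c \<in> charts Mbar" "f q \<in> cdom c"
      using b c by (auto simp: charts_at_def)
    define B where "B = metric Sigma b (cmap b q)"
    define Q where "Q = second_form (metric Sigma b) (metric Mbar c) (rep b c f) (cmap b q)"
    note I = immersion_isometric[OF assms(3) b'(1) assms(1) c'(1) assms(6)]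
    have xq: "cmap b q \<in> rep_dom b c f" "rep b c f (cmap b q) = cmap c (f q)"
      using b'(2) c'(2) by (simp_all add: rep_dom_iff[OF assms(3) b'(1)] rep_def chart_inverse(1)[OF assms(3) b'(1)])
    have BB: "bilinear B" "\<And>u v. B u v = B v u" "\<And>u. u \<noteq> 0 \<Longrightarrow> B u u > 0"
      using riemannian_fieldD(2-4)[OF isometric_mapD(1)[OF I] xq(1)] unfolding B_def by blast+
    have Q: "bilinear Q" "\<And>u v. Q u v = Q v u"
      unfolding Q_def by (rule bilinear_second_form[OF I xq(1)], rule second_form_symmetric[OF I xq(1)])
    \<comment> \<open>The frame that \<open>mean_curvature\<close> itself selects, so that the
      conclusion matches its unfolded definition.\<close>
    define E where "E = (SOME E. orthonormal_frame B E)"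
    have E: "orthonormal_frame B E"
      unfolding E_def using orthonormal_frame_exists[OF BB] by (rule someI_ex)
    \<comment> \<open>Each orthonormal \<open>s\<close>-set is realized by an admissible section,
      whose mean curvature is the normalized trace over it and equals \<open>H c\<close>; the factor
      \<open>real s\<close> undoes the normalization.\<close>
    have trace: "(\<Sum>e\<in>T. Q e e) = real s *\<^sub>R H c" if T: "finite T" "card T = s" "orthonormal_set B T" for T
    proof -
      have T': "card T = DIM('l)" using T(2) assms(11) by simp
      obtain M :: "('p, 'k) riem" and S :: "('b, 'l) riem" and b' where
        "submanifold M Mbar" "f q \<in> points M" "totally_geodesic_at M Mbar (f q)"
        "\<forall>d\<in>charts_at Mbar (f q). normal_subspace Sigma Mbar f d q \<subseteq> tangent_subspace M (\<lambda>z. z) d (f q)"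
        "local_intersection S M Sigma f q" "b' \<in> charts_at S q"
        and mc: "mean_curvature S Mbar f b' c q = (1 / real DIM('l)) *\<^sub>R (\<Sum>e\<in>T. Q e e)"
        using totally_geodesic_section_exists[OF assms(1,3,6) b c dim T(1) T' T(3)[unfolded B_def]]
        unfolding Q_def by blast
      from H[OF this(1-6) c] have "(1 / real DIM('l)) *\<^sub>R (\<Sum>e\<in>T. Q e e) = H c" by (simp add: mc)
      then have "real s *\<^sub>R ((1 / real s) *\<^sub>R (\<Sum>e\<in>T. Q e e)) = real s *\<^sub>R H c" by (simp add: assms(11))
      then show ?thesis using assms(8) by simp
    qed
    have "s \<le> DIM('m) - 1" using assms(4,9) by simp
    from bilinear_umbilic_if_partial_traces_constant[OF BB(1,2) Q E assms(8) this trace]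
    have "Q u v = B u v *\<^sub>R ((1 / real DIM('m)) *\<^sub>R (\<Sum>e\<in>E. Q e e))" .
    then show ?thesis
      using isometric_mapD(5)[OF I xq(1), of u v]
      unfolding mean_curvature_def second_fundamental_form_eq by (simp add: Q_def E_def B_def xq(2))
  qed
  then show ?thesis unfolding umbilic_at_def Let_def by blast
qed

end
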